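(* Let $G$ be a compactly generated locally compact group of polynomial growth, let $\mu$ be a courteous probability measure on $G$, and let $k\ge 1$ be an integer. Then the space $HF_k(G,\mu)$ of $\mu$-harmonic functions on $G$ with polynomial growth of degree at most $k$ is finite dimensional (as a complex vector space).
   Context: Let $S$ be a compact symmetric ($S=S^{-1}$) subset of $G$ containing $1$ with $G=\bigcup_{n\ge1}S^n$, where $S^n=\{s_1\cdots s_n: s_i\in S\}$ and $S^0=\{1\}$. Let $\mathfrak m$ be the left Haar measure on $G$ normalized so that $\mathfrak m(S)=1$. Put $|x|=\min\{n: x\in S^n\}$, the word length. $G$ has polynomial growth if there are $c,d>0$ with $\mathfrak m(S^n)\le c n^d$ for all $n>0$. A probability measure $\mu$ on $G$ is courteous if: (i) $\mu$ has a continuous density with respect to $\mathfrak m$; (ii) $\mu(A)=\mu(A^{-1})$ for all measurable $A$; (iii) the support of $\mu$ generates $G$; (iv) $\mu$ has exponential tail: there is $c_\mu>0$ with $\mu(\{x:|x|>t\})\le e^{-c_\mu t}$ for all sufficiently large $t$. A measurable function $f:G\to\mathbb C$ is $\mu$-harmonic if $f(x)=\int_G f(xs)\,d\mu(s)$ for all $x\in G$. For $f:G\to\mathbb C$ put $\|f\|_k=\limsup_{r\to\infty} r^{-k}\sup\{|f(x)|:|x|\le r\}$; if $\|f\|_k<\infty$ (equivalently $|f(x)|\le c(1+|x|)^k$ for some $c>0$ and all $x\in G$), $f$ has polynomial growth of degree at most $k$. $HF_k(G,\mu)$ is the complex vector space of all $\mu$-harmonic $f:G\to\mathbb C$ with $\|f\|_k<\infty$.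 It does not depend on the choice of $S$. *)

theory Defs
  imports "HOL-Probability.Probability" "HOL-Library.Function_Algebras"
begin

text \<open>
  Groups are written additively, since \<^class>\<open>topological_group_add\<close> is the library's class of
  topological groups. It is not assumed to be commutative: the product \<open>x y\<close>, the
  inverse and the unit are \<open>x + y\<close>, \<open>- x\<close> and \<open>0\<close>, and the order of summands matters throughout.
\<close>

definition set_pow :: "'a::monoid_add set \<Rightarrow> nat \<Rightarrow> 'a set" where
  "set_pow S n = {sum_list xs |xs. length xs = n \<and> set xs \<subseteq> S}"

definition compact_generating_set :: "'a::topological_group_add set \<Rightarrow> bool" where
  "compact_generating_set S \<longleftrightarrow>
     compact S \<and> uminus ` S = S \<and> 0 \<in> S \<and> (\<Union>n\<in>{1..}. set_pow S n) = UNIV"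

definition word_length :: "'a::monoid_add set \<Rightarrow> 'a \<Rightarrow> nat" where
  "word_length S x = (LEAST n. x \<in> set_pow S n)"

text \<open>A left Haar measure: a nonzero left-invariant Radon measure on the Borel sets.\<close>

definition left_haar_measure :: "'a::topological_group_add measure \<Rightarrow> bool" where
  "left_haar_measure m \<longleftrightarrow>
     sets m = sets borel \<and>
     emeasure m UNIV \<noteq> 0 \<and>
     (\<forall>K. compact K \<longrightarrow> emeasure m K < \<infinity>) \<and>
     (\<forall>A\<in>sets borel. emeasure m A = (INF U\<in>{U. open U \<and> A \<subseteq> U}. emeasure m U)) \<and>
     (\<forall>U. open U \<longrightarrow> emeasure m U = (SUP K\<in>{K. compact K \<and> K \<subseteq> U}. emeasure m K)) \<and>
     (\<forall>g. \<forall>A\<in>sets borel. emeasure m ((+) g ` A) = emeasure m A)"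

definition polynomial_growth :: "'a::topological_group_add set \<Rightarrow> 'a measure \<Rightarrow> bool" where
  "polynomial_growth S m \<longleftrightarrow>
     (\<exists>c>0. \<exists>d>0. \<forall>n>0. emeasure m (set_pow S n) \<le> ennreal (c * real n powr d))"

definition measure_support :: "'a::topological_space measure \<Rightarrow> 'a set" where
  "measure_support M = {x. \<forall>U. open U \<and> x \<in> U \<longrightarrow> emeasure M U > 0}"

definition additive_subgroup :: "'a::group_add set \<Rightarrow> bool" where
  "additive_subgroup H \<longleftrightarrow> 0 \<in> H \<and> (\<forall>x\<in>H. \<forall>y\<in>H. x + y \<in> H) \<and> (\<forall>x\<in>H. - x \<in> H)"

definition courteous ::
    "'a::topological_group_add set \<Rightarrow> 'a measure \<Rightarrow> 'a measure \<Rightarrow> bool" where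
  "courteous S m \<mu> \<longleftrightarrow>
     prob_space \<mu> \<and> sets \<mu> = sets borel \<and>
     (\<exists>\<rho>::'a \<Rightarrow> real. continuous_on UNIV \<rho> \<and> (\<forall>x. 0 \<le> \<rho> x) \<and> \<mu> = density m (\<lambda>x. ennreal (\<rho> x))) \<and>
     (\<forall>A\<in>sets borel. emeasure \<mu> A = emeasure \<mu> (uminus ` A)) \<and>
     additive_subgroup hull measure_support \<mu> = UNIV \<and>
     (\<exists>c>0. \<forall>\<^sub>F t in at_top. measure \<mu> {x. real (word_length S x) > t} \<le> exp (- c * t))"

text \<open>
  Integrability is required explicitly, because the Bochner integral of a non-integrable
  function is \<open>0\<close> by convention.
\<close>

definition harmonic :: "'a::topological_group_add measure \<Rightarrow> ('a \<Rightarrow> complex) \<Rightarrow> bool" where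
  "harmonic \<mu> f \<longleftrightarrow>
     f \<in> borel_measurable borel \<and>
     (\<forall>x. integrable \<mu> (\<lambda>s. f (x + s)) \<and> f x = (\<integral>s. f (x + s) \<partial>\<mu>))"

definition growth_norm :: "'a::monoid_add set \<Rightarrow> nat \<Rightarrow> ('a \<Rightarrow> complex) \<Rightarrow> ennreal" where
  "growth_norm S k f =
     Limsup at_top (\<lambda>r::real. ennreal (1 / r ^ k) *
       (SUP x\<in>{x. real (word_length S x) \<le> r}. ennreal (cmod (f x))))"

definition HF :: "'a::topological_group_add set \<Rightarrow> 'a measure \<Rightarrow> nat \<Rightarrow> ('a \<Rightarrow> complex) set" where
  "HF S \<mu> k = {f. harmonic \<mu> f \<and> growth_norm S k f < \<infinity>}"

definition fun_scale :: "complex \<Rightarrow> ('a \<Rightarrow> complex) \<Rightarrow> 'a \<Rightarrow> complex" where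
  "fun_scale c f = (\<lambda>x. c * f x)"

lemma vector_space_fun_scale: "vector_space fun_scale"
  by unfold_locales (auto simp: fun_scale_def fun_eq_iff algebra_simps)

text \<open>
  The span of a set is the one of the complex vector space of all functions, so this says that \<open>V\<close>
  is a linear subspace and has a finite spanning set.
\<close>

definition finite_dimensional_space :: "('a \<Rightarrow> complex) set \<Rightarrow> bool" where
  "finite_dimensional_space V \<longleftrightarrow> (\<exists>B. finite B \<and> module.span fun_scale B = V)"

end

theory Submission
  imports Defs "HOL-Real_Asymp.Real_Asymp"
begin

text \<open>
  This is Kleiner's argument with traces in place of coverings. A harmonic \<open>f\<close> of polynomial growth
  satisfies a Caccioppoli inequality: after a cutoff at scale \<open>R\<close>, its energy is \<open>O(R\<^sup>-\<^sup>2)\<close> times its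
  squared \<open>L\<^sup>2\<close> norm on the ball of radius \<open>4R\<close>, up to lower order. Since the support of \<open>\<mu>\<close> generates
  \<open>G\<close>, the energy controls translations by elements of \<open>S\<close>, so averaging over balls of radius \<open>\<epsilon>R\<close>
  moves \<open>f\<close> by \<open>O(\<epsilon>)\<close> in \<open>L\<^sup>2\<close>.
  By Bessel's inequality the averaging operator has squared Hilbert-Schmidt norm at most
  \<open>vol R / vol (\<epsilon>R)\<close>. Hence on a \<open>D\<close>-dimensional space the trace of the form of radius \<open>R\<close> relative to
  the form of radius \<open>4R\<close> is at most \<open>2 vol R / vol (\<epsilon>R) + O(\<epsilon>\<^sup>2) D\<close>. On the other hand, the Gram
  determinant grows polynomially, so at infinitely many scales this trace is at least a fixed multiple
  of \<open>D\<close> and the volume ratio is bounded; this bounds \<open>D\<close>.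

  The translation argument needs right invariance of the Haar measure, which follows from uniqueness
  of Haar measure and polynomial growth. The group need not be second countable, so Fubini's theorem
  is only applied to functions built from continuous ones.
\<close>

section \<open>Joint measurability and continuity without second countability\<close>

text \<open>The obstacle is uniformity in \<open>D\<close>. The Caccioppoli error contains the
  growth constants of the individual functions, and nothing bounds those in terms of
  \<open>k\<close>. They occur only in a term of order \<open>1 / R ^ 3\<close>, which becomes
  harmless at a scale that may depend on the family; the final bound on \<open>D\<close> involves
  only constants of the group, of \<open>\<mu>\<close> and of \<open>k\<close>. Hence good scales
  must exist beyond any prescribed one. At that scale two things must hold together: the Gram
  determinant grows little from \<open>R\<close> to \<open>4 * R\<close>, and the volume ratio of
  \<open>R\<close> to the averaging radius is bounded. Both logarithms grow linearly in the number
  of the scale, so one weighted sum with slope below 1 yields both. The logarithm of the determinant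
  is divided by \<open>D\<close>, which makes its slope depend on the growth exponents only. Right
  invariance is essential because harmonicity compares \<open>x\<close> with \<open>x + s\<close>,
  whereas Haar measure is invariant under the other side.\<close>

lemma open_sigma_compact_rectangles:
  fixes U :: "('a::topological_space \<times> 'b::topological_space) set"
  assumes "open U" and K: "\<And>n::nat. compact (K n)" and U: "U = (\<Union>n. K n)"
  shows "U \<in> sets (borel \<Otimes>\<^sub>M borel)"
proof -
  \<comment> \<open>A compact piece is covered by finitely many open rectangles inside
    \<open>U\<close>; countably many such finite unions exhaust \<open>U\<close>, with no countable
    base involved.\<close>
  have "\<exists>W. K n \<subseteq> W \<and> W \<subseteq> U \<and> W \<in> sets (borel \<Otimes>\<^sub>M borel)" for n
  proof -
    have "\<exists>A B. open A \<and> open B \<and> z \<in> A \<times> B \<and> A \<times> B \<subseteq> U" if "z \<in> K n" for z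
      using open_prod_elim[OF \<open>open U\<close>, of z] that U by blast
    then obtain A B where AB: "\<And>z. z \<in> K n \<Longrightarrow> open (A z) \<and> open (B z) \<and> z \<in> A z \<times> B z \<and> A z \<times> B z \<subseteq> U"
      by metis
    obtain C where C: "C \<subseteq> K n" "finite C" "K n \<subseteq> (\<Union>z\<in>C. A z \<times> B z)"
      by (rule compactE_image[OF K[of n], of "K n" "\<lambda>z. A z \<times> B z"]) (use AB in \<open>auto intro: open_Times\<close>)
    have "(\<Union>z\<in>C. A z \<times> B z) \<in> sets (borel \<Otimes>\<^sub>M borel)"
      using C AB by (intro sets.finite_UN) auto
    moreover have "(\<Union>z\<in>C. A z \<times> B z) \<subseteq> U" using AB C by blast
    ultimately show ?thesis using C(3) by blast
  qed
  then obtain W where W: "\<And>n. K n \<subseteq> W n \<and> W n \<subseteq> U \<and> W n \<in> sets (borel \<Otimes>\<^sub>M borel)" by metis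
  have "U = (\<Union>n. W n)" using W U by blast
  also have "\<dots> \<in> sets (borel \<Otimes>\<^sub>M borel)" using W by auto
  finally show ?thesis .
qed

text \<open>The product sigma-algebra can be smaller than the Borel sets of the product space.
  Sigma-compactness repairs this: an open set of a Euclidean space is a countable union of compact
  sets, so its preimage is one as well.\<close>

lemma borel_measurable_pair_continuous:
  fixes F :: "'a::t2_space \<times> 'b::t2_space \<Rightarrow> 'c::euclidean_space"
  assumes F: "continuous_on UNIV F"
    and K: "\<And>n::nat. compact (K n :: 'a set)" "(\<Union>n. K n) = UNIV"
    and L: "\<And>n::nat. compact (L n :: 'b set)" "(\<Union>n. L n) = UNIV"
  shows "F \<in> borel_measurable (borel \<Otimes>\<^sub>M borel)"
proof (rule borel_measurableI)
  fix V :: "'c set" assume "open V"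
  then obtain C where C: "\<And>n::nat. compact (C n)" "\<Union>(range C) = V"
    using open_Union_compact_subsets by metis
  \<comment> \<open>\<open>p\<close> codes a triple: a compact piece of \<open>V\<close>, and one
    compact piece of each factor to make the closed preimage compact.\<close>
  define Q where "Q = (\<lambda>p. case prod_decode p of (i, j) \<Rightarrow> case prod_decode j of (a, b) \<Rightarrow>
     F -` C i \<inter> (K a \<times> L b))"
  have "compact (Q p)" for p
  proof -
    have "closed (F -` C i)" for i
      using continuous_on_closed_vimage[of UNIV F] F C(1)[of i] by (auto intro: compact_imp_closed)
    then show ?thesis
      unfolding Q_def by (auto split: prod.split intro!: closed_Int_compact compact_Times K L)
  qed
  moreover have "F -` V = (\<Union>p. Q p)"
  proof (rule set_eqI, rule iffI)
    fix z assume "z \<in> F -` V"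
    then obtain i where "F z \<in> C i" using C(2) by auto
    moreover obtain a b where "fst z \<in> K a" "snd z \<in> L b" using K(2) L(2) by blast
    ultimately have "z \<in> Q (prod_encode (i, prod_encode (a, b)))"
      unfolding Q_def by (simp add: mem_Times_iff)
    then show "z \<in> (\<Union>p. Q p)" by blast
  next
    fix z assume "z \<in> (\<Union>p. Q p)"
    then show "z \<in> F -` V" unfolding C(2)[symmetric] Q_def by (force split: prod.splits)
  qed
  moreover have "open (F -` V)"
    using continuous_on_open_vimage[of UNIV F] F \<open>open V\<close> by auto
  ultimately show "F -` V \<inter> space (borel \<Otimes>\<^sub>M borel) \<in> sets (borel \<Otimes>\<^sub>M borel)"
    using open_sigma_compact_rectangles[of "F -` V" Q] by (simp add: space_pair_measure)
qed

text \<open>The tube lemma, which turns continuity into uniformity over a compact set.\<close>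

lemma open_tube:
  assumes "open U" "compact K" "K \<times> {x} \<subseteq> U"
  obtains X where "open X" "x \<in> X" "K \<times> X \<subseteq> U"
proof -
  have "\<exists>A B. open A \<and> open B \<and> t \<in> A \<and> x \<in> B \<and> A \<times> B \<subseteq> U" if "t \<in> K" for t
  proof -
    have "(t, x) \<in> U" using that assms(3) by blast
    then show ?thesis
      using open_prod_elim[OF \<open>open U\<close>, of "(t, x)"] by (metis mem_Sigma_iff)
  qed
  then obtain A B where AB: "\<And>t. t \<in> K \<Longrightarrow> open (A t) \<and> open (B t) \<and> t \<in> A t \<and> x \<in> B t \<and> A t \<times> B t \<subseteq> U"
    by metis
  obtain C where C: "C \<subseteq> K" "finite C" "K \<subseteq> (\<Union>t\<in>C. A t)"
    by (rule compactE_image[OF \<open>compact K\<close>, of K A]) (use AB in auto)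
  show ?thesis
  proof (rule that[of "\<Inter>t\<in>C. B t"])
    show "open (\<Inter>t\<in>C. B t)" using C AB by (intro open_INT) auto
    show "x \<in> (\<Inter>t\<in>C. B t)" using C AB by auto
    show "K \<times> (\<Inter>t\<in>C. B t) \<subseteq> U"
    proof clarify
      fix s y assume "s \<in> K" and y: "y \<in> (\<Inter>t\<in>C. B t)"
      then obtain t where "t \<in> C" "s \<in> A t" using C(3) by blast
      then have "(s, y) \<in> A t \<times> B t" using y by blast
      then show "(s, y) \<in> U" using AB \<open>t \<in> C\<close> C(1) by blast
    qed
  qed
qed

lemma uniform_on_compact_param:
  fixes F :: "'a::topological_space \<Rightarrow> 'b::topological_space \<Rightarrow> 'c::real_normed_vector"
  assumes "continuous_on UNIV (\<lambda>(t, x). F t x)" "compact K" "e > 0"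
  obtains X where "open X" "x0 \<in> X" "\<And>t x. t \<in> K \<Longrightarrow> x \<in> X \<Longrightarrow> norm (F t x - F t x0) < e"
proof -
  let ?G = "\<lambda>z. norm (F (fst z) (snd z) - F (fst z) x0)"
  have "continuous_on UNIV (\<lambda>z. (\<lambda>(t, x). F t x) (fst z, x0))"
    by (rule continuous_on_compose2[OF assms(1)]) (auto intro!: continuous_intros)
  then have "continuous_on UNIV ?G"
    using assms(1) by (auto intro!: continuous_intros simp: case_prod_unfold)
  then have op: "open (?G -` {..<e})" using continuous_on_open_vimage[of UNIV ?G] by auto
  have "K \<times> {x0} \<subseteq> ?G -` {..<e}" using assms(3) by auto
  then obtain X where X: "open X" "x0 \<in> X" "K \<times> X \<subseteq> ?G -` {..<e}"
    using open_tube[OF op assms(2)] by blast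
  have "norm (F t x - F t x0) < e" if "t \<in> K" "x \<in> X" for t x
    using subsetD[OF X(3), of "(t, x)"] that by simp
  with X show ?thesis using that by blast
qed

text \<open>The weight \<open>w\<close> need not be continuous: later it is the indicator of a ball,
  or a measurable function cut off to a ball. Points may lack a countable neighbourhood base, so
  uniformity on \<open>K\<close> takes the place of dominated convergence.\<close>

lemma continuous_on_integral_param:
  fixes F :: "'a::topological_space \<Rightarrow> 'b::topological_space \<Rightarrow> 'c::{real_normed_field,euclidean_space}"
  assumes F: "continuous_on UNIV (\<lambda>(t, x). F t x)" and K: "compact K" and M: "sets M = sets borel"
    and w: "integrable M w" "\<And>t. t \<notin> K \<Longrightarrow> w t = 0"
  shows "continuous_on UNIV (\<lambda>x. \<integral>t. w t * F t x \<partial>M)"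
proof -
  have Fx: "continuous_on UNIV (\<lambda>t. F t x)" for x
    using continuous_on_compose2[OF F, of UNIV "\<lambda>t. (t, x)"] by (simp add: continuous_on_Pair)
  have int: "integrable M (\<lambda>t. w t * F t x)" for x
  proof -
    have "bounded ((\<lambda>t. F t x) ` K)"
      using Fx K by (intro compact_imp_bounded compact_continuous_image) (auto intro: continuous_on_subset)
    then obtain b where b: "\<And>t. t \<in> K \<Longrightarrow> norm (F t x) \<le> b" by (auto simp: bounded_iff)
    have [measurable]: "(\<lambda>t. F t x) \<in> borel_measurable M"
      using borel_measurable_continuous_onI[OF Fx] measurable_cong_sets[OF M refl] by blast
    have [measurable]: "w \<in> borel_measurable M" using w by auto
    have "norm (w t * F t x) \<le> norm (w t * of_real b)" for t
      by (cases "t \<in> K") (use b[of t] w(2)[of t] in \<open>auto simp: norm_mult intro!: mult_left_mono\<close>)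
    then show ?thesis
      by (intro Bochner_Integration.integrable_bound[of M "\<lambda>t. w t * of_real b" "\<lambda>t. w t * F t x"] AE_I2)
        (use w in auto)
  qed
  show ?thesis
    unfolding continuous_on_def
  proof (intro ballI, rule tendstoI)
    fix x0 :: 'b and e :: real assume "e > 0"
    define I where "I = (\<integral>t. norm (w t) \<partial>M)"
    have "I \<ge> 0" unfolding I_def by simp
    define d where "d = e / (I + 1)"
    have "d > 0" using \<open>e > 0\<close> \<open>I \<ge> 0\<close> unfolding d_def by auto
    obtain X where X: "open X" "x0 \<in> X" "\<And>t x. t \<in> K \<Longrightarrow> x \<in> X \<Longrightarrow> norm (F t x - F t x0) < d"
      using uniform_on_compact_param[OF F K \<open>d > 0\<close>] by blast
    have "dist (\<integral>t. w t * F t x \<partial>M) (\<integral>t. w t * F t x0 \<partial>M) < e" if "x \<in> X" for x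
    proof -
      have "norm ((\<integral>t. w t * F t x \<partial>M) - (\<integral>t. w t * F t x0 \<partial>M))
          = norm (\<integral>t. w t * F t x - w t * F t x0 \<partial>M)"
        using int by simp
      also have "\<dots> \<le> (\<integral>t. norm (w t * F t x - w t * F t x0) \<partial>M)"
        by (rule integral_norm_bound)
      also have "\<dots> \<le> (\<integral>t. d * norm (w t) \<partial>M)"
      proof (rule integral_mono)
        show "norm (w t * F t x - w t * F t x0) \<le> d * norm (w t)" for t
          by (cases "t \<in> K") (use X(3)[of t x] that w(2)[of t] in
            \<open>auto simp: norm_mult mult.commute[of d] right_diff_distrib[symmetric] intro!: mult_left_mono\<close>)
      qed (use int w in auto)
      also have "\<dots> = d * I" unfolding I_def by simp
      also have "\<dots> < e" using \<open>e > 0\<close> \<open>I \<ge> 0\<close> unfolding d_def by (simp add: field_simps)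
      finally show ?thesis by (simp add: dist_norm)
    qed
    then show "\<forall>\<^sub>F x in at x0 within UNIV. dist (\<integral>t. w t * F t x \<partial>M) (\<integral>t. w t * F t x0 \<partial>M) < e"
      using X(1,2) by (auto simp: eventually_at_topological)
  qed
qed

section \<open>Word length\<close>

lemma set_pow_0 [simp]: "set_pow S 0 = {0}"
  by (auto simp: set_pow_def)

lemma set_pow_Suc: "set_pow S (Suc n) = (\<lambda>(a, b). a + b) ` (S \<times> set_pow S n)"
proof -
  have "x \<in> set_pow S (Suc n) \<longleftrightarrow> x \<in> (\<lambda>(a, b). a + b) ` (S \<times> set_pow S n)" for x
  proof
    assume "x \<in> set_pow S (Suc n)"
    then obtain xs where "x = sum_list xs" "length xs = Suc n" "set xs \<subseteq> S"
      by (auto simp: set_pow_def)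
    then show "x \<in> (\<lambda>(a, b). a + b) ` (S \<times> set_pow S n)"
      by (cases xs) (auto simp: set_pow_def image_iff intro!: bexI exI)
  next
    assume "x \<in> (\<lambda>(a, b). a + b) ` (S \<times> set_pow S n)"
    then obtain a xs where "x = a + sum_list xs" "a \<in> S" "length xs = n" "set xs \<subseteq> S"
      by (auto simp: set_pow_def)
    then show "x \<in> set_pow S (Suc n)"
      by (auto simp: set_pow_def intro!: exI[of _ "a # xs"])
  qed
  then show ?thesis by blast
qed

lemma set_pow_1 [simp]: "set_pow S (Suc 0) = S"
  by (auto simp: set_pow_Suc image_iff)

lemma set_pow_add_mem: "x \<in> set_pow S n \<Longrightarrow> y \<in> set_pow S k \<Longrightarrow> x + y \<in> set_pow S (n + k)"
proof -
  assume "x \<in> set_pow S n" "y \<in> set_pow S k"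
  then obtain xs ys where "x = sum_list xs" "length xs = n" "set xs \<subseteq> S"
    "y = sum_list ys" "length ys = k" "set ys \<subseteq> S"
    by (auto simp: set_pow_def)
  then show ?thesis
    unfolding set_pow_def by (intro CollectI exI[of _ "xs @ ys"]) auto
qed

locale compactly_generated =
  fixes S :: "'a::{topological_group_add,t2_space} set"
  assumes locally_compact: "locally_compact_space (euclidean :: 'a topology)"
    and generating: "compact_generating_set S"
begin

abbreviation B :: "nat \<Rightarrow> 'a set" where "B \<equiv> set_pow S"
abbreviation len :: "'a \<Rightarrow> nat" where "len \<equiv> word_length S"

lemma zero_in_S: "0 \<in> S" and compact_S: "compact S" and uminus_S: "uminus ` S = S"
  using generating unfolding compact_generating_set_def by auto

lemma compact_B: "compact (B n)"
proof (induction n)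
  case (Suc n)
  then show ?case unfolding set_pow_Suc using compact_S
    by (intro compact_continuous_image compact_Times)
       (auto intro!: continuous_intros simp: case_prod_unfold)
qed simp

lemma closed_B: "closed (B n)"
  using compact_B by (rule compact_imp_closed)

lemma B_measurable [measurable]: "B n \<in> sets borel"
  using closed_B by auto

lemma B_mono: "n \<le> k \<Longrightarrow> B n \<subseteq> B k"
proof (induction rule: dec_induct)
  case (step l)
  have "B l \<subseteq> B (Suc l)"
    unfolding set_pow_Suc by (intro subsetI image_eqI[of _ _ "(0, _)"]) (use zero_in_S in auto)
  then show ?case using step by blast
qed simp

lemma zero_in_B [simp]: "0 \<in> B n"
  using B_mono[of 0 n] by auto

lemma UN_B: "(\<Union>n. B n) = UNIV"
proof -
  have "x \<in> (\<Union>n\<in>{1..}. B n)" for x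
    using generating unfolding compact_generating_set_def by simp
  then show ?thesis by blast
qed

lemma in_B_iff: "x \<in> B n \<longleftrightarrow> len x \<le> n"
proof
  assume "x \<in> B n" then show "len x \<le> n" unfolding word_length_def by (rule Least_le)
next
  assume "len x \<le> n"
  moreover have "x \<in> B (len x)"
    unfolding word_length_def by (rule LeastI_ex) (use UN_B in auto)
  ultimately show "x \<in> B n" using B_mono by blast
qed

lemma len_zero [simp]: "len 0 = 0"
  using in_B_iff[of 0 0] by simp

lemma len_add: "len (x + y) \<le> len x + len y"
  using set_pow_add_mem in_B_iff by blast

lemma len_uminus [simp]: "len (- x) = len x"
proof -
  have *: "x \<in> B n \<Longrightarrow> - x \<in> B n" for x n
  proof (induction n arbitrary: x)
    case (Suc n)
    then obtain a b where "x = a + b" "a \<in> S" "b \<in> B n" by (auto simp: set_pow_Suc)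
    moreover have "- a \<in> B 1" using \<open>a \<in> S\<close> uminus_S by auto
    ultimately show ?case using set_pow_add_mem[of "- b" S n "- a" 1] Suc.IH by (simp add: minus_add)
  qed simp
  have "len (- x) \<le> len x" for x using *[of x "len x"] by (simp add: in_B_iff)
  from this[of x] this[of "- x"] show ?thesis by simp
qed

lemma len_diff_le: "len x \<le> len (x + y) + len y"
  using len_add[of "x + y" "- y"] by (simp add: add.assoc)

lemma len_measurable [measurable]: "len \<in> measurable borel (count_space UNIV)"
proof -
  have "len -` {n} = B n - (if n = 0 then {} else B (n - 1))" for n
    by (auto simp: in_B_iff simp del: set_pow_0)
  then have "\<forall>n. len -` {n} \<in> sets borel" by (simp add: sets.Diff)
  then show ?thesis by (simp add: measurable_count_space_eq2_countable)
qed

lemma pair_measurable: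
  fixes F :: "'a \<times> 'a \<Rightarrow> 'c::euclidean_space"
  shows "continuous_on UNIV F \<Longrightarrow> F \<in> borel_measurable (borel \<Otimes>\<^sub>M borel)"
  by (rule borel_measurable_pair_continuous[OF _ compact_B UN_B compact_B UN_B])

end

section \<open>Left Haar measure and unimodularity\<close>

text \<open>This is how polynomial growth forces unimodularity: the powers of the modular factor of
  one element will be bounded by volumes of balls.\<close>

lemma power_le_polynomial_imp_le_one:
  fixes x C l :: real
  assumes "\<And>n::nat. x ^ n \<le> C * (l * real n + 3) ^ d" "l \<ge> 0"
  shows "x \<le> 1"
proof (rule ccontr)
  assume "\<not> x \<le> 1"
  then have x: "x > 1" by simp
  have "((\<lambda>n::nat. C * (l * real n + 3) ^ d / x ^ n) \<longlongrightarrow> 0) sequentially"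
  proof (cases "l = 0")
    case True
    show ?thesis unfolding True using x by real_asymp
  next
    case False
    then have "l > 0" using assms by simp
    then show ?thesis using x by real_asymp
  qed
  moreover have "1 \<le> C * (l * real n + 3) ^ d / x ^ n" for n :: nat
    using assms(1)[of n] x by simp
  ultimately have "(1::real) \<le> 0"
    by (intro tendsto_lowerbound[where F = sequentially]) auto
  then show False by simp
qed

section \<open>Urysohn functions and left-invariant measures finite on balls\<close>

context compactly_generated
begin

lemma continuous_translation:
  fixes f :: "'a \<Rightarrow> 'c::topological_space"
  assumes "continuous_on UNIV f"
  shows "continuous_on UNIV (\<lambda>x. f (g + x))" "continuous_on UNIV (\<lambda>x. f (x + g))" "continuous_on UNIV (\<lambda>x. f (- x))"
  by (rule continuous_on_compose2[OF assms]; auto intro!: continuous_intros)+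

lemma translation_measurable [measurable]:
  "(\<lambda>x::'a. g + x) \<in> borel_measurable borel" "(\<lambda>x::'a. x + g) \<in> borel_measurable borel"
  "(\<lambda>x::'a. - x) \<in> borel_measurable borel"
  by (rule borel_measurable_continuous_onI; intro continuous_intros)+

lemma measurable_translation:
  assumes "f \<in> measurable borel M"
  shows "(\<lambda>x. f (g + x :: 'a)) \<in> measurable borel M" "(\<lambda>x. f (x + g)) \<in> measurable borel M"
    "(\<lambda>x. f (- x)) \<in> measurable borel M"
  by (rule measurable_compose[OF _ assms]; measurable)+

lemma open_translation_vimage:
  assumes "open (U :: 'a set)"
  shows "open {x. g + x \<in> U}" "open {x. x + g \<in> U}"
  using continuous_on_open_vimage[of UNIV "\<lambda>x. g + x"] continuous_on_open_vimage[of UNIV "\<lambda>x. x + g"] assms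
  by (auto simp: vimage_def intro!: continuous_intros)

text \<open>A locally compact Hausdorff space is completely regular, and then a compact set can be
  separated from a disjoint closed one.\<close>

lemma bump:
  assumes "compact K" "open U" "K \<subseteq> U"
  obtains h :: "'a \<Rightarrow> real" where "continuous_on UNIV h" "\<And>x. 0 \<le> h x" "\<And>x. h x \<le> 1"
    "\<And>x. x \<in> K \<Longrightarrow> h x = 1" "\<And>x. x \<notin> U \<Longrightarrow> h x = 0"
proof -
  have "Hausdorff_space (euclidean :: 'a topology)"
    unfolding Hausdorff_space_def using hausdorff by (auto simp: disjnt_def)
  then have "completely_regular_space (euclidean :: 'a topology)"
    using locally_compact_regular_imp_completely_regular_space locally_compact by blast
  then obtain h where "continuous_map euclidean (top_of_set {0..1::real}) h" "h ` (- U) \<subseteq> {0}" "h ` K \<subseteq> {1}"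
    using Urysohn_completely_regular_compact_closed[of 0 1 "euclidean :: 'a topology" K "- U"] assms
    by (auto simp: disjnt_def)
  then show ?thesis
    by (intro that[of h]) (auto simp: continuous_map_in_subtopology image_subset_iff)
qed

text \<open>The conditions are chosen so that right translates of \<open>m\<close> satisfy them at
  once; regularity of such a translate would take a separate argument.\<close>

definition left_radon :: "'a measure \<Rightarrow> bool" where
  "left_radon M \<longleftrightarrow> sets M = sets borel \<and> (\<forall>n. emeasure M (B n) < \<infinity>) \<and> (\<forall>g. distr M borel ((+) g) = M)"

context
  fixes M :: "'a measure"
  assumes M: "left_radon M"
begin

lemma left_radon_sets: "sets M = sets borel" and left_radon_finite: "emeasure M (B n) < \<infinity>"
  using M unfolding left_radon_def by auto

lemma left_radon_space: "space M = UNIV"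
  using left_radon_sets sets_eq_imp_space_eq by fastforce

lemma left_radon_sigma_finite: "sigma_finite_measure M"
proof
  show "\<exists>A. countable A \<and> A \<subseteq> sets M \<and> \<Union> A = space M \<and> (\<forall>a\<in>A. emeasure M a \<noteq> \<infinity>)"
  proof (intro exI[of _ "range B"] conjI ballI)
    fix a assume "a \<in> range B"
    then show "emeasure M a \<noteq> \<infinity>" using left_radon_finite by (auto simp: less_top[symmetric])
  qed (auto simp: left_radon_sets left_radon_space UN_B)
qed

lemma left_radon_nn_integral:
  assumes "f \<in> borel_measurable borel"
  shows "(\<integral>\<^sup>+x. f (g + x) \<partial>M) = (\<integral>\<^sup>+x. f x \<partial>M)"
proof -
  have "(\<integral>\<^sup>+x. f x \<partial>M) = (\<integral>\<^sup>+x. f x \<partial>distr M borel ((+) g))" using M unfolding left_radon_def by simp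
  also have "\<dots> = (\<integral>\<^sup>+x. f (g + x) \<partial>M)"
    by (rule nn_integral_distr) (use assms left_radon_sets in \<open>auto simp: measurable_cong_sets[OF left_radon_sets refl]\<close>)
  finally show ?thesis by simp
qed

lemma left_radon_emeasure:
  assumes "A \<in> sets borel"
  shows "emeasure M {x. g + x \<in> A} = emeasure M A"
proof -
  have "emeasure M A = emeasure (distr M borel ((+) g)) A" using M unfolding left_radon_def by simp
  also have "\<dots> = emeasure M {x. g + x \<in> A}"
    by (subst emeasure_distr) (use assms in \<open>auto simp: measurable_cong_sets[OF left_radon_sets refl] vimage_def left_radon_space\<close>)
  finally show ?thesis by simp
qed

text \<open>Finitely many left translates of a null open set would cover a ball, so all balls, and
  then the whole group, would be null.\<close>

lemma left_radon_open_pos: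
  assumes "open U" "u \<in> U" "emeasure M UNIV \<noteq> 0"
  shows "emeasure M U > 0"
proof (rule ccontr)
  assume "\<not> emeasure M U > 0"
  then have U0: "emeasure M U = 0" by simp
  have "emeasure M (B n) = 0" for n
  proof -
    have "\<And>x. x \<in> B n \<Longrightarrow> open {y. (u - x) + y \<in> U}" using open_translation_vimage assms by blast
    then obtain C where C: "C \<subseteq> B n" "finite C" "B n \<subseteq> (\<Union>x\<in>C. {y. (u - x) + y \<in> U})"
      by (rule compactE_image[OF compact_B[of n], of "B n"]) (use assms in \<open>auto simp: algebra_simps\<close>)
    have "emeasure M (\<Union>x\<in>C. {y. (u - x) + y \<in> U}) \<le> (\<Sum>x\<in>C. emeasure M {y. (u - x) + y \<in> U})"
      using C assms open_translation_vimage
      by (intro emeasure_subadditive_finite) (auto simp: left_radon_sets)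
    also have "\<dots> = 0" using left_radon_emeasure assms(1) U0 by simp
    finally have "emeasure M (\<Union>x\<in>C. {y. (u - x) + y \<in> U}) = 0" by simp
    moreover have "(\<Union>x\<in>C. {y. (u - x) + y \<in> U}) \<in> sets M"
      using C assms open_translation_vimage by (auto simp: left_radon_sets)
    ultimately show ?thesis using emeasure_mono[OF C(3), of M] by simp
  qed
  then have "emeasure M (\<Union>n. B n) = 0"
    by (intro emeasure_UN_eq_0) (auto simp: left_radon_sets)
  then show False using assms(3) UN_B by simp
qed

end

end

section \<open>Haar measure: interiors of balls, volume growth, two-sided invariance\<close>

locale haar_growth = compactly_generated +
  fixes m :: "'a measure"
  assumes haar: "left_haar_measure m" and mS: "emeasure m S = 1" and growth: "polynomial_growth S m"
begin

lemma sets_m [measurable_cong, simp]: "sets m = sets borel"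
  using haar unfolding left_haar_measure_def by simp

lemma space_m [simp]: "space m = UNIV"
  using sets_m sets_eq_imp_space_eq by fastforce

lemma left_radon_m: "left_radon m"
  unfolding left_radon_def
proof (intro conjI allI)
  show "emeasure m (B n) < \<infinity>" for n using haar compact_B unfolding left_haar_measure_def by blast
  fix g
  show "distr m borel ((+) g) = m"
  proof (rule measure_eqI)
    fix A assume "A \<in> sets (distr m borel ((+) g))"
    then have A: "A \<in> sets borel" by simp
    have "(+) g -` A = (+) (- g) ` A"
      by (force simp: image_iff add.assoc[symmetric])
    then show "emeasure (distr m borel ((+) g)) A = emeasure m A"
      using A haar unfolding left_haar_measure_def by (simp add: emeasure_distr)
  qed simp
qed simp

lemma m_UNIV: "emeasure m UNIV \<noteq> 0"
  using haar unfolding left_haar_measure_def by blast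

lemmas nn_integral_left = left_radon_nn_integral[OF left_radon_m]
lemmas emeasure_left = left_radon_emeasure[OF left_radon_m]
lemmas finite_B = left_radon_finite[OF left_radon_m]

lemma open_pos: "open U \<Longrightarrow> u \<in> U \<Longrightarrow> emeasure m U > 0"
  using left_radon_open_pos[OF left_radon_m] m_UNIV by blast

text \<open>Steinhaus: \<open>S\<close> and its small translates lie in an open set of measure below \<open>2\<close>, so they meet.\<close>

lemma B2_nhd_zero: obtains W where "open W" "0 \<in> W" "W \<subseteq> B 2"
proof -
  have Sb: "S \<in> sets borel" using B_measurable[of 1] by simp
  have "emeasure m S = (INF U\<in>{U. open U \<and> S \<subseteq> U}. emeasure m U)"
    using haar Sb unfolding left_haar_measure_def by blast
  then have "(INF U\<in>{U. open U \<and> S \<subseteq> U}. emeasure m U) < 2" using mS by simp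
  then obtain U where U: "open U" "S \<subseteq> U" "emeasure m U < 2" by (auto simp: INF_less_iff)
  have "open ((\<lambda>z::'a\<times>'a. snd z + fst z) -` U)"
    using continuous_on_open_vimage[of UNIV "\<lambda>z::'a\<times>'a. snd z + fst z"] U(1)
    by (auto intro!: continuous_intros)
  moreover have "S \<times> {0} \<subseteq> (\<lambda>z. snd z + fst z) -` U" using U(2) by auto
  ultimately obtain W where W: "open W" "0 \<in> W" "S \<times> W \<subseteq> (\<lambda>z. snd z + fst z) -` U"
    using open_tube[OF _ compact_S] by blast
  have "w \<in> B 2" if "w \<in> W" for w
  proof -
    let ?T = "{x. - w + x \<in> S}"
    have T: "?T \<in> sets borel"
      using measurable_sets[OF translation_measurable(1)[of "- w"] Sb] by (simp add: vimage_def)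
    have mT: "emeasure m ?T = 1" using emeasure_left[OF Sb] mS by simp
    have "?T \<subseteq> U"
    proof
      fix x assume "x \<in> ?T"
      then have "(- w + x, w) \<in> S \<times> W" using that by simp
      then have "w + (- w + x) \<in> U" using W(3) by auto
      then show "x \<in> U" by (simp add: add.assoc[symmetric])
    qed
    have "?T \<inter> S \<noteq> {}"
    proof
      assume "?T \<inter> S = {}"
      then have "emeasure m (?T \<union> S) = 2"
        using plus_emeasure[of ?T m S] T Sb mT mS by (simp add: one_add_one)
      moreover have "emeasure m (?T \<union> S) \<le> emeasure m U"
        using \<open>?T \<subseteq> U\<close> U by (intro emeasure_mono) auto
      ultimately show False using U(3) by simp
    qed
    then obtain x where x: "- w + x \<in> S" "x \<in> S" by blast
    then have "- (- w + x) \<in> S" using uminus_S by blast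
    then have "x + - (- w + x) \<in> B (1 + 1)" using x by (intro set_pow_add_mem) auto
    then show ?thesis by (simp add: minus_add add.assoc[symmetric] numeral_2_eq_2)
  qed
  then show ?thesis using that W by blast
qed

text \<open>Translate the neighbourhood of \<open>0\<close> inside \<open>B 2\<close>. This slack of
  2 returns as the additive \<open>2\<close> in the Lipschitz constant of
  \<open>cutoff\<close>.\<close>

lemma B_subset_interior: "B n \<subseteq> interior (B (n + 2))"
proof
  fix x assume x: "x \<in> B n"
  obtain W where W: "open W" "0 \<in> W" "W \<subseteq> B 2" by (rule B2_nhd_zero)
  have "{y. - x + y \<in> W} \<subseteq> B (n + 2)"
  proof clarify
    fix y assume "- x + y \<in> W"
    then have "x + (- x + y) \<in> B (n + 2)" using x W by (intro set_pow_add_mem) auto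
    then show "y \<in> B (n + 2)" by (simp add: add.assoc[symmetric])
  qed
  then show "x \<in> interior (B (n + 2))"
    using open_translation_vimage(1)[OF W(1), of "- x"] W(2) by (intro interiorI) auto
qed

lemma UN_interior_B: "(\<Union>n. interior (B n)) = UNIV"
proof -
  have "x \<in> interior (B (len x + 2))" for x using B_subset_interior[of "len x"] in_B_iff by blast
  then show ?thesis by blast
qed

lemma continuous_on_interior_B:
  assumes "\<And>n. continuous_on (interior (B n)) f"
  shows "continuous_on UNIV f"
  using continuous_on_open_UN[of UNIV "\<lambda>n. interior (B n)" f] assms UN_interior_B by simp

lemma growthE:
  obtains c :: real and d :: nat where "c > 0" "\<And>n. measure m (B n) \<le> c * (real n + 1) ^ d"
proof -
  obtain c e where ce: "c > 0" "e > 0" "\<And>n. n > 0 \<Longrightarrow> emeasure m (B n) \<le> ennreal (c * real n powr e)"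
    using growth unfolding polynomial_growth_def by blast
  define d where "d = nat \<lceil>e\<rceil>"
  have "measure m (B n) \<le> (c + 1) * (real n + 1) ^ d" for n
  proof -
    \<comment> \<open>\<open>polynomial_growth\<close> says nothing about radius 0, hence the detour
      through \<open>n + 1\<close>.\<close>
    have "measure m (B n) \<le> measure m (B (n + 1))"
      using B_mono[of n "n + 1"] finite_B[of "n+1"] by (intro measure_mono_fmeasurable) (auto simp: fmeasurable_def)
    also have "\<dots> \<le> c * real (n + 1) powr e"
      using ce(3)[of "n + 1"] ce(1) unfolding measure_def by (intro enn2real_leI) auto
    also have "\<dots> \<le> c * real (n + 1) powr real d"
      using ce by (intro mult_left_mono powr_mono) (auto simp: d_def)
    also have "\<dots> = c * (real n + 1) ^ d" by (simp add: powr_realpow add.commute)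
    also have "\<dots> \<le> (c + 1) * (real n + 1) ^ d" by (intro mult_right_mono) auto
    finally show ?thesis .
  qed
  then show ?thesis using ce(1) by (intro that[of "c + 1" d]) auto
qed

lemma B_measure_ge_1:
  assumes "n \<ge> 1" shows "measure m (B n) \<ge> 1"
proof -
  have "measure m (B 1) \<le> measure m (B n)"
    using B_mono[OF assms] finite_B[of n] B_measurable[of 1]
    by (intro measure_mono_fmeasurable) (auto simp: fmeasurable_def)
  then show ?thesis using mS by (simp add: measure_def)
qed

text \<open>
  The measure \<open>M\<close> enters the value of \<open>\<integral> f dM\<close> only through the factor \<open>\<integral> g dM\<close>, so left-invariant
  measures are proportional on continuous functions with compact support (Weil's argument).
\<close>

lemma nn_integral_left_radon_factor:
  fixes f g :: "'a \<Rightarrow> real"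
  assumes M: "left_radon M" and N: "left_radon N"
    and f: "continuous_on UNIV f" "\<And>x. 0 \<le> f x"
    and g: "continuous_on UNIV g" "\<And>x. 0 \<le> g x" "\<And>x. x \<notin> B n \<Longrightarrow> g x = 0" "g 0 > 0"
    and N0: "emeasure N UNIV \<noteq> 0"
  defines "D \<equiv> \<lambda>x. \<integral>t. g (t + x) \<partial>N"
  shows "(\<integral>\<^sup>+x. f x \<partial>M) = (\<integral>\<^sup>+x. g x \<partial>M) * (\<integral>\<^sup>+y. f (- y) / D (- y) \<partial>N)"
proof -
  interpret M: sigma_finite_measure M using left_radon_sigma_finite[OF M] .
  interpret N: sigma_finite_measure N using left_radon_sigma_finite[OF N] .
  interpret MN: pair_sigma_finite M N ..
  note sM[measurable_cong] = left_radon_sets[OF M]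
  note sN[measurable_cong] = left_radon_sets[OF N]
  have [measurable]: "g \<in> borel_measurable borel" "f \<in> borel_measurable borel"
    using f g by (auto intro: borel_measurable_continuous_onI)
  have int_ind: "integrable N (indicator (B k) :: 'a \<Rightarrow> real)" for k
    using left_radon_finite[OF N, of k] by (simp add: sN)
  \<comment> \<open>For fixed \<open>x\<close> the integrand of \<open>D x\<close> lives on one ball
    whose radius is locally bounded in \<open>x\<close>; this gives finiteness and continuity of
    \<open>D\<close>.\<close>
  have supp: "t \<in> B (n + len x)" if "g (t + x) \<noteq> 0" for t x
    using that g(3)[of "t + x"] len_diff_le[of t x] by (force simp: in_B_iff)
  obtain b where b: "\<And>x. g x \<le> b"
  proof -
    have "bounded (g ` B n)"
      using g compact_B by (intro compact_imp_bounded compact_continuous_image) (auto intro: continuous_on_subset)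
    then obtain b where "\<And>x. x \<in> B n \<Longrightarrow> \<bar>g x\<bar> \<le> b" by (auto simp: bounded_iff)
    then have "g x \<le> max b 0" for x using g(3)[of x] by (cases "x \<in> B n") (auto simp: le_max_iff_disj abs_le_iff)
    then show ?thesis using that by blast
  qed
  have gt [measurable]: "(\<lambda>t. g (t + x)) \<in> borel_measurable borel" for x
    by (rule measurable_translation) measurable
  have intg: "integrable N (\<lambda>t. g (t + x))" for x
  proof (rule Bochner_Integration.integrable_bound)
    show "integrable N (\<lambda>t. b * indicator (B (n + len x)) t)" using int_ind by simp
    have "norm (g (t + x)) \<le> norm (b * indicator (B (n + len x)) t)" for t
      using supp[of t x] b[of "t + x"] g(2)[of "t + x"] by (cases "g (t + x) = 0") auto
    then show "AE t in N. norm (g (t + x)) \<le> norm (b * indicator (B (n + len x)) t)" by simp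
  qed measurable
  have contD: "continuous_on UNIV D"
  proof (rule continuous_on_interior_B)
    fix j
    have "continuous_on UNIV (\<lambda>x. \<integral>t. indicator (B (n + j)) t * g (t + x) \<partial>N)"
    proof (rule continuous_on_integral_param[OF _ compact_B[of "n + j"] sN int_ind])
      show "continuous_on UNIV (\<lambda>(t, x). g (t + x))"
        unfolding case_prod_unfold by (rule continuous_on_compose2[OF g(1)]) (auto intro!: continuous_intros)
    qed auto
    moreover have "D x = (\<integral>t. indicator (B (n + j)) t * g (t + x) \<partial>N)" if "x \<in> interior (B j)" for x
    proof -
      have "len x \<le> j" using that interior_subset in_B_iff by blast
      then have "t \<in> B (n + j)" if "g (t + x) \<noteq> 0" for t
        using supp[OF that] B_mono[of "n + len x" "n + j"] by auto
      then have eq: "indicator (B (n + j)) t * g (t + x) = g (t + x)" for t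
        by (cases "g (t + x) = 0") auto
      show ?thesis unfolding D_def eq ..
    qed
    ultimately show "continuous_on (interior (B j)) D"
      by (subst continuous_on_cong[OF refl]) (auto intro: continuous_on_subset)
  qed
  have Dpos: "D x > 0" for x
  proof -
    have "D x \<noteq> 0"
    proof
      assume "D x = 0"
      then have "AE t in N. g (t + x) = 0"
        unfolding D_def using integral_nonneg_eq_0_iff_AE[OF intg] g(2) by simp
      moreover have op: "open {t. g (t + x) \<noteq> 0}"
        using continuous_translation(2)[OF g(1)] by (intro open_Collect_neq) auto
      ultimately have "emeasure N {t. g (t + x) \<noteq> 0} = 0"
        using AE_iff_measurable[of "{t. g (t + x) \<noteq> 0}" N "\<lambda>t. g (t + x) = 0"]
        by (simp add: left_radon_space[OF N] sN)
      with op show False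
        using left_radon_open_pos[OF N _ _ N0, of "{t. g (t + x) \<noteq> 0}" "- x"] g(4)
        by (simp add: left_radon_space[OF N])
    qed
    moreover have "D x \<ge> 0" unfolding D_def using g by simp
    ultimately show ?thesis by simp
  qed
  \<comment> \<open>Dividing by \<open>D\<close> writes \<open>f x\<close> as the
    \<open>N\<close>-integral of \<open>F x * g (y + x)\<close> over \<open>y\<close>. After a swap,
    \<open>x\<close> is moved by \<open>- y\<close> under \<open>M\<close>; after swapping back,
    \<open>y\<close> is moved by \<open>x\<close> under \<open>N\<close>. Then \<open>x\<close>
    occurs only in \<open>g x\<close> and \<open>y\<close> only in \<open>F (- y)\<close>, so the
    double integral factors.\<close>
  define F where "F z = f z / D z" for z
  have contF: "continuous_on UNIV F"
    unfolding F_def using f contD Dpos by (intro continuous_intros) (auto simp: less_imp_neq[THEN not_sym])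
  have F0: "F z \<ge> 0" for z unfolding F_def using f Dpos[of z] by simp
  have [measurable]: "F \<in> borel_measurable borel" using contF by (rule borel_measurable_continuous_onI)
  have pm1: "(\<lambda>(x, y). F x * g (y + x)) \<in> borel_measurable (borel \<Otimes>\<^sub>M borel)"
    unfolding case_prod_unfold
    by (intro pair_measurable continuous_intros continuous_on_compose2[OF contF] continuous_on_compose2[OF g(1)]) auto
  have pm2: "(\<lambda>(x, y). F (- y + x) * g x) \<in> borel_measurable (borel \<Otimes>\<^sub>M borel)"
    unfolding case_prod_unfold
    by (intro pair_measurable continuous_intros continuous_on_compose2[OF contF] continuous_on_compose2[OF g(1)]) auto
  have sMN: "sets (M \<Otimes>\<^sub>M N) = sets (borel \<Otimes>\<^sub>M borel)" using sM sN by (rule sets_pair_measure_cong)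
  have "(\<integral>\<^sup>+x. f x \<partial>M) = (\<integral>\<^sup>+x. \<integral>\<^sup>+y. ennreal (F x * g (y + x)) \<partial>N \<partial>M)"
  proof (rule nn_integral_cong)
    fix x
    have "(\<integral>\<^sup>+y. ennreal (F x * g (y + x)) \<partial>N) = ennreal (\<integral>y. F x * g (y + x) \<partial>N)"
      using intg F0 g(2) by (intro nn_integral_eq_integral) auto
    also have "(\<integral>y. F x * g (y + x) \<partial>N) = F x * D x" unfolding D_def by simp
    also have "\<dots> = f x" unfolding F_def using Dpos[of x] by simp
    finally show "ennreal (f x) = (\<integral>\<^sup>+y. ennreal (F x * g (y + x)) \<partial>N)" by simp
  qed
  also have "\<dots> = (\<integral>\<^sup>+y. \<integral>\<^sup>+x. ennreal (F x * g (y + x)) \<partial>M \<partial>N)"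
    using MN.Fubini'[of "\<lambda>x y. ennreal (F x * g (y + x))"] measurable_compose[OF pm1 measurable_ennreal]
    by (simp add: measurable_cong_sets[OF sMN refl] case_prod_unfold)
  also have "\<dots> = (\<integral>\<^sup>+y. \<integral>\<^sup>+x. ennreal (F (- y + x) * g x) \<partial>M \<partial>N)"
  proof (rule nn_integral_cong)
    fix y
    have m: "(\<lambda>x. ennreal (F x * g (y + x))) \<in> borel_measurable borel"
      using measurable_translation(1)[of g borel y] by measurable
    show "(\<integral>\<^sup>+x. ennreal (F x * g (y + x)) \<partial>M) = (\<integral>\<^sup>+x. ennreal (F (- y + x) * g x) \<partial>M)"
      using left_radon_nn_integral[OF M m, of "- y"] by (simp add: add.assoc[symmetric])
  qed
  also have "\<dots> = (\<integral>\<^sup>+x. \<integral>\<^sup>+y. ennreal (F (- y + x) * g x) \<partial>N \<partial>M)"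
    using MN.Fubini'[of "\<lambda>x y. ennreal (F (- y + x) * g x)"] measurable_compose[OF pm2 measurable_ennreal]
    by (simp add: measurable_cong_sets[OF sMN refl] case_prod_unfold)
  also have "\<dots> = (\<integral>\<^sup>+x. g x * (\<integral>\<^sup>+y. ennreal (F (- y)) \<partial>N) \<partial>M)"
  proof (rule nn_integral_cong)
    fix x
    have m: "(\<lambda>y. F (- y + x)) \<in> borel_measurable borel"
      using measurable_translation(3)[OF measurable_translation(2)[of F borel x]] by measurable
    have m': "(\<lambda>y. F (- y)) \<in> borel_measurable borel"
      using measurable_translation(3)[of F borel] by measurable
    have "(\<integral>\<^sup>+y. ennreal (F (- y + x) * g x) \<partial>N) = (\<integral>\<^sup>+y. ennreal (F (- (x + y) + x) * g x) \<partial>N)"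
      by (rule left_radon_nn_integral[OF N, symmetric]) (use m in measurable)
    also have "\<dots> = (\<integral>\<^sup>+y. ennreal (g x) * ennreal (F (- y)) \<partial>N)"
      by (simp add: minus_add add.assoc ennreal_mult' g(2) mult.commute)
    also have "\<dots> = g x * (\<integral>\<^sup>+y. ennreal (F (- y)) \<partial>N)"
      using m' by (intro nn_integral_cmult) measurable
    finally show "(\<integral>\<^sup>+y. ennreal (F (- y + x) * g x) \<partial>N) = g x * (\<integral>\<^sup>+y. ennreal (F (- y)) \<partial>N)" .
  qed
  also have "\<dots> = (\<integral>\<^sup>+x. g x \<partial>M) * (\<integral>\<^sup>+y. ennreal (F (- y)) \<partial>N)"
    by (intro nn_integral_multc) measurable
  finally show ?thesis unfolding F_def .
qed

text \<open>A right translate of \<open>m\<close> is again left invariant, so by the factorisation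
  it is \<open>j / i\<close> times \<open>m\<close> on nonnegative continuous functions. Iterating
  \<open>n\<close> times compares \<open>(j / i) ^ n\<close> with the volume of a ball of radius
  linear in \<open>n\<close>, whence \<open>j / i \<le> 1\<close>. The opposite inequality will come
  from \<open>- s\<close>.\<close>

lemma nn_integral_right_le:
  fixes f :: "'a \<Rightarrow> real"
  assumes f: "continuous_on UNIV f" "\<And>x. 0 \<le> f x"
  shows "(\<integral>\<^sup>+x. f (x + s) \<partial>m) \<le> (\<integral>\<^sup>+x. f x \<partial>m)"
proof -
  let ?R = "distr m borel (\<lambda>x. x + s)"
  have nnR: "(\<integral>\<^sup>+x. f x \<partial>?R) = (\<integral>\<^sup>+x. f (x + s) \<partial>m)" if "f \<in> borel_measurable borel" for f
    using that by (intro nn_integral_distr) auto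
  have emR: "emeasure ?R A = emeasure m {x. x + s \<in> A}" if "A \<in> sets borel" for A
    using that by (simp add: emeasure_distr vimage_def)
  have LR: "left_radon ?R"
    unfolding left_radon_def
  proof (intro conjI allI)
    fix n
    have "{x. x + s \<in> B n} \<subseteq> B (n + len s)"
    proof clarify
      fix x assume "x + s \<in> B n"
      then show "x \<in> B (n + len s)" using len_diff_le[of x s] by (simp add: in_B_iff)
    qed
    then have "emeasure m {x. x + s \<in> B n} \<le> emeasure m (B (n + len s))"
      by (intro emeasure_mono) auto
    then show "emeasure ?R (B n) < \<infinity>" using finite_B[of "n + len s"] emR[of "B n"] by simp
  next
    fix g :: 'a
    have 1: "(+) g \<in> measurable borel borel" using translation_measurable(1)[of g] by simp
    have "distr ?R borel ((+) g) = distr m borel ((+) g \<circ> (\<lambda>x. x + s))"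
      by (intro distr_distr) (use 1 in auto)
    also have "(+) g \<circ> (\<lambda>x. x + s) = (\<lambda>x. x + s) \<circ> (+) g" by (auto simp: add.assoc)
    also have "distr m borel \<dots> = distr (distr m borel ((+) g)) borel (\<lambda>x. x + s)"
      by (rule distr_distr[symmetric]) (use 1 in auto)
    also have "\<dots> = ?R" using left_radon_m unfolding left_radon_def by simp
    finally show "distr ?R borel ((+) g) = ?R" .
  qed simp
  have "{0} \<subseteq> interior (B 2)" using B_subset_interior[of 0] by (simp add: numeral_2_eq_2)
  then obtain g where g: "continuous_on UNIV g" "\<And>x. 0 \<le> g x" "\<And>x. g x \<le> (1::real)"
    "g 0 = 1" "\<And>x. x \<notin> interior (B 2) \<Longrightarrow> g x = 0"
    using bump[of "{0}" "interior (B 2)"] by auto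
  have g2: "g x = 0" if "x \<notin> B 2" for x using g(5) that interior_subset by blast
  have gb[measurable]: "g \<in> borel_measurable borel" using g(1) by (rule borel_measurable_continuous_onI)
  \<comment> \<open>The factor that does not depend on \<open>M\<close>, with
    \<open>N = m\<close>.\<close>
  define K where "K f = (\<integral>\<^sup>+y. f (- y) / (\<integral>t. g (t + - y) \<partial>m) \<partial>m)" for f :: "'a \<Rightarrow> real"
  have factor: "(\<integral>\<^sup>+x. f x \<partial>M) = (\<integral>\<^sup>+x. g x \<partial>M) * K f"
    if "left_radon M" "continuous_on UNIV f" "\<And>x. 0 \<le> f x" for M f
    unfolding K_def by (rule nn_integral_left_radon_factor[OF that(1) left_radon_m that(2,3) g(1,2) g2]) (use g m_UNIV in auto)
  have g_le: "(\<integral>\<^sup>+x. g (x + w) \<partial>m) \<le> emeasure m (B (2 + len w))" for w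
  proof -
    have "(\<integral>\<^sup>+x. g (x + w) \<partial>m) \<le> (\<integral>\<^sup>+x. indicator (B (2 + len w)) x \<partial>m)"
    proof (rule nn_integral_mono)
      fix x
      have "x + w \<in> B 2 \<Longrightarrow> x \<in> B (2 + len w)" using len_diff_le[of x w] by (simp add: in_B_iff)
      then show "ennreal (g (x + w)) \<le> indicator (B (2 + len w)) x"
        using g2[of "x + w"] g(3)[of "x + w"] by (cases "x + w \<in> B 2") (auto simp: indicator_def)
    qed
    then show ?thesis by simp
  qed
  define i where "i = enn2real (\<integral>\<^sup>+x. g x \<partial>m)"
  define j where "j = enn2real (\<integral>\<^sup>+x. g (x + s) \<partial>m)"
  have fin: "(\<integral>\<^sup>+x. g (x + w) \<partial>m) < \<infinity>" for w using g_le finite_B le_less_trans by blast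
  have i: "(\<integral>\<^sup>+x. g x \<partial>m) = ennreal i" using fin[of 0] unfolding i_def by simp
  have j: "(\<integral>\<^sup>+x. g (x + s) \<partial>m) = ennreal j" using fin[of s] unfolding j_def by simp
  have "i > 0"
  proof -
    have "(\<integral>\<^sup>+x. g x \<partial>m) \<noteq> 0"
    proof
      assume "(\<integral>\<^sup>+x. g x \<partial>m) = 0"
      then have "emeasure m {x \<in> space m. ennreal (g x) \<noteq> 0} = 0"
        by (subst (asm) nn_integral_0_iff) auto
      moreover have "{x \<in> space m. ennreal (g x) \<noteq> 0} = {x. g x \<noteq> 0}" using g(2) by (auto simp: ennreal_eq_0_iff antisym)
      moreover have "open {x. g x \<noteq> 0}" using g(1) by (intro open_Collect_neq) auto
      ultimately show False using open_pos[of "{x. g x \<noteq> 0}" 0] g(4) by simp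
    qed
    then show ?thesis using i by (simp add: zero_less_iff_neq_zero[symmetric])
  qed
  have j0: "j \<ge> 0" unfolding j_def by simp
  have transl: "(\<integral>\<^sup>+x. f (x + s) \<partial>m) * ennreal i = ennreal j * (\<integral>\<^sup>+x. f x \<partial>m)"
    if f: "continuous_on UNIV f" "\<And>x. 0 \<le> f x" for f :: "'a \<Rightarrow> real"
  proof -
    have "(\<lambda>x. ennreal (f x)) \<in> borel_measurable borel" using borel_measurable_continuous_onI[OF f(1)] by measurable
    then have "(\<integral>\<^sup>+x. f (x + s) \<partial>m) = ennreal j * K f"
      using factor[OF LR f] nnR[of "\<lambda>x. ennreal (f x)"] nnR[of "\<lambda>x. ennreal (g x)"] j by simp
    moreover have "(\<integral>\<^sup>+x. f x \<partial>m) = ennreal i * K f" using factor[OF left_radon_m f] i by simp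
    ultimately show ?thesis by (simp add: mult.assoc mult.commute mult.left_commute)
  qed
  obtain c d where cd: "c > 0" "\<And>n. measure m (B n) \<le> c * (real n + 1) ^ d" using growthE by blast
  have "j / i \<le> 1"
  proof (rule power_le_polynomial_imp_le_one)
    fix n :: nat
    \<comment> \<open>\<open>w n\<close> is the \<open>n\<close>-fold sum of \<open>s\<close>.
      Translating \<open>\<lambda>x. g (x + w n)\<close> by \<open>s\<close> gives the next such
      function, so \<open>transl\<close> contributes one factor \<open>j / i\<close> per
      step.\<close>
    define w where "w n = ((+) s ^^ n) 0" for n
    have lw: "len (w n) \<le> n * len s" for n
    proof (induction n)
      case (Suc n)
      then show ?case using len_add[of s "w n"] by (simp add: w_def)
    qed (simp add: w_def)
    have "(\<integral>\<^sup>+x. g (x + w n) \<partial>m) * ennreal (i ^ n) = ennreal (j ^ n) * ennreal i"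
    proof (induction n)
      case 0
      then show ?case using i by (simp add: w_def)
    next
      case (Suc n)
      have "(\<integral>\<^sup>+x. g (x + w (Suc n)) \<partial>m) * ennreal (i ^ Suc n)
          = (\<integral>\<^sup>+x. g (x + s + w n) \<partial>m) * ennreal i * ennreal (i ^ n)"
        using \<open>i > 0\<close> by (simp add: w_def add.assoc ennreal_mult mult.assoc)
      also have "\<dots> = ennreal j * ((\<integral>\<^sup>+x. g (x + w n) \<partial>m) * ennreal (i ^ n))"
        using transl[of "\<lambda>x. g (x + w n)"] continuous_translation(2)[OF g(1)] g(2) by (simp add: mult.assoc)
      also have "\<dots> = ennreal (j ^ Suc n) * ennreal i"
        unfolding Suc using j0 by (simp add: ennreal_mult mult.assoc)
      finally show ?case .
    qed
    then have "ennreal (j ^ n * i) \<le> emeasure m (B (2 + len (w n))) * ennreal (i ^ n)"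
      using mult_right_mono[OF g_le[of "w n"], of "ennreal (i ^ n)"] j0 \<open>i > 0\<close>
      by (simp add: ennreal_mult)
    also have "\<dots> \<le> emeasure m (B (2 + n * len s)) * ennreal (i ^ n)"
      using lw[of n] by (intro mult_right_mono emeasure_mono B_mono) auto
    also have "emeasure m (B (2 + n * len s)) = ennreal (measure m (B (2 + n * len s)))"
      using finite_B by (intro emeasure_eq_ennreal_measure) (auto simp: less_top[symmetric])
    also have "\<dots> * ennreal (i ^ n) \<le> ennreal (c * (real (2 + n * len s) + 1) ^ d) * ennreal (i ^ n)"
      using cd(2)[of "2 + n * len s"] by (intro mult_right_mono ennreal_leI) auto
    also have "\<dots> = ennreal (c * (real (2 + n * len s) + 1) ^ d * i ^ n)"
      using \<open>i > 0\<close> cd(1) by (simp add: ennreal_mult)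
    finally have "j ^ n * i \<le> c * (real (2 + n * len s) + 1) ^ d * i ^ n"
      using cd(1) \<open>i > 0\<close> by (subst (asm) ennreal_le_iff) auto
    then show "(j / i) ^ n \<le> c / i * (real (len s) * real n + 3) ^ d"
      using \<open>i > 0\<close> by (simp add: power_divide field_simps)
  qed simp
  then have "j \<le> i" using \<open>i > 0\<close> by simp
  then have "(\<integral>\<^sup>+x. f (x + s) \<partial>m) * ennreal i \<le> ennreal i * (\<integral>\<^sup>+x. f x \<partial>m)"
    unfolding transl[OF f] by (intro mult_right_mono ennreal_leI) auto
  then have "ennreal i * (\<integral>\<^sup>+x. f (x + s) \<partial>m) \<le> ennreal i * (\<integral>\<^sup>+x. f x \<partial>m)" by (simp add: mult.commute)
  then show ?thesis using \<open>i > 0\<close> by (simp add: ennreal_mult_le_mult_iff)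
qed

text \<open>From functions to sets: by inner regularity and a bump between a compact
  \<open>K\<close> and an open \<open>U\<close>, translation does not decrease the measure of
  \<open>U\<close>. Outer regularity then shows that it does not increase the measure of any Borel
  set, and translating back gives equality.\<close>

lemma emeasure_right:
  assumes "A \<in> sets borel"
  shows "emeasure m {x. x + s \<in> A} = emeasure m A"
proof -
  have op: "emeasure m U \<le> emeasure m {x. x + s \<in> U}" if U: "open U" for U s
  proof -
    have "emeasure m K \<le> emeasure m {x. x + s \<in> U}" if K: "compact K" "K \<subseteq> U" for K
    proof -
      obtain h :: "'a \<Rightarrow> real" where h: "continuous_on UNIV h" "\<And>x. 0 \<le> h x" "\<And>x. h x \<le> 1"
        "\<And>x. x \<in> K \<Longrightarrow> h x = 1" "\<And>x. x \<notin> U \<Longrightarrow> h x = 0"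
        using bump[OF K(1) U K(2)] by metis
      have h': "continuous_on UNIV (\<lambda>x. h (x + s))" using h(1) by (rule continuous_translation)
      have "emeasure m K = (\<integral>\<^sup>+x. indicator K x \<partial>m)"
        using K by (simp add: compact_imp_closed)
      also have "\<dots> \<le> (\<integral>\<^sup>+x. h x \<partial>m)"
        using h by (intro nn_integral_mono) (auto simp: indicator_def)
      also have "\<dots> = (\<integral>\<^sup>+x. h (x + - s + s) \<partial>m)" by (simp add: add.assoc)
      also have "\<dots> \<le> (\<integral>\<^sup>+x. h (x + s) \<partial>m)"
        using h' h(2) by (intro nn_integral_right_le)
      also have "\<dots> \<le> (\<integral>\<^sup>+x. indicator {x. x + s \<in> U} x \<partial>m)"
        using h by (intro nn_integral_mono) (auto simp: indicator_def)
      also have "\<dots> = emeasure m {x. x + s \<in> U}"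
        using open_translation_vimage(2)[OF U] by simp
      finally show ?thesis .
    qed
    moreover have "emeasure m U = (SUP K\<in>{K. compact K \<and> K \<subseteq> U}. emeasure m K)"
      using haar U unfolding left_haar_measure_def by blast
    ultimately show ?thesis by (auto intro: SUP_least)
  qed
  have le: "emeasure m {x. x + s \<in> A} \<le> emeasure m A" if A: "A \<in> sets borel" for A s
  proof -
    have "emeasure m {x. x + s \<in> A} \<le> emeasure m U" if U: "open U" "A \<subseteq> U" for U
    proof -
      have "emeasure m {x. x + s \<in> A} \<le> emeasure m {x. x + s \<in> U}"
        using U open_translation_vimage(2)[OF U(1)] by (intro emeasure_mono) auto
      also have "\<dots> \<le> emeasure m {x. x + - s \<in> {x. x + s \<in> U}}"
        using open_translation_vimage(2)[OF U(1)] by (rule op)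
      also have "\<dots> = emeasure m U" by (simp add: add.assoc)
      finally show ?thesis .
    qed
    moreover have "emeasure m A = (INF U\<in>{U. open U \<and> A \<subseteq> U}. emeasure m U)"
      using haar A unfolding left_haar_measure_def by blast
    ultimately show ?thesis by (auto intro: INF_greatest)
  qed
  have "{x. x + s \<in> A} \<in> sets borel"
    using measurable_sets[OF translation_measurable(2)[of s] assms] by (simp add: vimage_def)
  from le[OF this, of "- s"] le[OF assms, of s] show ?thesis by (simp add: add.assoc)
qed

lemma distr_right: "distr m borel (\<lambda>x. x + s) = m"
proof (rule measure_eqI)
  fix A assume "A \<in> sets (distr m borel (\<lambda>x. x + s))"
  then show "emeasure (distr m borel (\<lambda>x. x + s)) A = emeasure m A"
    using emeasure_right[of A s] by (simp add: emeasure_distr vimage_def)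
qed simp

lemma nn_integral_right:
  assumes "f \<in> borel_measurable borel"
  shows "(\<integral>\<^sup>+x. f (x + s) \<partial>m) = (\<integral>\<^sup>+x. f x \<partial>m)"
  using nn_integral_distr[of "\<lambda>x. x + s" m borel f] assms distr_right[of s] by simp

lemma integral_right:
  fixes f :: "'a \<Rightarrow> 'c::{banach,second_countable_topology}"
  assumes "f \<in> borel_measurable borel"
  shows "(\<integral>x. f (x + s) \<partial>m) = (\<integral>x. f x \<partial>m)" "integrable m (\<lambda>x. f (x + s)) \<longleftrightarrow> integrable m f"
  using integral_distr[of "\<lambda>x. x + s" m borel f] integrable_distr_eq[of "\<lambda>x. x + s" m borel f] assms distr_right[of s]
  by simp_all

lemma integral_left:
  fixes f :: "'a \<Rightarrow> 'c::{banach,second_countable_topology}"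
  assumes "f \<in> borel_measurable borel"
  shows "(\<integral>x. f (s + x) \<partial>m) = (\<integral>x. f x \<partial>m)" "integrable m (\<lambda>x. f (s + x)) \<longleftrightarrow> integrable m f"
proof -
  have "distr m borel ((+) s) = m" using left_radon_m unfolding left_radon_def by simp
  moreover have "(+) s \<in> measurable m borel" using translation_measurable(1)[of s] by simp
  ultimately show "(\<integral>x. f (s + x) \<partial>m) = (\<integral>x. f x \<partial>m)" "integrable m (\<lambda>x. f (s + x)) \<longleftrightarrow> integrable m f"
    using integral_distr[of "(+) s" m borel f] integrable_distr_eq[of "(+) s" m borel f] assms by simp_all
qed

end

section \<open>Courteous measures and harmonic functions of polynomial growth\<close>

context compactly_generated
begin

text \<open>Unlike \<open>growth_norm\<close>, this names the constant, on which the error terms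
  depend quantitatively.\<close>

definition growth_bound :: "nat \<Rightarrow> real \<Rightarrow> ('a \<Rightarrow> complex) \<Rightarrow> bool" where
  "growth_bound k C f \<longleftrightarrow> (\<forall>x. cmod (f x) \<le> C * (1 + real (len x)) ^ k)"

lemma growth_boundD: "growth_bound k C f \<Longrightarrow> cmod (f x) \<le> C * (1 + real (len x)) ^ k"
  unfolding growth_bound_def by blast

lemma growth_bound_nonneg:
  assumes "growth_bound k C f" shows "0 \<le> C"
proof -
  have "cmod (f 0) \<le> C" using growth_boundD[OF assms, of 0] by simp
  then show ?thesis by (rule order_trans[OF norm_ge_zero])
qed

lemma growth_norm_finite_iff: "growth_norm S k f < \<infinity> \<longleftrightarrow> (\<exists>C. growth_bound k C f)"
proof
  assume "growth_norm S k f < \<infinity>"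
  then obtain K where K: "growth_norm S k f < K" "K < \<infinity>" using dense by blast
  have "\<forall>\<^sub>F r in at_top. ennreal (1 / r ^ k) * (SUP x\<in>{x. real (len x) \<le> r}. ennreal (cmod (f x))) < K"
    using K(1) unfolding growth_norm_def by (rule Limsup_lessD)
  then obtain R0 where R0: "\<And>r. r \<ge> R0 \<Longrightarrow>
      ennreal (1 / r ^ k) * (SUP x\<in>{x. real (len x) \<le> r}. ennreal (cmod (f x))) < K"
    unfolding eventually_at_top_linorder by blast
  define R where "R = max R0 1"
  have R: "R \<ge> 1" "R \<ge> R0" unfolding R_def by auto
  have "cmod (f x) \<le> enn2real K * R ^ k * (1 + real (len x)) ^ k" for x
  proof -
    \<comment> \<open>This radius lies beyond \<open>R0\<close> and is at least
      \<open>len x\<close>, so the bound on the supremum applies to the point itself, at the cost of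
      a factor \<open>R ^ k\<close>.\<close>
    define r where "r = R * (1 + real (len x))"
    have r: "r \<ge> R0" "r \<ge> 1" "real (len x) \<le> r"
    proof -
      have "R * 1 \<le> r" "1 * (1 + real (len x)) \<le> r"
        unfolding r_def using R by (intro mult_left_mono mult_right_mono; simp)+
      then show "r \<ge> R0" "r \<ge> 1" "real (len x) \<le> r" using R by auto
    qed
    have "ennreal (1 / r ^ k) * ennreal (cmod (f x))
        \<le> ennreal (1 / r ^ k) * (SUP x\<in>{x. real (len x) \<le> r}. ennreal (cmod (f x)))"
      using r by (intro mult_left_mono SUP_upper) auto
    also have "\<dots> \<le> K" using R0[OF r(1)] by simp
    also have "K = ennreal (enn2real K)" using K(2) by simp
    finally have "ennreal (cmod (f x) / r ^ k) \<le> ennreal (enn2real K)"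
      using r by (simp add: ennreal_mult[symmetric])
    then have "cmod (f x) / r ^ k \<le> enn2real K" by (subst (asm) ennreal_le_iff) auto
    then have "cmod (f x) \<le> enn2real K * r ^ k" using r by (simp add: field_simps)
    then show ?thesis by (simp add: r_def power_mult_distrib)
  qed
  then show "\<exists>C. growth_bound k C f" unfolding growth_bound_def by blast
next
  assume "\<exists>C. growth_bound k C f"
  then obtain C where C: "growth_bound k C f" by blast
  note C0 = growth_bound_nonneg[OF C]
  have "\<forall>\<^sub>F r in at_top. ennreal (1 / r ^ k) * (SUP x\<in>{x. real (len x) \<le> r}. ennreal (cmod (f x))) \<le> ennreal (C * 2 ^ k)"
    using eventually_ge_at_top[of 1]
  proof eventually_elim
    case (elim r)
    have "(SUP x\<in>{x. real (len x) \<le> r}. ennreal (cmod (f x))) \<le> ennreal (C * (2 * r) ^ k)"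
    proof (rule SUP_least, rule ennreal_leI)
      fix x assume "x \<in> {x. real (len x) \<le> r}"
      then have "C * (1 + real (len x)) ^ k \<le> C * (2 * r) ^ k"
        using elim C0 by (intro mult_left_mono power_mono) auto
      then show "cmod (f x) \<le> C * (2 * r) ^ k" using growth_boundD[OF C, of x] by linarith
    qed
    then have "ennreal (1 / r ^ k) * (SUP x\<in>{x. real (len x) \<le> r}. ennreal (cmod (f x)))
      \<le> ennreal (1 / r ^ k) * ennreal (C * (2 * r) ^ k)" by (intro mult_left_mono) auto
    also have "\<dots> = ennreal (C * 2 ^ k)"
      using elim C0 by (simp add: ennreal_mult[symmetric] power_mult_distrib)
    finally show ?case .
  qed
  then have "growth_norm S k f \<le> ennreal (C * 2 ^ k)" unfolding growth_norm_def by (rule Limsup_bounded)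
  then show "growth_norm S k f < \<infinity>" using le_less_trans by fastforce
qed

lemma growth_bound_add:
  "growth_bound k C f \<Longrightarrow> growth_bound k D g \<Longrightarrow> growth_bound k (C + D) (\<lambda>x. f x + g x)"
  unfolding growth_bound_def by (metis add_mono distrib_right norm_triangle_le)

lemma growth_bound_scale: "growth_bound k C f \<Longrightarrow> growth_bound k (cmod c * C) (\<lambda>x. c * f x)"
  unfolding growth_bound_def by (simp add: norm_mult mult.assoc mult_left_mono)

text \<open>\<open>1 + len\<close> is submultiplicative. This separates the starting point from the
  step, so that integrals over the step become moments of \<open>\<mu>\<close>.\<close>

lemma growth_bound_shift:
  assumes "growth_bound k C f"
  shows "cmod (f (x + s)) \<le> C * (1 + real (len x)) ^ k * (1 + real (len s)) ^ k"
proof -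
  have "1 + real (len (x + s)) \<le> (1 + real (len x)) * (1 + real (len s))"
  proof -
    have "(1 + real (len x)) * (1 + real (len s)) = 1 + real (len x) + real (len s) + real (len x) * real (len s)"
      by (simp add: algebra_simps)
    moreover have "0 \<le> real (len x) * real (len s)" by simp
    ultimately show ?thesis using len_add[of x s] by linarith
  qed
  then have "C * (1 + real (len (x + s))) ^ k \<le> C * ((1 + real (len x)) * (1 + real (len s))) ^ k"
    using growth_bound_nonneg[OF assms] by (intro mult_left_mono power_mono) auto
  then show ?thesis using growth_boundD[OF assms, of "x + s"] by (simp add: power_mult_distrib mult.assoc)
qed

end

section \<open>Moments of the step measure, the space of harmonic functions, continuity\<close>

locale courteous_walk = haar_growth +
  fixes \<mu> :: "'a measure"
  assumes courteous: "courteous S m \<mu>"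
begin

sublocale mu: prob_space \<mu>
  using courteous unfolding courteous_def by simp

lemma sets_mu [measurable_cong, simp]: "sets \<mu> = sets borel"
  using courteous unfolding courteous_def by simp

lemma space_mu [simp]: "space \<mu> = UNIV"
  using sets_mu sets_eq_imp_space_eq by fastforce

lemma density_mu: obtains \<rho> where "continuous_on UNIV \<rho>" "\<And>x. 0 \<le> \<rho> x" "\<mu> = density m (\<lambda>x. ennreal (\<rho> x))"
  using courteous unfolding courteous_def by blast

lemma distr_uminus_mu: "distr \<mu> borel uminus = \<mu>"
proof (rule measure_eqI)
  fix A assume "A \<in> sets (distr \<mu> borel uminus)"
  then have A: "A \<in> sets borel" by simp
  have "uminus -` A = uminus ` A" by (force simp: image_iff)
  then have "emeasure (distr \<mu> borel uminus) A = emeasure \<mu> (uminus ` A)"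
    using A translation_measurable(3) by (simp add: emeasure_distr)
  also have "\<dots> = emeasure \<mu> A" using A courteous unfolding courteous_def by simp
  finally show "emeasure (distr \<mu> borel uminus) A = emeasure \<mu> A" .
qed simp

lemma integral_uminus:
  fixes f :: "'a \<Rightarrow> 'c::{banach,second_countable_topology}"
  assumes "f \<in> borel_measurable borel"
  shows "(\<integral>s. f (- s) \<partial>\<mu>) = (\<integral>s. f s \<partial>\<mu>)"
  using integral_distr[of uminus \<mu> borel f] assms distr_uminus_mu translation_measurable(3) by simp

text \<open>Sum over the shells \<open>len s = n\<close>, on which the exponential tail beats every
  power.\<close>

lemma integrable_moment: "integrable \<mu> (\<lambda>s. (1 + real (len s)) ^ p)"
proof -
  obtain c where c: "c > 0" "\<forall>\<^sub>F t in at_top. measure \<mu> {x. real (len x) > t} \<le> exp (- c * t)"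
    using courteous unfolding courteous_def by blast
  then obtain T where T: "\<And>t. t \<ge> T \<Longrightarrow> measure \<mu> {x. real (len x) > t} \<le> exp (- c * t)"
    unfolding eventually_at_top_linorder by blast
  \<comment> \<open>The tail event is a strict inequality, so shell \<open>n\<close> is bounded by
    the tail at \<open>n - 1\<close>. From \<open>N\<close> on, \<open>n - 1\<close> is at least
    \<open>T\<close>; earlier shells get the trivial bound 1.\<close>
  define N where "N = nat \<lceil>T\<rceil> + 1"
  define a where "a n = (if n < N then 1 else exp (- c * (real n - 1)))" for n
  have a: "emeasure \<mu> {x. len x = n} \<le> ennreal (a n)" for n
  proof (cases "n < N")
    case False
    then have "T \<le> real n - 1" unfolding N_def by linarith
    have "{x. real n - 1 < real (len x)} \<in> sets \<mu>"
      using measurable_sets[OF len_measurable, of "{k. real n - 1 < real k}"] by (simp add: vimage_def)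
    then have "emeasure \<mu> {x. len x = n} \<le> emeasure \<mu> {x. real (len x) > real n - 1}"
      by (intro emeasure_mono) auto
    also have "\<dots> \<le> ennreal (exp (- c * (real n - 1)))"
      using T[OF \<open>T \<le> real n - 1\<close>] by (simp add: mu.emeasure_eq_measure)
    finally show ?thesis using False unfolding a_def by simp
  qed (simp add: a_def mu.emeasure_eq_measure)
  have "summable (\<lambda>n. (1 + real n) ^ p * a n)"
  proof (rule summable_comparison_test_ev)
    have "\<forall>\<^sub>F n in sequentially. (1 + real n) ^ p * exp (- c * (real n - 1)) \<le> 1 / (real n) ^ 2"
      using c(1) by real_asymp
    then show "\<forall>\<^sub>F n in sequentially. norm ((1 + real n) ^ p * a n) \<le> 1 / (real n) ^ 2"
      using eventually_ge_at_top[of N] by eventually_elim (simp add: a_def)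
    show "summable (\<lambda>n. 1 / (real n)\<^sup>2)" using inverse_power_summable[of 2, where ?'a = real] by (simp add: divide_inverse)
  qed
  then have fin: "(\<Sum>n. ennreal ((1 + real n) ^ p * a n)) < \<infinity>"
    by (subst suminf_ennreal2) (auto simp: a_def)
  have lm: "{x. len x = n} \<in> sets borel" for n
    using measurable_sets[OF len_measurable, of "{n}"] by (simp add: vimage_def)
  have "(\<integral>\<^sup>+s. ennreal ((1 + real (len s)) ^ p) \<partial>\<mu>)
      = (\<integral>\<^sup>+s. (\<Sum>n. ennreal ((1 + real n) ^ p) * indicator {x. len x = n} s) \<partial>\<mu>)"
  proof (rule nn_integral_cong)
    fix s
    show "ennreal ((1 + real (len s)) ^ p) = (\<Sum>n. ennreal ((1 + real n) ^ p) * indicator {x. len x = n} s)"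
      by (subst suminf_finite[of "{len s}"]) auto
  qed
  also have "\<dots> = (\<Sum>n. \<integral>\<^sup>+s. ennreal ((1 + real n) ^ p) * indicator {x. len x = n} s \<partial>\<mu>)"
    using lm by (intro nn_integral_suminf) auto
  also have "\<dots> = (\<Sum>n. ennreal ((1 + real n) ^ p) * emeasure \<mu> {x. len x = n})"
    using lm by (simp add: nn_integral_cmult_indicator)
  also have "\<dots> \<le> (\<Sum>n. ennreal ((1 + real n) ^ p * a n))"
  proof (intro suminf_le)
    fix n
    have "a n \<ge> 0" by (simp add: a_def)
    then show "ennreal ((1 + real n) ^ p) * emeasure \<mu> {x. len x = n} \<le> ennreal ((1 + real n) ^ p * a n)"
      using mult_left_mono[OF a[of n], of "ennreal ((1 + real n) ^ p)"] by (simp add: ennreal_mult)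
  qed auto
  finally have "(\<integral>\<^sup>+s. ennreal ((1 + real (len s)) ^ p) \<partial>\<mu>) < \<infinity>" using fin le_less_trans by blast
  moreover have "(\<lambda>s. (1 + real (len s)) ^ p) \<in> borel_measurable borel"
    using measurable_compose[OF len_measurable, of "\<lambda>n. (1 + real n) ^ p" borel] by simp
  ultimately show ?thesis by (intro integrableI_bounded) auto
qed

definition moment :: "nat \<Rightarrow> real" where "moment p = (\<integral>s. (1 + real (len s)) ^ p \<partial>\<mu>)"

lemma moment_nonneg: "moment p \<ge> 0"
  unfolding moment_def by simp

lemma integrable_growth_bound:
  assumes "growth_bound k C f" "f \<in> borel_measurable borel"
  shows "integrable \<mu> (\<lambda>s. f (x + s))"
proof (rule Bochner_Integration.integrable_bound)
  show "integrable \<mu> (\<lambda>s. C * (1 + real (len x)) ^ k * (1 + real (len s)) ^ k)"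
    using integrable_moment by simp
  show "(\<lambda>s. f (x + s)) \<in> borel_measurable \<mu>" using measurable_translation(1)[OF assms(2)] by simp
  show "AE s in \<mu>. cmod (f (x + s)) \<le> norm (C * (1 + real (len x)) ^ k * (1 + real (len s)) ^ k)"
    using growth_bound_shift[OF assms(1), of x] growth_bound_nonneg[OF assms(1)] by simp
qed

lemma HF_iff:
  "f \<in> HF S \<mu> k \<longleftrightarrow> f \<in> borel_measurable borel \<and> (\<forall>x. f x = (\<integral>s. f (x + s) \<partial>\<mu>)) \<and> (\<exists>C. growth_bound k C f)"
  unfolding HF_def harmonic_def mem_Collect_eq growth_norm_finite_iff
  using integrable_growth_bound by blast

lemma HF_D:
  assumes "f \<in> HF S \<mu> k"
  shows "f \<in> borel_measurable borel" "f x = (\<integral>s. f (x + s) \<partial>\<mu>)" "integrable \<mu> (\<lambda>s. f (x + s))"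
  using assms integrable_growth_bound unfolding HF_iff by blast+

lemma HF_growth_bound: "f \<in> HF S \<mu> k \<Longrightarrow> \<exists>C. growth_bound k C f"
  unfolding HF_iff by blast

lemma HF_zero: "(\<lambda>x. 0) \<in> HF S \<mu> k"
proof -
  have "growth_bound k 0 (\<lambda>x. 0)" unfolding growth_bound_def by simp
  then show ?thesis unfolding HF_iff by auto
qed

lemma HF_scale:
  assumes f: "f \<in> HF S \<mu> k"
  shows "(\<lambda>x. c * f x) \<in> HF S \<mu> k"
  unfolding HF_iff
proof (intro conjI allI)
  show "(\<lambda>x. c * f x) \<in> borel_measurable borel" using HF_D(1)[OF f] by simp
  show "\<exists>C. growth_bound k C (\<lambda>x. c * f x)" using HF_growth_bound[OF f] growth_bound_scale by blast
  fix x
  have "c * f x = c * (\<integral>s. f (x + s) \<partial>\<mu>)" using HF_D(2)[OF f, of x] by (rule arg_cong)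
  then show "c * f x = (\<integral>s. c * f (x + s) \<partial>\<mu>)" by (simp only: integral_mult_right_zero)
qed

lemma HF_add:
  assumes f: "f \<in> HF S \<mu> k" and g: "g \<in> HF S \<mu> k"
  shows "(\<lambda>x. f x + g x) \<in> HF S \<mu> k"
  unfolding HF_iff
proof (intro conjI allI)
  show "(\<lambda>x. f x + g x) \<in> borel_measurable borel" using HF_D(1)[OF f] HF_D(1)[OF g] by simp
  show "\<exists>C. growth_bound k C (\<lambda>x. f x + g x)"
    using HF_growth_bound[OF f] HF_growth_bound[OF g] growth_bound_add by blast
  fix x
  have "f x + g x = (\<integral>s. f (x + s) \<partial>\<mu>) + (\<integral>s. g (x + s) \<partial>\<mu>)"
    using HF_D(2)[OF f, of x] HF_D(2)[OF g, of x] by (rule arg_cong2)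
  also have "\<dots> = (\<integral>s. f (x + s) + g (x + s) \<partial>\<mu>)"
    using HF_D(3)[OF f, of x] HF_D(3)[OF g, of x] by (rule Bochner_Integration.integral_add[symmetric])
  finally show "f x + g x = (\<integral>s. f (x + s) + g (x + s) \<partial>\<mu>)" .
qed

text \<open>\<open>f\<close> is its own average against a continuous density. Truncated to balls,
  \<open>f\<close> yields integrals over compact sets that are continuous in \<open>x\<close>, and
  these converge locally uniformly because \<open>\<mu>\<close> has a moment of order
  \<open>k + 1\<close>. Continuity is what gives access to Fubini's theorem later.\<close>

lemma HF_continuous:
  assumes "f \<in> HF S \<mu> k"
  shows "continuous_on UNIV f"
proof (rule continuous_on_interior_B)
  fix L
  obtain C where fm [measurable]: "f \<in> borel_measurable borel" and fh: "\<And>x. f x = (\<integral>s. f (x + s) \<partial>\<mu>)"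
    and C: "growth_bound k C f" using assms unfolding HF_iff by blast
  note C0 = growth_bound_nonneg[OF C]
  obtain \<rho> where \<rho>: "continuous_on UNIV \<rho>" "\<And>x. 0 \<le> \<rho> x" "\<mu> = density m (\<lambda>x. ennreal (\<rho> x))"
    using density_mu by metis
  define w where "w n y = indicator (B n) y * f y" for n y
  have wm [measurable]: "w n \<in> borel_measurable borel" for n unfolding w_def by measurable
  have wint: "integrable m (w n)" for n
  proof (rule Bochner_Integration.integrable_bound)
    show "integrable m (\<lambda>y. C * (1 + real n) ^ k * indicator (B n) y)"
      using finite_B[of n] by simp
    have "cmod (w n y) \<le> norm (C * (1 + real n) ^ k * indicator (B n) y)" for y
    proof (cases "y \<in> B n")
      case True
      then have "C * (1 + real (len y)) ^ k \<le> C * (1 + real n) ^ k"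
        using C0 by (intro mult_left_mono power_mono) (auto simp: in_B_iff)
      then show ?thesis using True growth_boundD[OF C, of y] C0 by (simp add: w_def)
    qed (simp add: w_def)
    then show "AE y in m. cmod (w n y) \<le> norm (C * (1 + real n) ^ k * indicator (B n) y)" by simp
  qed measurable
  define F where "F n x = (\<integral>y. w n y * complex_of_real (\<rho> (- x + y)) \<partial>m)" for n x
  have contF: "continuous_on UNIV (F n)" for n
    unfolding F_def
  proof (rule continuous_on_integral_param[OF _ compact_B[of n] sets_m wint])
    have "continuous_on UNIV (\<lambda>z. \<rho> (- snd z + fst z))"
      by (rule continuous_on_compose2[OF \<rho>(1)]) (auto intro!: continuous_intros)
    then show "continuous_on UNIV (\<lambda>(t, x). complex_of_real (\<rho> (- x + t)))"
      by (auto simp: case_prod_unfold intro!: continuous_intros)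
  qed (simp add: w_def)
  have [measurable]: "\<rho> \<in> borel_measurable borel" using \<rho>(1) by (rule borel_measurable_continuous_onI)
  have Feq: "F n x = (\<integral>s. w n (x + s) \<partial>\<mu>)" for n x
  proof -
    have [measurable]: "(\<lambda>y. \<rho> (- x + y)) \<in> borel_measurable borel" "(\<lambda>y. w n (x + y)) \<in> borel_measurable borel"
      by (intro measurable_translation; measurable)+
    have "F n x = (\<integral>s. w n (x + s) * complex_of_real (\<rho> (- x + (x + s))) \<partial>m)"
      unfolding F_def by (rule integral_left(1)[symmetric]) measurable
    also have "\<dots> = (\<integral>s. \<rho> s *\<^sub>R w n (x + s) \<partial>m)"
      by (simp add: add.assoc[symmetric] scaleR_conv_of_real mult.commute)
    also have "\<dots> = (\<integral>s. w n (x + s) \<partial>\<mu>)"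
      unfolding \<rho>(3) using \<rho>(2) by (intro integral_density[symmetric]) auto
    finally show ?thesis .
  qed
  define Q where "Q = C * (1 + real L) ^ k * moment (k + 1)"
  have err: "dist (F n x) (f x) \<le> Q / (real n + 1 - real L)" if x: "x \<in> interior (B L)" and n: "L \<le> n" for n x
  proof -
    have lx: "len x \<le> L" using x interior_subset in_B_iff by blast
    have i1: "integrable \<mu> (\<lambda>s. f (x + s))" by (rule integrable_growth_bound[OF C fm])
    have wb: "growth_bound k C (w n)"
      unfolding growth_bound_def
    proof
      fix y show "cmod (w n y) \<le> C * (1 + real (len y)) ^ k"
        using growth_boundD[OF C, of y] C0 by (cases "y \<in> B n") (auto simp: w_def)
    qed
    have i2: "integrable \<mu> (\<lambda>s. w n (x + s))" by (rule integrable_growth_bound[OF wb wm])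
    have "dist (F n x) (f x) = norm (\<integral>s. w n (x + s) - f (x + s) \<partial>\<mu>)"
      unfolding Feq dist_norm by (subst fh[of x]) (use i1 i2 in simp)
    also have "\<dots> \<le> (\<integral>s. norm (w n (x + s) - f (x + s)) \<partial>\<mu>)" by (rule integral_norm_bound)
    also have "\<dots> \<le> (\<integral>s. C * (1 + real L) ^ k / (real n + 1 - real L) * (1 + real (len s)) ^ (k + 1) \<partial>\<mu>)"
    proof (rule integral_mono)
      fix s
      show "norm (w n (x + s) - f (x + s)) \<le> C * (1 + real L) ^ k / (real n + 1 - real L) * (1 + real (len s)) ^ (k + 1)"
      proof (cases "x + s \<in> B n")
        case True
        then show ?thesis using C0 n by (simp add: w_def)
      next
        case False
        then have "real n + 1 - real L \<le> 1 + real (len s)" using lx len_add[of x s] by (simp add: in_B_iff)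
        \<comment> \<open>If \<open>x + s\<close> leaves \<open>B n\<close>, the step is long;
          inserting this factor spends the extra moment to gain decay in \<open>n\<close>.\<close>
        then have 1: "1 \<le> (1 + real (len s)) / (real n + 1 - real L)" using n by simp
        have "norm (w n (x + s) - f (x + s)) \<le> C * (1 + real (len x)) ^ k * (1 + real (len s)) ^ k"
          using False growth_bound_shift[OF C, of x s] by (simp add: w_def)
        also have "\<dots> \<le> C * (1 + real L) ^ k * (1 + real (len s)) ^ k"
          using lx C0 by (intro mult_right_mono mult_left_mono power_mono) auto
        also have "\<dots> * 1 \<le> C * (1 + real L) ^ k * (1 + real (len s)) ^ k * ((1 + real (len s)) / (real n + 1 - real L))"
          using 1 C0 by (intro mult_left_mono) auto
        finally show ?thesis by (simp add: field_simps)
      qed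
    next
      show "integrable \<mu> (\<lambda>s. C * (1 + real L) ^ k / (real n + 1 - real L) * (1 + real (len s)) ^ (k + 1))"
        by (intro integrable_mult_right integrable_moment)
    qed (use i1 i2 in auto)
    also have "\<dots> = Q / (real n + 1 - real L)" by (simp add: Q_def moment_def)
    finally show ?thesis .
  qed
  have "uniform_limit (interior (B L)) F f sequentially"
  proof (rule uniform_limitI)
    fix e :: real assume "e > 0"
    have "\<forall>\<^sub>F n in sequentially. Q / (real n + 1 - real L) < e" using \<open>e > 0\<close> by real_asymp
    then show "\<forall>\<^sub>F n in sequentially. \<forall>x\<in>interior (B L). dist (F n x) (f x) < e"
      using eventually_ge_at_top[of L] by eventually_elim (use err in fastforce)
  qed
  then show "continuous_on (interior (B L)) f"
    by (rule uniform_limit_theorem[rotated]) (use contF in \<open>auto intro: continuous_on_subset always_eventually\<close>)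
qed

end

section \<open>The energy form and the pseudo-Poincare inequality\<close>

text \<open>The weight \<open>a\<close> stays free: splitting a word one letter at a time with
  \<open>a = 1\<close> throughout would lose exponentially in its length.\<close>

lemma norm_add_square_le:
  fixes u v :: "'a::real_normed_vector"
  assumes "a > 0"
  shows "(norm (u + v))\<^sup>2 \<le> (1 + a) * (norm u)\<^sup>2 + (1 + 1 / a) * (norm v)\<^sup>2"
proof -
  have "(norm (u + v))\<^sup>2 \<le> (norm u + norm v)\<^sup>2" by (intro power_mono norm_triangle_ineq) simp
  also have "0 \<le> (a * norm u - norm v)\<^sup>2 / a" using assms by simp
  then have "(norm u + norm v)\<^sup>2 \<le> (1 + a) * (norm u)\<^sup>2 + (1 + 1 / a) * (norm v)\<^sup>2"
    using assms by (simp add: power2_eq_square field_simps)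
  finally show ?thesis .
qed

context haar_growth
begin

lemma sigma_finite_m: "sigma_finite_measure m"
  by (rule left_radon_sigma_finite[OF left_radon_m])

lemma integrable_on_B:
  fixes h :: "'a \<Rightarrow> 'c::{banach,second_countable_topology}"
  assumes "continuous_on UNIV h"
  shows "integrable m (\<lambda>s. indicator (B n) s *\<^sub>R h s)"
proof -
  have "bounded (h ` B n)"
    using assms compact_B by (intro compact_imp_bounded compact_continuous_image) (auto intro: continuous_on_subset)
  then obtain b where b: "\<And>x. x \<in> B n \<Longrightarrow> norm (h x) \<le> b" by (auto simp: bounded_iff)
  have [measurable]: "h \<in> borel_measurable borel" using assms by (rule borel_measurable_continuous_onI)
  show ?thesis
  proof (rule Bochner_Integration.integrable_bound)
    show "integrable m (\<lambda>s. b * indicator (B n) s)" using finite_B[of n] by simp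
    have "norm (indicator (B n) s *\<^sub>R h s) \<le> norm (b * indicator (B n) s)" for s
      using b[of s] by (cases "s \<in> B n") auto
    then show "AE s in m. norm (indicator (B n) s *\<^sub>R h s) \<le> norm (b * indicator (B n) s)" by simp
  qed measurable
qed

definition shift_energy :: "('a \<Rightarrow> complex) \<Rightarrow> 'a \<Rightarrow> ennreal" where
  "shift_energy g s = (\<integral>\<^sup>+x. ennreal ((cmod (g x - g (x + s)))\<^sup>2) \<partial>m)"

lemma shift_pair_measurable:
  fixes g :: "'a \<Rightarrow> complex"
  assumes "continuous_on UNIV g"
  shows "(\<lambda>(x, s). ennreal ((cmod (g x - g (x + s)))\<^sup>2)) \<in> borel_measurable (borel \<Otimes>\<^sub>M borel)"
proof -
  have "continuous_on UNIV (\<lambda>z::'a \<times> 'a. (cmod (g (fst z) - g (fst z + snd z)))\<^sup>2)"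
    by (intro continuous_intros continuous_on_compose2[OF assms]) auto
  then show ?thesis
    unfolding case_prod_unfold by (intro measurable_compose[OF pair_measurable measurable_ennreal])
qed

lemma shift_measurable:
  fixes g :: "'a \<Rightarrow> complex"
  assumes "continuous_on UNIV g"
  shows "(\<lambda>x. ennreal ((cmod (g x - g (x + s)))\<^sup>2)) \<in> borel_measurable borel"
proof -
  have "continuous_on UNIV (\<lambda>x. (cmod (g x - g (x + s)))\<^sup>2)"
    by (intro continuous_intros assms continuous_translation(2)[OF assms])
  then have "(\<lambda>x. (cmod (g x - g (x + s)))\<^sup>2) \<in> borel_measurable borel" by (rule borel_measurable_continuous_onI)
  then show ?thesis by measurable
qed

lemma shift_energy_measurable:
  assumes "continuous_on UNIV g"
  shows "shift_energy g \<in> borel_measurable borel"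
proof -
  interpret sigma_finite_measure m by (rule sigma_finite_m)
  have "(\<lambda>z::'a \<times> 'a. (\<lambda>(x, s). ennreal ((cmod (g x - g (x + s)))\<^sup>2)) (snd z, fst z)) \<in> borel_measurable (borel \<Otimes>\<^sub>M borel)"
    by (rule measurable_compose[OF _ shift_pair_measurable[OF assms]]) measurable
  then have "(\<lambda>(s, x). ennreal ((cmod (g x - g (x + s)))\<^sup>2)) \<in> borel_measurable (borel \<Otimes>\<^sub>M m)"
    by (simp add: case_prod_unfold measurable_cong_sets[OF sets_pair_measure_cong[OF refl sets_m] refl])
  then show ?thesis unfolding shift_energy_def by (rule borel_measurable_nn_integral)
qed

text \<open>The second increment is the increment by \<open>t\<close> seen from
  \<open>x + s\<close>, and right invariance removes the \<open>s\<close>.\<close>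

lemma shift_energy_add:
  assumes g: "continuous_on UNIV g" and a: "a > 0"
  shows "shift_energy g (s + t) \<le> ennreal (1 + a) * shift_energy g s + ennreal (1 + 1 / a) * shift_energy g t"
proof -
  let ?h = "\<lambda>s x. ennreal ((cmod (g x - g (x + s)))\<^sup>2)"
  note h[measurable] = shift_measurable[OF g]
  have [measurable]: "(\<lambda>x. ?h t (x + s)) \<in> borel_measurable borel"
    by (rule measurable_translation(2)[OF h])
  have "?h (s + t) x \<le> ennreal (1 + a) * ?h s x + ennreal (1 + 1 / a) * ?h t (x + s)" for x
  proof -
    have "(cmod (g x - g (x + (s + t))))\<^sup>2
        \<le> (1 + a) * (cmod (g x - g (x + s)))\<^sup>2 + (1 + 1 / a) * (cmod (g (x + s) - g (x + s + t)))\<^sup>2"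
      using norm_add_square_le[OF a, of "g x - g (x + s)" "g (x + s) - g (x + s + t)"] by (simp add: add.assoc)
    then show ?thesis using a by (simp add: ennreal_mult[symmetric] ennreal_plus[symmetric] ennreal_leI del: ennreal_plus)
  qed
  then have "shift_energy g (s + t) \<le> (\<integral>\<^sup>+x. ennreal (1 + a) * ?h s x + ennreal (1 + 1 / a) * ?h t (x + s) \<partial>m)"
    unfolding shift_energy_def by (intro nn_integral_mono)
  also have "\<dots> = ennreal (1 + a) * shift_energy g s + ennreal (1 + 1 / a) * (\<integral>\<^sup>+x. ?h t (x + s) \<partial>m)"
    unfolding shift_energy_def
    by (subst nn_integral_add, measurable) (subst (1 2) nn_integral_cmult, measurable)
  also have "(\<integral>\<^sup>+x. ?h t (x + s) \<partial>m) = shift_energy g t"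
    unfolding shift_energy_def by (rule nn_integral_right[OF h])
  finally show ?thesis .
qed

lemma shift_energy_add2:
  assumes "continuous_on UNIV g"
  shows "shift_energy g (s + t) \<le> 2 * shift_energy g s + 2 * shift_energy g t"
  using shift_energy_add[OF assms, of 1 s t] by simp

lemma shift_energy_uminus:
  assumes g: "continuous_on UNIV g"
  shows "shift_energy g (- s) = shift_energy g s"
  unfolding shift_energy_def
  using nn_integral_right[OF shift_measurable[OF g, of "- s"], of s]
  by (simp add: add.assoc norm_minus_commute)

lemma shift_energy_zero [simp]: "shift_energy g 0 = 0"
  unfolding shift_energy_def by simp

end

section \<open>The energy of the walk controls every translation\<close>

context courteous_walk
begin

definition energy :: "('a \<Rightarrow> complex) \<Rightarrow> ennreal" where
  "energy g = (\<integral>\<^sup>+s. shift_energy g s \<partial>\<mu>)"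

text \<open>Asking for a whole neighbourhood with one constant makes the set open, and lets
  compactness of \<open>S\<close> produce a single constant in
  \<open>shift_energy_bound\<close>.\<close>

definition energy_controlled :: "'a set" where
  "energy_controlled = {s. \<exists>W C. open W \<and> s \<in> W \<and>
     (\<forall>t\<in>W. \<forall>g. continuous_on UNIV g \<longrightarrow> shift_energy g t \<le> ennreal C * energy g)}"

lemma energy_controlledI:
  "open W \<Longrightarrow> s \<in> W \<Longrightarrow> (\<And>t g. t \<in> W \<Longrightarrow> continuous_on UNIV g \<Longrightarrow> shift_energy g t \<le> ennreal C * energy g)
    \<Longrightarrow> s \<in> energy_controlled"
  unfolding energy_controlled_def by blast

lemma energy_controlledD:
  assumes "s \<in> energy_controlled"
  shows "\<exists>W C. open W \<and> s \<in> W \<and> C \<ge> 0 \<and> W \<subseteq> energy_controlled \<and>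
    (\<forall>t\<in>W. \<forall>g. continuous_on UNIV g \<longrightarrow> shift_energy g t \<le> ennreal C * energy g)"
proof -
  obtain W C where W: "open W" "s \<in> W"
    "\<And>t g. t \<in> W \<Longrightarrow> continuous_on UNIV g \<Longrightarrow> shift_energy g t \<le> ennreal C * energy g"
    using assms unfolding energy_controlled_def by blast
  have "shift_energy g t \<le> ennreal (max C 0) * energy g" if "t \<in> W" "continuous_on UNIV g" for t g
    using W(3)[OF that] by (rule order_trans) (intro mult_right_mono ennreal_leI; simp)
  moreover have "W \<subseteq> energy_controlled" using energy_controlledI W by blast
  ultimately show ?thesis using W by (intro exI[of _ W] exI[of _ "max C 0"]) auto
qed

text \<open>Energy controls shifts only on average over \<open>\<mu>\<close>. Where the density is
  bounded below, this becomes an average over \<open>m\<close>, which can be translated.\<close>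

lemma shift_energy_local_average:
  assumes \<rho>: "\<mu> = density m (\<lambda>x. ennreal (\<rho> x))" "continuous_on UNIV \<rho>"
    and W: "W \<in> sets borel" "\<And>u. u \<in> W \<Longrightarrow> \<delta> \<le> \<rho> u" "\<delta> > 0"
    and g: "continuous_on UNIV g"
  shows "(\<integral>\<^sup>+u. indicator W u * shift_energy g u \<partial>m) \<le> ennreal (1 / \<delta>) * energy g"
proof -
  note [measurable] = shift_energy_measurable[OF g] borel_measurable_continuous_onI[OF \<rho>(2)]
  have "indicator W u * shift_energy g u \<le> ennreal (1 / \<delta>) * (ennreal (\<rho> u) * shift_energy g u)" for u
  proof (cases "u \<in> W")
    case True
    then have "1 \<le> 1 / \<delta> * \<rho> u" using W(2)[of u] W(3) by (simp add: field_simps)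
    then have "1 \<le> ennreal (1 / \<delta> * \<rho> u)" using ennreal_leI by fastforce
    also have "\<dots> = ennreal (1 / \<delta>) * ennreal (\<rho> u)"
      using W(3) W(2)[OF True] by (intro ennreal_mult) auto
    finally have "1 * shift_energy g u \<le> (ennreal (1 / \<delta>) * ennreal (\<rho> u)) * shift_energy g u"
      by (rule mult_right_mono) simp
    then show ?thesis using True by (simp add: mult.assoc)
  qed simp
  then have "(\<integral>\<^sup>+u. indicator W u * shift_energy g u \<partial>m)
      \<le> (\<integral>\<^sup>+u. ennreal (1 / \<delta>) * (ennreal (\<rho> u) * shift_energy g u) \<partial>m)"
    by (intro nn_integral_mono)
  also have "\<dots> = ennreal (1 / \<delta>) * (\<integral>\<^sup>+u. ennreal (\<rho> u) * shift_energy g u \<partial>m)"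
    by (intro nn_integral_cmult) measurable
  also have "(\<integral>\<^sup>+u. ennreal (\<rho> u) * shift_energy g u \<partial>m) = energy g"
    unfolding energy_def by (subst \<rho>(1), rule nn_integral_density[symmetric]) measurable
  finally show ?thesis .
qed

text \<open>A single shift is recovered from averages by writing \<open>t = u + (- u + t)\<close>
  and averaging over \<open>u\<close> near \<open>s0\<close>. For \<open>t\<close> near
  \<open>0\<close>, both \<open>u\<close> and \<open>- t + u\<close> stay where the density is
  large; for \<open>t\<close> near \<open>s0\<close>, the second summand is near \<open>0\<close>,
  which is the case just settled.\<close>

lemma energy_controlled_near_density:
  assumes \<rho>: "\<mu> = density m (\<lambda>x. ennreal (\<rho> x))" "continuous_on UNIV \<rho>" and s0: "\<rho> s0 > 0"
  shows "0 \<in> energy_controlled" "s0 \<in> energy_controlled"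
proof -
  define \<delta> where "\<delta> = \<rho> s0 / 2"
  have "\<delta> > 0" using s0 unfolding \<delta>_def by simp
  define W0 where "W0 = {u. \<rho> u > \<delta>}"
  have W0: "open W0" "s0 \<in> W0"
    unfolding W0_def using \<rho>(2) s0 open_Collect_less[OF continuous_on_const \<rho>(2), of \<delta>]
    by (auto simp: \<delta>_def)
  obtain n where n: "s0 \<in> interior (B n)" using UN_interior_B by blast
  have open_pre: "open (h -` U)" if "open U" "continuous_on UNIV h" for U and h :: "'a \<times> 'a \<Rightarrow> 'a"
    using continuous_on_open_vimage[of UNIV h] that by auto
  have meas_W: "\<exists>w>0. emeasure m W = ennreal w" if W: "open W" "s0 \<in> W" "W \<subseteq> interior (B n)" for W
  proof -
    have "emeasure m W \<le> emeasure m (B n)"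
      using W interior_subset by (intro emeasure_mono) auto
    then have "emeasure m W < \<infinity>" using finite_B le_less_trans by blast
    moreover have "emeasure m W > 0" using open_pos W by blast
    ultimately show ?thesis by (intro exI[of _ "enn2real (emeasure m W)"]) (auto simp: enn2real_positive_iff)
  qed
  \<comment> \<open>Openness around \<open>(0, s0)\<close> fixes at once how small \<open>t\<close>
    must be and how close to \<open>s0\<close> the averaging variable \<open>u\<close> must
    stay.\<close>
  let ?V = "(\<lambda>z. - fst z + snd z) -` W0 \<inter> snd -` (W0 \<inter> interior (B n))"
  have "open ?V" using W0 by (intro open_Int open_pre open_interior) (auto intro!: continuous_intros)
  moreover have "(0, s0) \<in> ?V" using W0 n by simp
  ultimately obtain T W1 where TW: "open T" "open W1" "0 \<in> T" "s0 \<in> W1" "T \<times> W1 \<subseteq> ?V"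
    by (rule open_prod_elim) auto
  have W1: "W1 \<subseteq> W0" "W1 \<subseteq> interior (B n)" using TW by auto
  obtain w where w: "w > 0" "emeasure m W1 = ennreal w" using meas_W[OF TW(2,4) W1(2)] by blast
  have T: "shift_energy g t \<le> ennreal (4 / (\<delta> * w)) * energy g" if "t \<in> T" and g: "continuous_on UNIV g" for t g
  proof -
    note [measurable] = shift_energy_measurable[OF g]
    let ?N = "shift_energy g"
    have [measurable]: "W0 \<in> sets borel" using W0(1) by simp
    have m1 [measurable]: "(\<lambda>u. indicator W0 u * ?N u) \<in> borel_measurable borel" by measurable
    have m2 [measurable]: "(\<lambda>u. indicator W0 (- t + u) * ?N (- t + u)) \<in> borel_measurable borel"
      by (rule measurable_translation(1)[OF m1])
    have "ennreal w * ?N t = (\<integral>\<^sup>+u. ?N t * indicator W1 u \<partial>m)"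
      using TW(2) w(2) by (subst nn_integral_cmult_indicator) (auto simp: mult.commute)
    also have "\<dots> \<le> (\<integral>\<^sup>+u. 2 * (indicator W0 u * ?N u) + 2 * (indicator W0 (- t + u) * ?N (- t + u)) \<partial>m)"
    proof (rule nn_integral_mono)
      fix u
      show "?N t * indicator W1 u \<le> 2 * (indicator W0 u * ?N u) + 2 * (indicator W0 (- t + u) * ?N (- t + u))"
      proof (cases "u \<in> W1")
        case True
        then have "(t, u) \<in> ?V" using TW(5) \<open>t \<in> T\<close> by blast
        then have "u \<in> W0" "- t + u \<in> W0" by auto
        have "?N t = ?N (u + (- u + t))" by (simp add: add.assoc[symmetric])
        also have "\<dots> \<le> 2 * ?N u + 2 * ?N (- u + t)" by (rule shift_energy_add2[OF g])
        \<comment> \<open>Shift energy is even, and \<open>- t + u\<close> is a left translate of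
          \<open>u\<close>, so both terms have the same integral over \<open>u\<close>.\<close>
        also have "?N (- u + t) = ?N (- t + u)"
          using shift_energy_uminus[OF g, of "- u + t"] by (simp add: minus_add)
        finally show ?thesis using True \<open>u \<in> W0\<close> \<open>- t + u \<in> W0\<close> by simp
      qed simp
    qed
    also have "\<dots> = 2 * (\<integral>\<^sup>+u. indicator W0 u * ?N u \<partial>m) + 2 * (\<integral>\<^sup>+u. indicator W0 (- t + u) * ?N (- t + u) \<partial>m)"
      by (subst nn_integral_add) (auto simp: nn_integral_cmult)
    also have "(\<integral>\<^sup>+u. indicator W0 (- t + u) * ?N (- t + u) \<partial>m) = (\<integral>\<^sup>+u. indicator W0 u * ?N u \<partial>m)"
      by (rule nn_integral_left[OF m1])
    also have "2 * (\<integral>\<^sup>+u. indicator W0 u * ?N u \<partial>m) + 2 * (\<integral>\<^sup>+u. indicator W0 u * ?N u \<partial>m)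
        = 4 * (\<integral>\<^sup>+u. indicator W0 u * ?N u \<partial>m)" by (simp flip: distrib_right)
    also have "\<dots> \<le> 4 * (ennreal (1 / \<delta>) * energy g)"
      using shift_energy_local_average[OF \<rho> _ _ \<open>\<delta> > 0\<close> g, of W0] W0(1)
      by (intro mult_left_mono) (auto simp: W0_def)
    finally have "ennreal (1 / w) * (ennreal w * ?N t) \<le> ennreal (1 / w) * (4 * (ennreal (1 / \<delta>) * energy g))"
      by (rule mult_left_mono) simp
    also have "ennreal (1 / w) * (4 * (ennreal (1 / \<delta>) * energy g)) = ennreal (4 / (\<delta> * w)) * energy g"
      using w(1) \<open>\<delta> > 0\<close> by (simp add: mult.assoc[symmetric] ennreal_mult[symmetric] ennreal_numeral[symmetric] del: ennreal_numeral) (simp add: mult.commute)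
    also have "ennreal (1 / w) * (ennreal w * ?N t) = ?N t"
      using w(1) by (simp add: mult.assoc[symmetric] ennreal_mult[symmetric])
    finally show ?thesis .
  qed
  show "0 \<in> energy_controlled" using TW(1,3) T by (rule energy_controlledI)
  define C where "C = 4 / (\<delta> * w)"
  have "C > 0" unfolding C_def using \<open>\<delta> > 0\<close> w(1) by simp
  \<comment> \<open>Now the pair is \<open>(u, t)\<close>, both near \<open>s0\<close>, so that
    \<open>- u + t\<close> falls into the neighbourhood \<open>T\<close> of
    \<open>0\<close>.\<close>
  let ?V' = "(\<lambda>z. - fst z + snd z) -` T \<inter> fst -` (W0 \<inter> interior (B n))"
  have "open ?V'" using TW W0 by (intro open_Int open_pre open_interior) (auto intro!: continuous_intros)
  moreover have "(s0, s0) \<in> ?V'" using TW W0 n by simp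
  ultimately obtain W3 W4 where W34: "open W3" "open W4" "s0 \<in> W3" "s0 \<in> W4" "W3 \<times> W4 \<subseteq> ?V'"
    by (rule open_prod_elim) auto
  have W3: "W3 \<subseteq> W0" "W3 \<subseteq> interior (B n)" using W34 by auto
  obtain v where v: "v > 0" "emeasure m W3 = ennreal v" using meas_W[OF W34(1,3) W3(2)] by blast
  have "shift_energy g t \<le> ennreal (2 / (\<delta> * v) + 2 * C) * energy g" if "t \<in> W4" and g: "continuous_on UNIV g" for t g
  proof -
    note [measurable] = shift_energy_measurable[OF g] W34(1)
    let ?N = "shift_energy g"
    have [measurable]: "W3 \<in> sets borel" using W34(1) by simp
    have "ennreal v * ?N t = (\<integral>\<^sup>+u. ?N t * indicator W3 u \<partial>m)"
      using v(2) by (subst nn_integral_cmult_indicator) (auto simp: mult.commute)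
    also have "\<dots> \<le> (\<integral>\<^sup>+u. 2 * (indicator W3 u * ?N u) + (2 * (ennreal C * energy g)) * indicator W3 u \<partial>m)"
    proof (rule nn_integral_mono)
      fix u
      show "?N t * indicator W3 u \<le> 2 * (indicator W3 u * ?N u) + (2 * (ennreal C * energy g)) * indicator W3 u"
      proof (cases "u \<in> W3")
        case True
        then have "(u, t) \<in> ?V'" using W34(5) \<open>t \<in> W4\<close> by blast
        then have *: "- u + t \<in> T" by auto
        have "?N t = ?N (u + (- u + t))" by (simp add: add.assoc[symmetric])
        also have "\<dots> \<le> 2 * ?N u + 2 * ?N (- u + t)" by (rule shift_energy_add2[OF g])
        also have "\<dots> \<le> 2 * ?N u + 2 * (ennreal C * energy g)"
          using T[OF * g] unfolding C_def by (intro add_left_mono mult_left_mono) auto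
        finally show ?thesis using True by simp
      qed simp
    qed
    also have "\<dots> = 2 * (\<integral>\<^sup>+u. indicator W3 u * ?N u \<partial>m) + (2 * (ennreal C * energy g)) * ennreal v"
      using v(2) by (subst nn_integral_add) (auto simp: nn_integral_cmult nn_integral_cmult_indicator)
    also have "\<dots> \<le> 2 * (ennreal (1 / \<delta>) * energy g) + (2 * (ennreal C * energy g)) * ennreal v"
    proof -
      have "\<delta> \<le> \<rho> u" if "u \<in> W3" for u using that W3(1) unfolding W0_def by force
      then show ?thesis
        using shift_energy_local_average[OF \<rho> _ _ \<open>\<delta> > 0\<close> g, of W3]
        by (intro add_right_mono mult_left_mono) auto
    qed
    also have "\<dots> = (ennreal 2 * ennreal (1 / \<delta>) + ennreal 2 * ennreal C * ennreal v) * energy g"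
      by (simp add: algebra_simps)
    also have "ennreal 2 * ennreal (1 / \<delta>) + ennreal 2 * ennreal C * ennreal v = ennreal (2 / \<delta> + 2 * C * v)"
      using \<open>C > 0\<close> v(1) \<open>\<delta> > 0\<close> by (simp add: ennreal_mult[symmetric] ennreal_plus[symmetric] del: ennreal_plus ennreal_numeral)
    finally have "ennreal (1 / v) * (ennreal v * ?N t) \<le> ennreal (1 / v) * (ennreal (2 / \<delta> + 2 * C * v) * energy g)"
      by (rule mult_left_mono) simp
    also have "ennreal (1 / v) * (ennreal (2 / \<delta> + 2 * C * v) * energy g) = ennreal (2 / (\<delta> * v) + 2 * C) * energy g"
    proof -
      have "ennreal (1 / v) * ennreal (2 / \<delta> + 2 * C * v) = ennreal (1 / v * (2 / \<delta> + 2 * C * v))"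
        using v(1) \<open>\<delta> > 0\<close> \<open>C > 0\<close> by (intro ennreal_mult[symmetric]) auto
      also have "1 / v * (2 / \<delta> + 2 * C * v) = 2 / (\<delta> * v) + 2 * C"
        using v(1) \<open>\<delta> > 0\<close> by (simp add: field_simps)
      finally show ?thesis by (simp only: mult.assoc[symmetric])
    qed
    also have "ennreal (1 / v) * (ennreal v * ?N t) = ?N t"
      using v(1) by (simp add: mult.assoc[symmetric] ennreal_mult[symmetric])
    finally show ?thesis .
  qed
  then show "s0 \<in> energy_controlled" using W34(2,4) energy_controlledI by blast
qed

text \<open>The controlled elements form an open subgroup, hence a closed set. The density vanishes
  on the complement, which is therefore a null open set and misses the support; but the support
  generates the group.\<close>

lemma energy_controlled_UNIV: "energy_controlled = UNIV"
proof -
  obtain \<rho> where \<rho>: "continuous_on UNIV \<rho>" "\<And>x. 0 \<le> \<rho> x" "\<mu> = density m (\<lambda>x. ennreal (\<rho> x))"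
    using density_mu by metis
  note near = energy_controlled_near_density[OF \<rho>(3,1)]
  have [measurable]: "\<rho> \<in> borel_measurable borel" using \<rho>(1) by (rule borel_measurable_continuous_onI)
  have null: "emeasure \<mu> A = 0" if "A \<in> sets borel" "\<And>x. x \<in> A \<Longrightarrow> \<rho> x = 0" for A
  proof -
    have "emeasure \<mu> A = (\<integral>\<^sup>+x. ennreal (\<rho> x) * indicator A x \<partial>m)"
      unfolding \<rho>(3) using that(1) by (intro emeasure_density) auto
    also have "\<dots> = (\<integral>\<^sup>+x. 0 \<partial>m)"
      using that(2) by (intro nn_integral_cong) (auto simp: indicator_def)
    finally show ?thesis by simp
  qed
  obtain s0 where "\<rho> s0 \<noteq> 0" using null[of UNIV] mu.emeasure_space_1 by auto
  then have "\<rho> s0 > 0" using \<rho>(2)[of s0] by simp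
  note zero = near(1)[OF this]
  have add: "s + t \<in> energy_controlled" if s: "s \<in> energy_controlled" and t: "t \<in> energy_controlled" for s t
  proof -
    obtain C1 where C1: "C1 \<ge> 0" "\<And>g. continuous_on UNIV g \<Longrightarrow> shift_energy g s \<le> ennreal C1 * energy g"
      using energy_controlledD[OF s] by blast
    obtain W C2 where W: "open W" "t \<in> W" "C2 \<ge> 0"
      "\<And>t g. t \<in> W \<Longrightarrow> continuous_on UNIV g \<Longrightarrow> shift_energy g t \<le> ennreal C2 * energy g"
      using energy_controlledD[OF t] by blast
    show ?thesis
    proof (rule energy_controlledI[of "{y. - s + y \<in> W}" _ "2 * C1 + 2 * C2"])
      show "open {y. - s + y \<in> W}" using W(1) by (rule open_translation_vimage)
      show "s + t \<in> {y. - s + y \<in> W}" using W(2) by (simp add: add.assoc[symmetric])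
      fix y and g :: "'a \<Rightarrow> complex" assume y: "y \<in> {y. - s + y \<in> W}" and g: "continuous_on UNIV g"
      have "shift_energy g y = shift_energy g (s + (- s + y))" by (simp add: add.assoc[symmetric])
      also have "\<dots> \<le> 2 * shift_energy g s + 2 * shift_energy g (- s + y)" by (rule shift_energy_add2[OF g])
      also have "\<dots> \<le> 2 * (ennreal C1 * energy g) + 2 * (ennreal C2 * energy g)"
        using C1 W(4) g y by (intro add_mono mult_left_mono) auto
      also have "\<dots> = ennreal (2 * C1 + 2 * C2) * energy g"
        using C1(1) W(3) by (simp add: algebra_simps ennreal_mult)
      finally show "shift_energy g y \<le> ennreal (2 * C1 + 2 * C2) * energy g" .
    qed
  qed
  have neg: "- s \<in> energy_controlled" if s: "s \<in> energy_controlled" for s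
  proof -
    obtain W C where W: "open W" "s \<in> W" "C \<ge> 0"
      "\<And>t g. t \<in> W \<Longrightarrow> continuous_on UNIV g \<Longrightarrow> shift_energy g t \<le> ennreal C * energy g"
      using energy_controlledD[OF s] by blast
    have "open {y. - y \<in> W}"
      using continuous_on_open_vimage[of UNIV "uminus :: 'a \<Rightarrow> 'a"] W(1) by (auto simp: vimage_def intro!: continuous_intros)
    then show ?thesis
    proof (rule energy_controlledI[of _ _ C])
      show "- s \<in> {y. - y \<in> W}" using W(2) by simp
      fix t and g :: "'a \<Rightarrow> complex" assume t: "t \<in> {y. - y \<in> W}" and g: "continuous_on UNIV g"
      then have "- t \<in> W" by simp
      from W(4)[OF this g] show "shift_energy g t \<le> ennreal C * energy g"
        by (simp only: shift_energy_uminus[OF g])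
    qed
  qed
  have op: "open energy_controlled"
  proof (subst open_subopen, intro ballI)
    fix s assume "s \<in> energy_controlled"
    from energy_controlledD[OF this] show "\<exists>T. open T \<and> s \<in> T \<and> T \<subseteq> energy_controlled" by blast
  qed
  \<comment> \<open>An open subgroup is closed: if \<open>x\<close> is outside and
    \<open>- y + x\<close> is inside, then \<open>y\<close> is outside.\<close>
  have "open (- energy_controlled)"
  proof (subst open_subopen, intro ballI)
    fix x assume x: "x \<in> - energy_controlled"
    have "open {y. - y + x \<in> energy_controlled}"
      using continuous_on_open_vimage[of UNIV "\<lambda>y::'a. - y + x"] op by (auto simp: vimage_def intro!: continuous_intros)
    moreover have "x \<in> {y. - y + x \<in> energy_controlled}" using zero by simp
    moreover have "{y. - y + x \<in> energy_controlled} \<subseteq> - energy_controlled"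
    proof clarify
      fix y assume "- y + x \<in> energy_controlled" "y \<in> energy_controlled"
      then have "y + (- y + x) \<in> energy_controlled" using add[of y "- y + x"] by blast
      then show False using x by (simp add: add.assoc[symmetric])
    qed
    ultimately show "\<exists>T. open T \<and> x \<in> T \<and> T \<subseteq> - energy_controlled" by blast
  qed
  moreover have "emeasure \<mu> (- energy_controlled) = 0"
  proof (rule null)
    fix x assume x: "x \<in> - energy_controlled"
    then show "\<rho> x = 0" using near(2)[of x] \<rho>(2)[of x] by force
  qed (use op in auto)
  ultimately have "measure_support \<mu> \<subseteq> energy_controlled"
    unfolding measure_support_def by fastforce
  moreover have "additive_subgroup energy_controlled"
    unfolding additive_subgroup_def using zero add neg by blast
  ultimately have "additive_subgroup hull measure_support \<mu> \<subseteq> energy_controlled" by (rule hull_minimal)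
  then show ?thesis using courteous unfolding courteous_def by auto
qed

text \<open>A finite subcover of \<open>S\<close> gives one constant for all generators, and
  induction along words extends it. The quadratic rate is what balances the factor
  \<open>1 / R ^ 2\<close> of the Caccioppoli inequality.\<close>

lemma shift_energy_bound:
  obtains C where "C \<ge> 0"
    "\<And>g s. continuous_on UNIV g \<Longrightarrow> shift_energy g s \<le> ennreal (C * (real (len s))\<^sup>2) * energy g"
proof -
  have "\<exists>W C. open W \<and> s \<in> W \<and> C \<ge> 0 \<and> (\<forall>t\<in>W. \<forall>g. continuous_on UNIV g \<longrightarrow> shift_energy g t \<le> ennreal C * energy g)" for s
    using energy_controlledD[of s] energy_controlled_UNIV by blast
  then obtain W C where WC: "\<And>s. open (W s)" "\<And>s. s \<in> W s" "\<And>s. C s \<ge> 0"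
    "\<And>s t g. t \<in> W s \<Longrightarrow> continuous_on UNIV g \<Longrightarrow> shift_energy g t \<le> ennreal (C s) * energy g" by metis
  obtain F where F: "F \<subseteq> S" "finite F" "S \<subseteq> (\<Union>s\<in>F. W s)"
    by (rule compactE_image[OF compact_S, of S W]) (use WC in auto)
  define K where "K = (\<Sum>s\<in>F. C s)"
  have K0: "K \<ge> 0" unfolding K_def using WC by (intro sum_nonneg) auto
  have KS: "shift_energy g t \<le> ennreal K * energy g" if t: "t \<in> S" and g: "continuous_on UNIV g" for t g
  proof -
    obtain s where s: "s \<in> F" "t \<in> W s" using subsetD[OF F(3) t] by blast
    have "C s \<le> K" unfolding K_def using s F WC(3) by (intro member_le_sum) auto
    have "shift_energy g t \<le> ennreal (C s) * energy g" using WC(4) s g by blast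
    also have "\<dots> \<le> ennreal K * energy g" using \<open>C s \<le> K\<close> by (intro mult_right_mono ennreal_leI) auto
    finally show ?thesis .
  qed
  have *: "shift_energy g t \<le> ennreal (K * (real n)\<^sup>2) * energy g" if g: "continuous_on UNIV g" and "t \<in> B n" for t g n
    using that(2)
  proof (induction n arbitrary: t)
    case (Suc n)
    then obtain a b where ab: "t = a + b" "a \<in> S" "b \<in> B n" by (auto simp: set_pow_Suc)
    show ?case
    proof (cases "n = 0")
      case True
      then show ?thesis using ab KS[OF ab(2) g] by simp
    next
      case False
      \<comment> \<open>With the weight \<open>a = n\<close> the two terms add up to exactly
        \<open>K\<close> times the square of \<open>n + 1\<close>; the weight must be positive,
        hence the separate case \<open>n = 0\<close>.\<close>
      have "shift_energy g t \<le> ennreal (1 + real n) * shift_energy g a + ennreal (1 + 1 / real n) * shift_energy g b"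
        unfolding ab(1) using False by (intro shift_energy_add g) auto
      also have "\<dots> \<le> ennreal (1 + real n) * (ennreal K * energy g) + ennreal (1 + 1 / real n) * (ennreal (K * (real n)\<^sup>2) * energy g)"
        using KS[OF ab(2) g] Suc.IH[OF ab(3)] by (intro add_mono mult_left_mono) auto
      also have "\<dots> = (ennreal ((1 + real n) * K) + ennreal ((1 + 1 / real n) * (K * (real n)\<^sup>2))) * energy g"
      proof -
        have "ennreal ((1 + real n) * K) = ennreal (1 + real n) * ennreal K"
          "ennreal ((1 + 1 / real n) * (K * (real n)\<^sup>2)) = ennreal (1 + 1 / real n) * ennreal (K * (real n)\<^sup>2)"
          using K0 by (intro ennreal_mult; simp)+
        then show ?thesis by (simp only: mult.assoc distrib_right)
      qed
      also have "ennreal ((1 + real n) * K) + ennreal ((1 + 1 / real n) * (K * (real n)\<^sup>2))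
          = ennreal ((1 + real n) * K + (1 + 1 / real n) * (K * (real n)\<^sup>2))"
        using K0 by (intro ennreal_plus[symmetric]) auto
      also have "(1 + real n) * K + (1 + 1 / real n) * (K * (real n)\<^sup>2) = K * (real (Suc n))\<^sup>2"
        using False by (simp add: power2_eq_square field_simps)
      finally show ?thesis .
    qed
  qed simp
  show ?thesis using K0 * by (intro that[of K]) (auto simp: in_B_iff)
qed

end

text \<open>To be used with \<open>a = f x\<close> and \<open>b = f (x + s)\<close>. The first two
  terms form the energy pairing of \<open>f\<close> with the squared cutoff times \<open>f\<close>,
  which harmonicity kills; the last one contains increments of the cutoff but none of
  \<open>f\<close>.\<close>

lemma Caccioppoli_identity:
  fixes a b :: complex and \<alpha> \<beta> :: real
  shows "(cmod (\<alpha> * a - \<beta> * b))\<^sup>2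
    = Re ((a - b) * (\<alpha>\<^sup>2 * cnj a)) - Re ((a - b) * (\<beta>\<^sup>2 * cnj b)) + Re (a * cnj b) * (\<alpha> - \<beta>)\<^sup>2"
  unfolding cmod_power2 by (simp add: power2_eq_square algebra_simps)

lemma Re_mult_cnj_le: "\<bar>Re (a * cnj b)\<bar> \<le> ((cmod a)\<^sup>2 + (cmod b)\<^sup>2) / 2"
proof -
  have "\<bar>Re (a * cnj b)\<bar> \<le> cmod a * cmod b" using abs_Re_le_cmod[of "a * cnj b"] by (simp add: norm_mult)
  also have "\<dots> \<le> ((cmod a)\<^sup>2 + (cmod b)\<^sup>2) / 2"
    using sum_squares_bound[of "cmod a" "cmod b"] by simp
  finally show ?thesis .
qed

lemma (in pair_sigma_finite) integrable_product_bound: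
  fixes f :: "_ \<Rightarrow> _ \<Rightarrow> 'c::{banach,second_countable_topology}"
  assumes f: "case_prod f \<in> borel_measurable (M1 \<Otimes>\<^sub>M M2)"
    and u: "integrable M1 u" and v: "integrable M2 v"
    and le: "\<And>x y. norm (f x y) \<le> u x * v y"
  shows "integrable (M1 \<Otimes>\<^sub>M M2) (case_prod f)"
proof (rule integrableI_bounded[OF f])
  have [measurable]: "u \<in> borel_measurable M1" "v \<in> borel_measurable M2" using u v by auto
  have "(\<integral>\<^sup>+z. ennreal (norm (case_prod f z)) \<partial>(M1 \<Otimes>\<^sub>M M2))
      \<le> (\<integral>\<^sup>+z. ennreal (norm (u (fst z))) * ennreal (norm (v (snd z))) \<partial>(M1 \<Otimes>\<^sub>M M2))"
  proof (rule nn_integral_mono)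
    fix z
    have "norm (f (fst z) (snd z)) \<le> norm (u (fst z)) * norm (v (snd z))"
      using le[of "fst z" "snd z"] by (metis abs_ge_self abs_mult order_trans real_norm_def)
    then show "ennreal (norm (case_prod f z)) \<le> ennreal (norm (u (fst z))) * ennreal (norm (v (snd z)))"
      by (simp add: case_prod_unfold ennreal_mult[symmetric] ennreal_leI)
  qed
  also have "\<dots> = (\<integral>\<^sup>+x. \<integral>\<^sup>+y. ennreal (norm (u x)) * ennreal (norm (v y)) \<partial>M2 \<partial>M1)"
    by (subst M2.nn_integral_fst[symmetric]) auto
  also have "\<dots> = (\<integral>\<^sup>+x. ennreal (norm (u x)) \<partial>M1) * (\<integral>\<^sup>+y. ennreal (norm (v y)) \<partial>M2)"
    by (simp add: nn_integral_cmult nn_integral_multc)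
  also have "\<dots> < \<infinity>"
    using u v unfolding integrable_iff_bounded by (simp add: ennreal_mult_less_top)
  finally show "(\<integral>\<^sup>+z. ennreal (norm (case_prod f z)) \<partial>(M1 \<Otimes>\<^sub>M M2)) < \<infinity>" .
qed

section \<open>Ball averages, cutoffs and squared L2 norms on balls\<close>

context haar_growth
begin

abbreviation vol :: "nat \<Rightarrow> real" where "vol n \<equiv> measure m (B n)"

lemma emeasure_B: "emeasure m (B n) = ennreal (vol n)"
  using finite_B by (intro emeasure_eq_ennreal_measure) (auto simp: less_top[symmetric])

lemma vol_mono: "n \<le> k \<Longrightarrow> vol n \<le> vol k"
  using B_mono[of n k] finite_B[of k] by (intro measure_mono_fmeasurable) (auto simp: fmeasurable_def)

lemma integrable_compact_support:
  fixes h :: "'a \<Rightarrow> 'c::{banach,second_countable_topology}"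
  assumes "continuous_on UNIV h" "\<And>x. x \<notin> B n \<Longrightarrow> h x = 0"
  shows "integrable m h"
proof -
  have "indicator (B n) x *\<^sub>R h x = h x" for x using assms(2)[of x] by (cases "x \<in> B n") auto
  then show ?thesis using integrable_on_B[OF assms(1), of n] by simp
qed

definition ball_average :: "nat \<Rightarrow> ('a \<Rightarrow> complex) \<Rightarrow> 'a \<Rightarrow> complex" where
  "ball_average r g x = (1 / vol r) *\<^sub>R (\<integral>s. indicator (B r) s *\<^sub>R g (x + s) \<partial>m)"

lemma ball_average_continuous:
  assumes "continuous_on UNIV g"
  shows "continuous_on UNIV (ball_average r g)"
proof -
  have "integrable m (\<lambda>s. indicator (B r) s :: complex)"
    using integrable_on_B[of "\<lambda>_. 1 :: complex" r] by (simp add: scaleR_conv_of_real of_real_indicator)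
  moreover have "continuous_on UNIV (\<lambda>(s, x). g (x + s))"
    unfolding case_prod_unfold by (intro continuous_on_compose2[OF assms] continuous_intros) auto
  ultimately have "continuous_on UNIV (\<lambda>x. \<integral>s. indicator (B r) s * g (x + s) \<partial>m)"
    by (intro continuous_on_integral_param[OF _ compact_B[of r] sets_m]) auto
  then show ?thesis
    unfolding ball_average_def
    by (intro continuous_on_scaleR continuous_on_const) (simp add: scaleR_conv_of_real of_real_indicator)
qed

lemma ball_average_deviation:
  assumes g: "continuous_on UNIV g" and r: "r \<ge> 1"
  shows "ennreal ((cmod (g x - ball_average r g x))\<^sup>2)
    \<le> ennreal (1 / vol r) * (\<integral>\<^sup>+s. indicator (B r) s * ennreal ((cmod (g x - g (x + s)))\<^sup>2) \<partial>m)"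
proof -
  let ?I = "\<lambda>s. indicator (B r) s :: real" and ?d = "\<lambda>s. g x - g (x + s)"
  note gs = continuous_translation(1)[OF g, of x]
  have d: "continuous_on UNIV ?d" using gs by (intro continuous_intros)
  have [measurable]: "?d \<in> borel_measurable borel" using d by (rule borel_measurable_continuous_onI)
  have V: "vol r > 0" using B_measure_ge_1[OF r] by simp
  have i1: "integrable m (\<lambda>s. ?I s *\<^sub>R g (x + s))" using integrable_on_B[OF gs] .
  have i2: "integrable m (\<lambda>s. ?I s *\<^sub>R g x)" using integrable_on_B[of "\<lambda>_. g x"] by simp
  have J: "(\<integral>s. ?I s *\<^sub>R g x \<partial>m) = vol r *\<^sub>R g x" using finite_B[of r] by simp
  have "g x - ball_average r g x = (1 / vol r) *\<^sub>R ((\<integral>s. ?I s *\<^sub>R g x \<partial>m) - (\<integral>s. ?I s *\<^sub>R g (x + s) \<partial>m))"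
    unfolding ball_average_def J using V by (simp add: scaleR_diff_right)
  also have "\<dots> = (1 / vol r) *\<^sub>R (\<integral>s. ?I s *\<^sub>R ?d s \<partial>m)"
    using i1 i2 by (simp add: scaleR_diff_right)
  finally have "cmod (g x - ball_average r g x) = (1 / vol r) * cmod (\<integral>s. ?I s *\<^sub>R ?d s \<partial>m)"
    using V by simp
  then have "ennreal (cmod (g x - ball_average r g x)) = ennreal (1 / vol r) * ennreal (cmod (\<integral>s. ?I s *\<^sub>R ?d s \<partial>m))"
    using V by (simp add: ennreal_mult[symmetric])
  \<comment> \<open>The indicator is written twice so that Cauchy-Schwarz leaves
    \<open>vol r\<close> as its second factor, which cancels one \<open>1 / vol r\<close>.\<close>
  also have "\<dots> \<le> ennreal (1 / vol r) * (\<integral>\<^sup>+s. ennreal (cmod (?d s) * ?I s) * ennreal (?I s) \<partial>m)"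
  proof -
    have "ennreal (cmod (\<integral>s. ?I s *\<^sub>R ?d s \<partial>m)) \<le> (\<integral>\<^sup>+s. ennreal (norm (?I s *\<^sub>R ?d s)) \<partial>m)"
      by (rule integral_norm_bound_ennreal[OF integrable_on_B[OF d]])
    also have "\<dots> = (\<integral>\<^sup>+s. ennreal (cmod (?d s) * ?I s) * ennreal (?I s) \<partial>m)"
      by (intro nn_integral_cong) (auto simp: indicator_def)
    finally show ?thesis by (rule mult_left_mono) simp
  qed
  finally have "(ennreal (cmod (g x - ball_average r g x)))\<^sup>2
      \<le> (ennreal (1 / vol r) * (\<integral>\<^sup>+s. ennreal (cmod (?d s) * ?I s) * ennreal (?I s) \<partial>m))\<^sup>2"
    by (rule power_mono) simp
  also have "\<dots> = (ennreal (1 / vol r))\<^sup>2 * (\<integral>\<^sup>+s. ennreal (cmod (?d s) * ?I s) * ennreal (?I s) \<partial>m)\<^sup>2"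
    by (rule power_mult_distrib)
  also have "\<dots> \<le> (ennreal (1 / vol r))\<^sup>2 *
      ((\<integral>\<^sup>+s. (ennreal (cmod (?d s) * ?I s))\<^sup>2 \<partial>m) * (\<integral>\<^sup>+s. (ennreal (?I s))\<^sup>2 \<partial>m))"
    by (intro mult_left_mono Cauchy_Schwarz_nn_integral) auto
  also have "(\<integral>\<^sup>+s. (ennreal (?I s))\<^sup>2 \<partial>m) = (\<integral>\<^sup>+s. indicator (B r) s \<partial>m)"
    by (intro nn_integral_cong) (auto simp: indicator_def)
  also have "\<dots> = ennreal (vol r)" by (simp add: emeasure_B)
  also have "(\<integral>\<^sup>+s. (ennreal (cmod (?d s) * ?I s))\<^sup>2 \<partial>m) = (\<integral>\<^sup>+s. indicator (B r) s * ennreal ((cmod (?d s))\<^sup>2) \<partial>m)"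
    by (intro nn_integral_cong) (auto simp: indicator_def ennreal_power)
  also have "(ennreal (1 / vol r))\<^sup>2 * ((\<integral>\<^sup>+s. indicator (B r) s * ennreal ((cmod (?d s))\<^sup>2) \<partial>m) * ennreal (vol r))
      = (ennreal (1 / vol r) * ennreal (vol r)) * (ennreal (1 / vol r) * (\<integral>\<^sup>+s. indicator (B r) s * ennreal ((cmod (?d s))\<^sup>2) \<partial>m))"
    by (simp add: power2_eq_square algebra_simps)
  also have "ennreal (1 / vol r) * ennreal (vol r) = 1" using V by (simp add: ennreal_mult[symmetric])
  finally show ?thesis by (simp add: ennreal_power)
qed

text \<open>The pseudo-Poincare inequality: integrating the pointwise estimate and swapping leaves
  an average of \<open>shift_energy g s\<close> over the ball.\<close>

lemma ball_average_deviation_integral: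
  assumes g: "continuous_on UNIV g" and r: "r \<ge> 1" and bd: "\<And>s. s \<in> B r \<Longrightarrow> shift_energy g s \<le> K"
  shows "(\<integral>\<^sup>+x. ennreal ((cmod (g x - ball_average r g x))\<^sup>2) \<partial>m) \<le> K"
proof -
  interpret m: sigma_finite_measure m by (rule sigma_finite_m)
  interpret mm: pair_sigma_finite m m ..
  have V: "vol r > 0" using B_measure_ge_1[OF r] by simp
  let ?h = "\<lambda>x s. ennreal ((cmod (g x - g (x + s)))\<^sup>2)"
  have smm: "sets (m \<Otimes>\<^sub>M m) = sets (borel \<Otimes>\<^sub>M borel)" by (intro sets_pair_measure_cong) auto
  have h [measurable]: "(\<lambda>(x, s). ?h x s) \<in> borel_measurable (m \<Otimes>\<^sub>M m)"
    using shift_pair_measurable[OF g] by (simp add: measurable_cong_sets[OF smm refl])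
  have I [measurable]: "(\<lambda>(x, s). indicator (B r) s * ?h x s) \<in> borel_measurable (m \<Otimes>\<^sub>M m)"
  proof -
    have "(\<lambda>z. indicator (B r) (snd z) :: ennreal) \<in> borel_measurable (m \<Otimes>\<^sub>M m)" by measurable
    from borel_measurable_times_ennreal[OF this h] show ?thesis by (simp add: case_prod_unfold)
  qed
  note hx [measurable] = shift_measurable[OF g]
  have "(\<integral>\<^sup>+x. ennreal ((cmod (g x - ball_average r g x))\<^sup>2) \<partial>m)
      \<le> (\<integral>\<^sup>+x. ennreal (1 / vol r) * (\<integral>\<^sup>+s. indicator (B r) s * ?h x s \<partial>m) \<partial>m)"
    by (intro nn_integral_mono ball_average_deviation[OF g r])
  also have "\<dots> = ennreal (1 / vol r) * (\<integral>\<^sup>+x. \<integral>\<^sup>+s. indicator (B r) s * ?h x s \<partial>m \<partial>m)"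
    by (intro nn_integral_cmult m.borel_measurable_nn_integral I)
  also have "(\<integral>\<^sup>+x. \<integral>\<^sup>+s. indicator (B r) s * ?h x s \<partial>m \<partial>m) = (\<integral>\<^sup>+s. \<integral>\<^sup>+x. indicator (B r) s * ?h x s \<partial>m \<partial>m)"
    by (rule mm.Fubini'[OF I, symmetric])
  also have "\<dots> = (\<integral>\<^sup>+s. indicator (B r) s * shift_energy g s \<partial>m)"
    unfolding shift_energy_def by (intro nn_integral_cong nn_integral_cmult) measurable
  also have "\<dots> \<le> (\<integral>\<^sup>+s. K * indicator (B r) s \<partial>m)"
    using bd by (intro nn_integral_mono) (auto simp: indicator_def)
  also have "\<dots> = K * ennreal (vol r)"
    by (subst nn_integral_cmult_indicator) (auto simp: emeasure_B)
  also have "ennreal (1 / vol r) * (K * ennreal (vol r)) = K * (ennreal (1 / vol r) * ennreal (vol r))"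
    by (simp add: algebra_simps)
  also have "ennreal (1 / vol r) * ennreal (vol r) = 1" using V by (simp add: ennreal_mult[symmetric])
  finally show ?thesis by (simp add: mult_left_mono)
qed

definition cutoff :: "nat \<Rightarrow> ('a \<Rightarrow> real) \<Rightarrow> bool" where
  "cutoff R \<eta> \<longleftrightarrow> continuous_on UNIV \<eta> \<and> (\<forall>x. 0 \<le> \<eta> x \<and> \<eta> x \<le> 1) \<and> (\<forall>x\<in>B R. \<eta> x = 1) \<and>
     (\<forall>x. x \<notin> B (3 * R) \<longrightarrow> \<eta> x = 0) \<and> (\<forall>x s. \<bar>\<eta> x - \<eta> (x + s)\<bar> \<le> (real (len s) + 2) / real R)"

text \<open>Word length need not be continuous, so the Lipschitz cutoff is an average of Urysohn functions of balls.\<close>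

lemma cutoff_exists:
  assumes R: "R \<ge> 1" obtains \<eta> where "cutoff R \<eta>"
proof -
  have "\<exists>h. continuous_on UNIV h \<and> (\<forall>x. 0 \<le> h x \<and> h x \<le> (1::real)) \<and> (\<forall>x\<in>B n. h x = 1) \<and> (\<forall>x. x \<notin> B (n + 2) \<longrightarrow> h x = 0)" for n
  proof -
    obtain h :: "'a \<Rightarrow> real" where "continuous_on UNIV h" "\<And>x. 0 \<le> h x" "\<And>x. h x \<le> 1"
      "\<And>x. x \<in> B n \<Longrightarrow> h x = 1" "\<And>x. x \<notin> interior (B (n + 2)) \<Longrightarrow> h x = 0"
      using bump[OF compact_B open_interior B_subset_interior, of n] by metis
    then show ?thesis using interior_subset by (intro exI[of _ h]) blast
  qed
  then obtain h where h: "\<And>n. continuous_on UNIV (h n)" "\<And>n x. 0 \<le> h n x" "\<And>n x. h n x \<le> (1::real)"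
    "\<And>n x. x \<in> B n \<Longrightarrow> h n x = 1" "\<And>n x. x \<notin> B (n + 2) \<Longrightarrow> h n x = 0"
    by metis
  define \<sigma> where "\<sigma> x = (\<Sum>n\<in>{R..<2*R}. h n x)" for x
  define \<eta> where "\<eta> x = \<sigma> x / real R" for x
  \<comment> \<open>Up to the slack 2 of each bump, \<open>\<sigma> x\<close> counts the radii in
    \<open>{R..<2*R}\<close> that reach \<open>x\<close>. Truncated subtraction makes the count 0,
    not negative, for distant points.\<close>
  have lower: "real (2 * R - max R (len x)) \<le> \<sigma> x" for x
  proof -
    have "real (2 * R - max R (len x)) = (\<Sum>n\<in>{max R (len x)..<2*R}. 1)" by simp
    also have "\<dots> = (\<Sum>n\<in>{max R (len x)..<2*R}. h n x)"
      using h(4) by (intro sum.cong refl) (auto simp: in_B_iff)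
    also have "\<dots> \<le> \<sigma> x" unfolding \<sigma>_def using h(2) by (intro sum_mono2) auto
    finally show ?thesis .
  qed
  have upper: "\<sigma> x \<le> real (2 * R - max R (len x - 2))" for x
  proof -
    have "\<sigma> x = (\<Sum>n\<in>{max R (len x - 2)..<2*R}. h n x)"
      unfolding \<sigma>_def using h(5) by (intro sum.mono_neutral_right) (auto simp: in_B_iff)
    also have "\<dots> \<le> (\<Sum>n\<in>{max R (len x - 2)..<2*R}. 1)" using h(3) by (intro sum_mono) auto
    finally show ?thesis by simp
  qed
  have diff: "\<sigma> x - \<sigma> y \<le> real (len s) + 2" if "len y \<le> len x + len s" for x y s
  proof -
    have "2 * R - max R (len x - 2) \<le> (2 * R - max R (len y)) + (len s + 2)" using that by arith
    then have "real (2 * R - max R (len x - 2)) \<le> real (2 * R - max R (len y)) + (real (len s) + 2)"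
      by linarith
    then show ?thesis using upper[of x] lower[of y] by linarith
  qed
  have "cutoff R \<eta>"
    unfolding cutoff_def
  proof (intro conjI allI ballI impI)
    show "continuous_on UNIV \<eta>" unfolding \<eta>_def \<sigma>_def using h(1) R by (intro continuous_intros) auto
    show "0 \<le> \<eta> x" for x unfolding \<eta>_def \<sigma>_def using h(2) by (intro divide_nonneg_nonneg sum_nonneg) auto
    have "\<sigma> x \<le> real R" for x by (rule order_trans[OF upper]) simp
    then show "\<eta> x \<le> 1" for x unfolding \<eta>_def using R by simp
    show "\<eta> x = 1" if "x \<in> B R" for x
    proof -
      have "real R \<le> \<sigma> x" using lower[of x] that by (simp add: in_B_iff)
      with \<open>\<sigma> x \<le> real R\<close> show ?thesis unfolding \<eta>_def using R by simp
    qed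
    \<comment> \<open>The largest bump in the sum reaches radius \<open>2 * R + 1\<close>, which is
      at most \<open>3 * R\<close>.\<close>
    show "\<eta> x = 0" if "x \<notin> B (3 * R)" for x
    proof -
      have "\<sigma> x \<le> 0" using upper[of x] that R by (simp add: in_B_iff)
      moreover have "\<sigma> x \<ge> 0" unfolding \<sigma>_def using h(2) by (intro sum_nonneg) auto
      ultimately show ?thesis unfolding \<eta>_def by simp
    qed
    fix x s
    have "\<sigma> x - \<sigma> (x + s) \<le> real (len s) + 2" "\<sigma> (x + s) - \<sigma> x \<le> real (len s) + 2"
      using len_add[of x s] len_diff_le[of x s] by (intro diff; simp)+
    then have "\<bar>\<sigma> x - \<sigma> (x + s)\<bar> \<le> real (len s) + 2" by linarith
    moreover have "\<bar>\<eta> x - \<eta> (x + s)\<bar> = \<bar>\<sigma> x - \<sigma> (x + s)\<bar> / real R"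
      unfolding \<eta>_def by (simp add: diff_divide_distrib[symmetric] abs_divide)
    ultimately show "\<bar>\<eta> x - \<eta> (x + s)\<bar> \<le> (real (len s) + 2) / real R"
      by (simp add: divide_right_mono)
  qed
  then show ?thesis using that by blast
qed

text \<open>A squared L2 norm on a ball, not a Dirichlet energy such as
  \<open>energy\<close>.\<close>

definition ball_energy :: "nat \<Rightarrow> ('a \<Rightarrow> complex) \<Rightarrow> real" where
  "ball_energy R f = (\<integral>x. indicator (B R) x * (cmod (f x))\<^sup>2 \<partial>m)"

lemma integrable_ball_energy:
  assumes "continuous_on UNIV f"
  shows "integrable m (\<lambda>x. indicator (B R) x * (cmod (f x))\<^sup>2)"
  using integrable_on_B[of "\<lambda>x. (cmod (f x))\<^sup>2" R] assms by (simp add: continuous_intros)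

lemma ball_energy_nonneg: "ball_energy R f \<ge> 0"
  unfolding ball_energy_def by simp

lemma ball_energy_mono:
  assumes "continuous_on UNIV f" "R \<le> R'"
  shows "ball_energy R f \<le> ball_energy R' f"
  unfolding ball_energy_def using B_mono[OF assms(2)]
  by (intro integral_mono integrable_ball_energy assms) (auto simp: indicator_def)

lemma ball_energy_le:
  assumes f: "continuous_on UNIV f" and C: "growth_bound k C f"
  shows "ball_energy R f \<le> (C * (1 + real R) ^ k)\<^sup>2 * vol R"
proof -
  have "ball_energy R f \<le> (\<integral>x. (C * (1 + real R) ^ k)\<^sup>2 * indicator (B R) x \<partial>m)"
    unfolding ball_energy_def
  proof (intro integral_mono integrable_ball_energy f)
    show "integrable m (\<lambda>x. (C * (1 + real R) ^ k)\<^sup>2 * indicator (B R) x)" using finite_B[of R] by simp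
    fix x
    show "indicator (B R) x * (cmod (f x))\<^sup>2 \<le> (C * (1 + real R) ^ k)\<^sup>2 * indicator (B R) x"
    proof (cases "x \<in> B R")
      case True
      then have "C * (1 + real (len x)) ^ k \<le> C * (1 + real R) ^ k"
        using growth_bound_nonneg[OF C] by (intro mult_left_mono power_mono) (auto simp: in_B_iff)
      then have "cmod (f x) \<le> C * (1 + real R) ^ k" using growth_boundD[OF C, of x] by linarith
      then show ?thesis using True by (simp add: power_mono)
    qed simp
  qed
  also have "\<dots> = (C * (1 + real R) ^ k)\<^sup>2 * vol R" using finite_B[of R] by simp
  finally show ?thesis .
qed

end

section \<open>The Caccioppoli inequality\<close>

context courteous_walk
begin

lemma integrable_uminus:
  fixes f :: "'a \<Rightarrow> 'c::{banach,second_countable_topology}"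
  assumes "integrable \<mu> f"
  shows "integrable \<mu> (\<lambda>s. f (- s))"
proof -
  have "f \<in> borel_measurable borel" using borel_measurable_integrable[OF assms] by simp
  then show ?thesis
    using integrable_distr_eq[of uminus \<mu> borel f] assms distr_uminus_mu translation_measurable(3) by simp
qed

text \<open>
  Expanding \<open>|\<eta>(x) f(x) - \<eta>(xs) f(xs)|\<^sup>2\<close> by the Caccioppoli identity, the first two terms integrate to
  \<open>0\<close> by harmonicity. The third is supported near the ball when \<open>s\<close> is short, and long \<open>s\<close> contribute
  a lower order error by the moment bounds on \<open>\<mu>\<close>.
\<close>

lemma Caccioppoli:
  obtains M c where "M \<ge> 0" "c \<ge> 0"
    "\<And>f C R \<eta>. f \<in> HF S \<mu> k \<Longrightarrow> growth_bound k C f \<Longrightarrow> R \<ge> 1 \<Longrightarrow> cutoff R \<eta> \<Longrightarrow>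
      energy (\<lambda>x. complex_of_real (\<eta> x) * f x) \<le> ennreal (M / (real R)\<^sup>2 * ball_energy (4 * R) f + c * C\<^sup>2 / (real R) ^ 3)"
proof -
  obtain c0 d where c0: "c0 > 0" "\<And>n. vol n \<le> c0 * (real n + 1) ^ d" using growthE by blast
  \<comment> \<open>The growth exponent of \<open>ball_energy\<close>: \<open>2 * k\<close> from the
    square of \<open>f\<close>, and \<open>d\<close> from the volume.\<close>
  define q where "q = 2 * k + d"
  have main: "energy (\<lambda>x. complex_of_real (\<eta> x) * f x)
      \<le> ennreal ((4 * moment 2) / (real R)\<^sup>2 * ball_energy (4 * R) f + (c0 * 4 ^ q * moment (q + 3)) * C\<^sup>2 / (real R) ^ 3)"
    if f: "f \<in> HF S \<mu> k" and C: "growth_bound k C f" and R: "R \<ge> 1" and \<eta>: "cutoff R \<eta>" for f C R \<eta>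
  proof -
    interpret m: sigma_finite_measure m by (rule sigma_finite_m)
    interpret P: pair_sigma_finite m \<mu> ..
    interpret P': pair_sigma_finite \<mu> m ..
    have smm: "sets (m \<Otimes>\<^sub>M \<mu>) = sets (borel \<Otimes>\<^sub>M borel)" "sets (\<mu> \<Otimes>\<^sub>M m) = sets (borel \<Otimes>\<^sub>M borel)"
      by (intro sets_pair_measure_cong; simp)+
    note C0 = growth_bound_nonneg[OF C]
    have fc: "continuous_on UNIV f" by (rule HF_continuous[OF f])
    have \<eta>c: "continuous_on UNIV \<eta>" and \<eta>01: "\<And>x. 0 \<le> \<eta> x" "\<And>x. \<eta> x \<le> 1"
      and \<eta>0: "\<And>x. x \<notin> B (3 * R) \<Longrightarrow> \<eta> x = 0"
      and \<eta>L: "\<And>x s. \<bar>\<eta> x - \<eta> (x + s)\<bar> \<le> (real (len s) + 2) / real R"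
      using \<eta> unfolding cutoff_def by auto
    note fs = continuous_translation(2)[OF fc] and \<eta>s = continuous_translation(2)[OF \<eta>c]
    have fp: "continuous_on UNIV (\<lambda>z::'a \<times> 'a. f (fst z))" "continuous_on UNIV (\<lambda>z::'a \<times> 'a. f (fst z + snd z))"
      "continuous_on UNIV (\<lambda>z::'a \<times> 'a. f (snd z))" "continuous_on UNIV (\<lambda>z::'a \<times> 'a. f (snd z + fst z))"
      by (rule continuous_on_compose2[OF fc]; auto intro!: continuous_intros)+
    have \<eta>p: "continuous_on UNIV (\<lambda>z::'a \<times> 'a. \<eta> (fst z))" "continuous_on UNIV (\<lambda>z::'a \<times> 'a. \<eta> (fst z + snd z))"
      "continuous_on UNIV (\<lambda>z::'a \<times> 'a. \<eta> (snd z))" "continuous_on UNIV (\<lambda>z::'a \<times> 'a. \<eta> (snd z + fst z))"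
      by (rule continuous_on_compose2[OF \<eta>c]; auto intro!: continuous_intros)+
    have \<eta>s0: "\<eta> (x + s) = 0" "\<eta> x = 0" if "x \<notin> B (3 * R + len s)" for x s
      using that len_diff_le[of x s] by (intro \<eta>0; simp add: in_B_iff)+
    define g where "g x = complex_of_real (\<eta> x) * f x" for x
    define T1 where "T1 x s = (f x - f (x + s)) * (complex_of_real ((\<eta> x)\<^sup>2) * cnj (f x))" for x s
    define T2 where "T2 x s = (f x - f (x + s)) * (complex_of_real ((\<eta> (x + s))\<^sup>2) * cnj (f (x + s)))" for x s
    define T3 where "T3 x s = Re (f x * cnj (f (x + s))) * (\<eta> x - \<eta> (x + s))\<^sup>2" for x s
    define t1 where "t1 s = (\<integral>x. T1 x s \<partial>m)" for s
    define t3 where "t3 s = (\<integral>x. T3 x s \<partial>m)" for s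
    have i1: "integrable m (\<lambda>x. T1 x s)" for s
      unfolding T1_def by (rule integrable_compact_support[of _ "3 * R"])
        (intro continuous_intros fc \<eta>c fs, simp add: \<eta>0)
    have i2: "integrable m (\<lambda>x. T2 x s)" for s
      unfolding T2_def by (rule integrable_compact_support[of _ "3 * R + len s"])
        (intro continuous_intros fc \<eta>s fs, simp add: \<eta>s0)
    have i3: "integrable m (\<lambda>x. T3 x s)" for s
      unfolding T3_def by (rule integrable_compact_support[of _ "3 * R + len s"])
        (intro continuous_intros fc \<eta>s \<eta>c fs, simp add: \<eta>s0)
    \<comment> \<open>Replacing \<open>x\<close> by \<open>x + s\<close>, which right invariance
      permits, exchanges the end points of the step and turns \<open>T2\<close> at \<open>s\<close>
      into minus \<open>T1\<close> at \<open>- s\<close>.\<close>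
    have t2: "(\<integral>x. T2 x s \<partial>m) = - t1 (- s)" for s
    proof -
      have "(\<integral>x. T2 x s \<partial>m) = (\<integral>x. - T1 (x + s) (- s) \<partial>m)"
        unfolding T1_def T2_def by (simp add: add.assoc algebra_simps)
      also have "\<dots> = (\<integral>x. - T1 x (- s) \<partial>m)"
        using i1[of "- s"] by (intro integral_right) (auto dest: borel_measurable_integrable)
      also have "\<dots> = - t1 (- s)" unfolding t1_def by simp
      finally show ?thesis .
    qed
    have shift: "shift_energy g s = ennreal (Re (t1 s) + Re (t1 (- s)) + t3 s)"
      and pos: "0 \<le> Re (t1 s) + Re (t1 (- s)) + t3 s" for s
    proof -
      have eq: "(cmod (g x - g (x + s)))\<^sup>2 = Re (T1 x s) - Re (T2 x s) + T3 x s" for x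
        unfolding g_def T1_def T2_def T3_def by (rule Caccioppoli_identity)
      have int: "(\<integral>x. (cmod (g x - g (x + s)))\<^sup>2 \<partial>m) = Re (t1 s) + Re (t1 (- s)) + t3 s"
        unfolding eq using i1[of s] i2[of s] i3[of s] t2[of s] by (simp add: t1_def t3_def)
      have "integrable m (\<lambda>x. (cmod (g x - g (x + s)))\<^sup>2)"
        unfolding eq using i1[of s] i2[of s] i3[of s] by simp
      then show "shift_energy g s = ennreal (Re (t1 s) + Re (t1 (- s)) + t3 s)"
        unfolding shift_energy_def int[symmetric] by (intro nn_integral_eq_integral) auto
      show "0 \<le> Re (t1 s) + Re (t1 (- s)) + t3 s" unfolding int[symmetric] by simp
    qed
    \<comment> \<open>A product majorant for Fubini: the cutoff confines \<open>x\<close> to a ball,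
      and the growth in \<open>s\<close> is a moment.\<close>
    have T1_int: "integrable (m \<Otimes>\<^sub>M \<mu>) (case_prod T1)"
    proof (rule P.integrable_product_bound)
      define a where "a = C * (1 + real (3 * R)) ^ k"
      have a0: "a \<ge> 0" unfolding a_def using C0 by simp
      have "continuous_on UNIV (\<lambda>z. T1 (fst z) (snd z))"
        unfolding T1_def by (intro continuous_intros fp \<eta>p)
      then show "case_prod T1 \<in> borel_measurable (m \<Otimes>\<^sub>M \<mu>)"
        unfolding case_prod_unfold measurable_cong_sets[OF smm(1) refl] by (rule pair_measurable)
      show "integrable m (\<lambda>x. 2 * a\<^sup>2 * indicator (B (3 * R)) x)" using finite_B[of "3 * R"] by simp
      show "integrable \<mu> (\<lambda>s. (1 + real (len s)) ^ k)" by (rule integrable_moment)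
      fix x s
      define v where "v = (1 + real (len s)) ^ k"
      have v1: "v \<ge> 1" unfolding v_def by (intro one_le_power) simp
      show "norm (T1 x s) \<le> 2 * a\<^sup>2 * indicator (B (3 * R)) x * (1 + real (len s)) ^ k"
      proof (cases "x \<in> B (3 * R)")
        case True
        then have le: "C * (1 + real (len x)) ^ k \<le> a"
          unfolding a_def using C0 by (intro mult_left_mono power_mono) (auto simp: in_B_iff)
        have 1: "cmod (f x) \<le> a" using growth_boundD[OF C, of x] le by linarith
        have 2: "cmod (f (x + s)) \<le> a * v"
        proof -
          have "C * (1 + real (len x)) ^ k * v \<le> a * v" using le v1 by (intro mult_right_mono) auto
          then show ?thesis using growth_bound_shift[OF C, of x s] unfolding v_def by linarith
        qed
        have "cmod (f x - f (x + s)) \<le> cmod (f x) + cmod (f (x + s))" by (rule norm_triangle_ineq4)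
        also have "\<dots> \<le> a * v + a * v"
          using 1 2 mult_left_mono[OF v1 a0] by simp
        finally have 3: "cmod (f x - f (x + s)) \<le> 2 * a * v" by simp
        have "(\<eta> x)\<^sup>2 * cmod (f x) \<le> 1 * a"
          using 1 \<eta>01[of x] by (intro mult_mono) (auto simp: power_le_one)
        then have 4: "cmod (complex_of_real ((\<eta> x)\<^sup>2) * cnj (f x)) \<le> a"
          by (simp add: norm_mult norm_power)
        have "norm (T1 x s) \<le> (2 * a * v) * a"
          unfolding T1_def norm_mult[of "f x - f (x + s)"] using mult_mono[OF 3 4] a0 v1 by simp
        then show ?thesis using True by (simp add: v_def power2_eq_square mult.assoc mult.commute mult.left_commute)
      next
        case False
        then show ?thesis unfolding T1_def by (simp add: \<eta>0)
      qed
    qed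
    have t1_int: "integrable \<mu> t1"
      unfolding t1_def using P.integrable_snd[OF T1_int] .
    \<comment> \<open>Integrating over the step first leaves \<open>f x\<close> minus its own
      average.\<close>
    have t1_0: "(\<integral>s. t1 s \<partial>\<mu>) = 0"
    proof -
      have "(\<integral>s. t1 s \<partial>\<mu>) = (\<integral>x. \<integral>s. T1 x s \<partial>\<mu> \<partial>m)"
        unfolding t1_def by (rule P.Fubini_integral[OF T1_int])
      also have "(\<lambda>x. \<integral>s. T1 x s \<partial>\<mu>) = (\<lambda>x. 0)"
      proof
        fix x
        have "(\<integral>s. f x - f (x + s) \<partial>\<mu>) = f x - (\<integral>s. f (x + s) \<partial>\<mu>)"
          using HF_D(3)[OF f, of x] mu.prob_space by simp
        also have "\<dots> = 0" using HF_D(2)[OF f, of x] by simp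
        finally show "(\<integral>s. T1 x s \<partial>\<mu>) = 0" unfolding T1_def by simp
      qed
      finally show ?thesis by simp
    qed
    have t1u: "integrable \<mu> (\<lambda>s. t1 (- s))" "(\<integral>s. t1 (- s) \<partial>\<mu>) = 0"
      using integrable_uminus[OF t1_int] integral_uminus[of t1] t1_0 borel_measurable_integrable[OF t1_int] by auto
    \<comment> \<open>Majorant of the cutoff term. The first summand serves steps with
      \<open>len s \<le> R\<close>, which keep the integrand inside radius \<open>4 * R\<close>. The
      second serves longer steps, where the factor \<open>((1 + len s) / R) ^ 3\<close>, at least 1,
      trades three moments for decay. The exponent 3 beats the factor
      \<open>r ^ 2 \<le> R ^ 2\<close> that appears in \<open>trace_bound\<close>.\<close>
    define A where "A s = 4 / (real R)\<^sup>2 * ball_energy (4 * R) f * (1 + real (len s)) ^ 2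
        + C\<^sup>2 * c0 * 4 ^ q / (real R) ^ 3 * (1 + real (len s)) ^ (q + 3)" for s
    define K where "K x s = (cmod (f x))\<^sup>2 * (\<eta> x - \<eta> (x + s))\<^sup>2" for x s
    have K_int: "integrable m (\<lambda>x. K x s)" for s
      unfolding K_def by (rule integrable_compact_support[of _ "3 * R + len s"])
        (intro continuous_intros fc \<eta>s \<eta>c fs, simp add: \<eta>s0)
    have K_le: "(\<integral>x. K x s \<partial>m) \<le> A s" for s
    proof (cases "len s \<le> R")
      case True
      have "(\<integral>x. K x s \<partial>m) \<le> (\<integral>x. ((real (len s) + 2) / real R)\<^sup>2 * (indicator (B (4 * R)) x * (cmod (f x))\<^sup>2) \<partial>m)"
      proof (intro integral_mono K_int integrable_mult_right integrable_ball_energy fc)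
        fix x
        show "K x s \<le> ((real (len s) + 2) / real R)\<^sup>2 * (indicator (B (4 * R)) x * (cmod (f x))\<^sup>2)"
        proof (cases "x \<in> B (4 * R)")
          case x: True
          have "(\<eta> x - \<eta> (x + s))\<^sup>2 \<le> ((real (len s) + 2) / real R)\<^sup>2"
            using power_mono[OF \<eta>L[of x s], of 2] by simp
          then show ?thesis using x unfolding K_def by (simp add: mult.commute mult_left_mono)
        next
          case x: False
          have "3 * R + len s \<le> 4 * R" using True by simp
          then have "x \<notin> B (3 * R + len s)" using x B_mono by blast
          then show ?thesis using x unfolding K_def by (simp add: \<eta>s0)
        qed
      qed
      also have "\<dots> = ((real (len s) + 2) / real R)\<^sup>2 * ball_energy (4 * R) f"
        unfolding ball_energy_def by simp
      also have "\<dots> \<le> (2 * (1 + real (len s)) / real R)\<^sup>2 * ball_energy (4 * R) f"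
        by (intro mult_right_mono power_mono divide_right_mono ball_energy_nonneg) auto
      also have "\<dots> = 4 / (real R)\<^sup>2 * ball_energy (4 * R) f * (1 + real (len s)) ^ 2"
        by (simp only: power_divide power_mult_distrib) simp
      also have "\<dots> \<le> A s" unfolding A_def using c0 by simp
      finally show ?thesis .
    next
      case False
      define n where "n = 3 * R + len s"
      have "(\<integral>x. K x s \<partial>m) \<le> ball_energy n f"
        unfolding ball_energy_def
      proof (intro integral_mono K_int integrable_ball_energy fc)
        fix x
        show "K x s \<le> indicator (B n) x * (cmod (f x))\<^sup>2"
        proof (cases "x \<in> B n")
          case True
          have "\<bar>\<eta> x - \<eta> (x + s)\<bar> \<le> 1" using \<eta>01[of x] \<eta>01[of "x + s"] by linarith
          then have "(\<eta> x - \<eta> (x + s))\<^sup>2 \<le> 1" by (simp add: abs_square_le_1)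
          then show ?thesis using True unfolding K_def by (simp add: mult_left_le)
        next
          case False
          then show ?thesis unfolding K_def n_def by (simp add: \<eta>s0)
        qed
      qed
      also have "\<dots> \<le> (C * (1 + real n) ^ k)\<^sup>2 * vol n" by (rule ball_energy_le[OF fc C])
      also have "\<dots> \<le> (C * (1 + real n) ^ k)\<^sup>2 * (c0 * (real n + 1) ^ d)"
        using c0(2)[of n] by (intro mult_left_mono) auto
      also have "\<dots> = C\<^sup>2 * c0 * (1 + real n) ^ q"
        unfolding q_def by (simp add: power_mult_distrib power_add power_mult add.commute mult.commute power2_eq_square)
      also have "\<dots> \<le> C\<^sup>2 * c0 * (4 * (1 + real (len s))) ^ q"
        using False c0(1) unfolding n_def by (intro mult_left_mono power_mono) auto
      also have "\<dots> * 1 \<le> C\<^sup>2 * c0 * (4 * (1 + real (len s))) ^ q * ((1 + real (len s)) / real R) ^ 3"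
        using False c0(1) R by (intro mult_left_mono one_le_power) auto
      also have "\<dots> = C\<^sup>2 * c0 * 4 ^ q / (real R) ^ 3 * (1 + real (len s)) ^ (q + 3)"
        by (simp only: power_mult_distrib power_divide power_add) simp
      also have "\<dots> \<le> A s" unfolding A_def using ball_energy_nonneg[of "4 * R" f] by simp
      finally show ?thesis by simp
    qed
    have t3_le: "\<bar>t3 s\<bar> \<le> A s" for s
    proof -
      \<comment> \<open>The half of the estimate that involves \<open>f (x + s)\<close> is brought
        back to \<open>f x\<close> by a right translation, with \<open>- s\<close> in place of
        \<open>s\<close>.\<close>
      have K_right: "integrable m (\<lambda>x. K (x + s) (- s))" "(\<integral>x. K (x + s) (- s) \<partial>m) = (\<integral>x. K x (- s) \<partial>m)"
        using integral_right[of "\<lambda>x. K x (- s)" s] K_int[of "- s"] borel_measurable_integrable[OF K_int[of "- s"]] by auto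
      have "\<bar>t3 s\<bar> \<le> (\<integral>x. \<bar>T3 x s\<bar> \<partial>m)" unfolding t3_def by (rule integral_abs_bound)
      also have "\<dots> \<le> (\<integral>x. (K x s + K (x + s) (- s)) / 2 \<partial>m)"
      proof (rule integral_mono)
        fix x
        have "\<bar>T3 x s\<bar> = \<bar>Re (f x * cnj (f (x + s)))\<bar> * (\<eta> x - \<eta> (x + s))\<^sup>2" unfolding T3_def by (simp add: abs_mult)
        also have "\<dots> \<le> ((cmod (f x))\<^sup>2 + (cmod (f (x + s)))\<^sup>2) / 2 * (\<eta> x - \<eta> (x + s))\<^sup>2"
          by (intro mult_right_mono Re_mult_cnj_le) simp
        also have "\<dots> = (K x s + K (x + s) (- s)) / 2"
          unfolding K_def by (simp add: add.assoc algebra_simps power2_commute[of "\<eta> x"])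
        finally show "\<bar>T3 x s\<bar> \<le> (K x s + K (x + s) (- s)) / 2" .
      qed (use i3[of s] K_int[of s] K_right(1) in auto)
      also have "\<dots> = ((\<integral>x. K x s \<partial>m) + (\<integral>x. K x (- s) \<partial>m)) / 2"
        using K_int[of s] K_right by simp
      also have "\<dots> \<le> (A s + A (- s)) / 2" using K_le[of s] K_le[of "- s"] by simp
      also have "A (- s) = A s" unfolding A_def by simp
      finally show ?thesis by simp
    qed
    have A_int: "integrable \<mu> A"
      unfolding A_def by (intro Bochner_Integration.integrable_add integrable_mult_right integrable_moment)
    have t3_int: "integrable \<mu> t3"
    proof (rule Bochner_Integration.integrable_bound[OF A_int])
      have "continuous_on UNIV (\<lambda>z. T3 (snd z) (fst z))"
        unfolding T3_def by (intro continuous_intros fp \<eta>p)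
      then have "(\<lambda>(s, x). T3 x s) \<in> borel_measurable (\<mu> \<Otimes>\<^sub>M m)"
        unfolding case_prod_unfold measurable_cong_sets[OF smm(2) refl] by (rule pair_measurable)
      then show "t3 \<in> borel_measurable \<mu>"
        unfolding t3_def by (rule m.borel_measurable_lebesgue_integral)
      show "AE s in \<mu>. norm (t3 s) \<le> norm (A s)" using t3_le by (intro AE_I2) (simp add: order_trans[OF _ abs_ge_self])
    qed
    have "energy g = (\<integral>\<^sup>+s. ennreal (Re (t1 s) + Re (t1 (- s)) + t3 s) \<partial>\<mu>)"
      unfolding energy_def shift ..
    also have "\<dots> = ennreal (\<integral>s. Re (t1 s) + Re (t1 (- s)) + t3 s \<partial>\<mu>)"
      using t1_int t1u(1) t3_int pos by (intro nn_integral_eq_integral) auto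
    also have "(\<integral>s. Re (t1 s) + Re (t1 (- s)) + t3 s \<partial>\<mu>) = (\<integral>s. t3 s \<partial>\<mu>)"
      using t1_int t1u t3_int t1_0 by simp
    also have "ennreal (\<integral>s. t3 s \<partial>\<mu>) \<le> ennreal (\<integral>s. A s \<partial>\<mu>)"
      using t3_le by (intro ennreal_leI integral_mono t3_int A_int) (simp add: abs_le_iff)
    also have "(\<integral>s. A s \<partial>\<mu>) = 4 / (real R)\<^sup>2 * ball_energy (4 * R) f * moment 2 + C\<^sup>2 * c0 * 4 ^ q / (real R) ^ 3 * moment (q + 3)"
      unfolding A_def moment_def
      by (subst Bochner_Integration.integral_add)
         (simp_all only: integrable_mult_right[OF integrable_moment] integral_mult_right_zero)
    also have "\<dots> = (4 * moment 2) / (real R)\<^sup>2 * ball_energy (4 * R) f + (c0 * 4 ^ q * moment (q + 3)) * C\<^sup>2 / (real R) ^ 3"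
      by (simp add: mult.commute mult.left_commute)
    finally show ?thesis unfolding g_def .
  qed
  show ?thesis
    by (rule that[OF _ _ main]) (use c0(1) moment_nonneg in auto)
qed

end

section \<open>Hermitian forms on function spaces\<close>

text \<open>The form is only semidefinite: functions are not identified when they agree almost
  everywhere on a ball, so a nonzero function may have norm 0. Lemmas that divide by a norm assume
  positivity where they use it.\<close>

locale hermitian_form =
  fixes V :: "('a \<Rightarrow> complex) set" and ip :: "('a \<Rightarrow> complex) \<Rightarrow> ('a \<Rightarrow> complex) \<Rightarrow> complex"
  assumes V_zero: "(\<lambda>x. 0) \<in> V"
    and V_add: "f \<in> V \<Longrightarrow> g \<in> V \<Longrightarrow> (\<lambda>x. f x + g x) \<in> V"
    and V_scale: "f \<in> V \<Longrightarrow> (\<lambda>x. c * f x) \<in> V"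
    and ip_add: "f \<in> V \<Longrightarrow> g \<in> V \<Longrightarrow> h \<in> V \<Longrightarrow> ip (\<lambda>x. f x + g x) h = ip f h + ip g h"
    and ip_scale: "f \<in> V \<Longrightarrow> h \<in> V \<Longrightarrow> ip (\<lambda>x. c * f x) h = c * ip f h"
    and ip_cnj: "f \<in> V \<Longrightarrow> h \<in> V \<Longrightarrow> ip h f = cnj (ip f h)"
    and ip_nonneg: "f \<in> V \<Longrightarrow> 0 \<le> Re (ip f f)"
begin

definition sq :: "('a \<Rightarrow> complex) \<Rightarrow> real" where "sq f = Re (ip f f)"

lemma ip_self: "f \<in> V \<Longrightarrow> ip f f = complex_of_real (sq f)"
  using ip_cnj[of f f] unfolding sq_def by (simp add: complex_eq_iff)

lemma sq_nonneg: "f \<in> V \<Longrightarrow> 0 \<le> sq f"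
  unfolding sq_def by (rule ip_nonneg)

lemma ip_zero: "h \<in> V \<Longrightarrow> ip (\<lambda>x. 0) h = 0"
  using ip_scale[OF V_zero, of h 0] by simp

lemma V_sum: "(\<And>i. i \<in> I \<Longrightarrow> f i \<in> V) \<Longrightarrow> (\<lambda>x. \<Sum>i\<in>I. c i * f i x) \<in> V"
proof (induction I rule: infinite_finite_induct)
  case (insert i I)
  then show ?case using V_add[OF V_scale[of "f i" "c i"] insert.IH] by simp
qed (simp_all add: V_zero)

lemma ip_sum: "(\<And>i. i \<in> I \<Longrightarrow> f i \<in> V) \<Longrightarrow> h \<in> V \<Longrightarrow> ip (\<lambda>x. \<Sum>i\<in>I. c i * f i x) h = (\<Sum>i\<in>I. c i * ip (f i) h)"
  by (induction I rule: infinite_finite_induct) (auto simp: ip_zero ip_add ip_scale V_sum V_scale)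

lemma ip_add_right: "f \<in> V \<Longrightarrow> g \<in> V \<Longrightarrow> h \<in> V \<Longrightarrow> ip h (\<lambda>x. f x + g x) = ip h f + ip h g"
  by (subst (1 2 3) ip_cnj) (auto simp: V_add ip_add)

lemma ip_scale_right: "f \<in> V \<Longrightarrow> h \<in> V \<Longrightarrow> ip h (\<lambda>x. c * f x) = cnj c * ip h f"
  by (subst (1 2) ip_cnj) (auto simp: V_scale ip_scale)

lemma ip_sum_right:
  "(\<And>i. i \<in> I \<Longrightarrow> f i \<in> V) \<Longrightarrow> h \<in> V \<Longrightarrow> ip h (\<lambda>x. \<Sum>i\<in>I. c i * f i x) = (\<Sum>i\<in>I. cnj (c i) * ip h (f i))"
proof -
  assume f: "\<And>i. i \<in> I \<Longrightarrow> f i \<in> V" and h: "h \<in> V"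
  have "ip h (\<lambda>x. \<Sum>i\<in>I. c i * f i x) = cnj (ip (\<lambda>x. \<Sum>i\<in>I. c i * f i x) h)"
    by (rule ip_cnj[OF V_sum[OF f] h])
  also have "\<dots> = (\<Sum>i\<in>I. cnj (c i) * cnj (ip (f i) h))" by (simp add: ip_sum[OF f h])
  also have "\<dots> = (\<Sum>i\<in>I. cnj (c i) * ip h (f i))"
    by (intro sum.cong refl) (simp add: ip_cnj[OF f h, symmetric])
  finally show ?thesis .
qed

lemma sq_add_orthogonal:
  assumes "f \<in> V" "g \<in> V" "ip f g = 0"
  shows "sq (\<lambda>x. f x + g x) = sq f + sq g"
  using assms ip_cnj[of f g] unfolding sq_def by (simp add: ip_add ip_add_right V_add)

lemma sq_scale: "f \<in> V \<Longrightarrow> sq (\<lambda>x. c * f x) = (cmod c)\<^sup>2 * sq f"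
  by (simp add: sq_def ip_scale ip_scale_right V_scale mult.assoc[symmetric] complex_norm_square[symmetric])

lemma sq_orthonormal_sum:
  fixes n :: nat
  assumes f: "\<And>i. i < n \<Longrightarrow> f i \<in> V"
    and on: "\<And>i j. i < n \<Longrightarrow> j < n \<Longrightarrow> ip (f i) (f j) = (if i = j then 1 else 0)"
  shows "sq (\<lambda>x. \<Sum>i<n. c i * f i x) = (\<Sum>i<n. (cmod (c i))\<^sup>2)"
proof -
  have "ip (\<lambda>x. \<Sum>i<n. c i * f i x) (\<lambda>x. \<Sum>j<n. c j * f j x) = (\<Sum>i<n. c i * (\<Sum>j<n. cnj (c j) * ip (f i) (f j)))"
    using f by (subst ip_sum) (auto intro!: V_sum sum.cong arg_cong2[where f = "(*)"] ip_sum_right)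
  also have "\<dots> = (\<Sum>i<n. c i * (\<Sum>j<n. if i = j then cnj (c j) else 0))"
    using on by (intro sum.cong refl arg_cong2[where f = "(*)"]) auto
  also have "\<dots> = (\<Sum>i<n. complex_of_real ((cmod (c i))\<^sup>2))"
    by (intro sum.cong refl) (simp add: sum.delta complex_norm_square del: of_real_power)
  finally show ?thesis unfolding sq_def by simp
qed

lemma Bessel:
  fixes n :: nat
  assumes f: "\<And>i. i < n \<Longrightarrow> f i \<in> V" and \<psi>: "\<psi> \<in> V"
    and on: "\<And>i j. i < n \<Longrightarrow> j < n \<Longrightarrow> ip (f i) (f j) = (if i = j then 1 else 0)"
  shows "(\<Sum>i<n. (cmod (ip (f i) \<psi>))\<^sup>2) \<le> sq \<psi>"
proof -
  define p where "p x = (\<Sum>i<n. ip \<psi> (f i) * f i x)" for x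
  define w where "w x = \<psi> x + (- 1) * p x" for x
  have pV: "p \<in> V" unfolding p_def using f by (intro V_sum) auto
  have wV: "w \<in> V" unfolding w_def by (intro V_add \<psi> V_scale pV)
  have "ip w (f j) = 0" if j: "j < n" for j
  proof -
    have "ip p (f j) = (\<Sum>i<n. ip \<psi> (f i) * ip (f i) (f j))" unfolding p_def using f j by (intro ip_sum) auto
    also have "\<dots> = (\<Sum>i<n. if i = j then ip \<psi> (f i) else 0)" using on j by (intro sum.cong refl) auto
    also have "\<dots> = ip \<psi> (f j)" using j by simp
    finally show ?thesis
      unfolding w_def using \<psi> pV f[OF j] V_scale[OF pV, of "- 1"] by (simp only: ip_add ip_scale) simp
  qed
  then have "ip w p = 0" unfolding p_def using f wV by (subst ip_sum_right) auto
  then have "sq (\<lambda>x. w x + p x) = sq w + sq p" by (rule sq_add_orthogonal[OF wV pV])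
  moreover have "(\<lambda>x. w x + p x) = \<psi>" unfolding w_def by simp
  moreover have "sq p = (\<Sum>i<n. (cmod (ip \<psi> (f i)))\<^sup>2)"
    unfolding p_def by (rule sq_orthonormal_sum[OF f on])
  moreover have "cmod (ip \<psi> (f i)) = cmod (ip (f i) \<psi>)" if "i < n" for i
    using ip_cnj[OF f[OF that] \<psi>] by simp
  ultimately show ?thesis using sq_nonneg[OF wV] by simp
qed

text \<open>By induction both \<open>h\<close> and the last vector \<open>e n\<close> are corrected
  against the earlier vectors. Subtracting a multiple of the corrected \<open>e n\<close>, whose
  norm is positive by \<open>pos\<close>, then settles the last equation without disturbing the
  others.\<close>

lemma orthogonal_correction:
  fixes e :: "nat \<Rightarrow> 'a \<Rightarrow> complex"
  assumes "\<And>i. i < n \<Longrightarrow> e i \<in> V"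
    and pos: "\<And>i b. i < n \<Longrightarrow> sq (\<lambda>x. e i x + (\<Sum>j<i. b j * e j x)) > 0"
    and h: "h \<in> V"
  shows "\<exists>a. \<forall>l<n. ip (\<lambda>x. h x + (\<Sum>j<n. a j * e j x)) (e l) = 0"
  using assms
proof (induction n arbitrary: h)
  case (Suc n)
  have eV: "e i \<in> V" if "i \<le> n" for i using Suc.prems(1) that by simp
  have IH: "\<exists>a. \<forall>l<n. ip (\<lambda>x. h x + (\<Sum>j<n. a j * e j x)) (e l) = 0" if "h \<in> V" for h
    using Suc.IH[OF _ _ that] Suc.prems(1,2) by simp
  obtain a where a: "\<And>l. l < n \<Longrightarrow> ip (\<lambda>x. h x + (\<Sum>j<n. a j * e j x)) (e l) = 0"
    using IH[OF Suc.prems(3)] by blast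
  obtain b where b: "\<And>l. l < n \<Longrightarrow> ip (\<lambda>x. e n x + (\<Sum>j<n. b j * e j x)) (e l) = 0"
    using IH[OF eV[of n]] by blast
  define h1 where "h1 x = h x + (\<Sum>j<n. a j * e j x)" for x
  define e1 where "e1 x = e n x + (\<Sum>j<n. b j * e j x)" for x
  have h1V: "h1 \<in> V" unfolding h1_def using eV by (intro V_add V_sum Suc.prems(3)) auto
  have e1V: "e1 \<in> V" unfolding e1_def using eV by (intro V_add V_sum) auto
  have "sq e1 > 0" unfolding e1_def using Suc.prems(2)[of n b] by simp
  then have nz: "ip e1 e1 \<noteq> 0" using ip_self[OF e1V] by simp
  define t where "t = - ip h1 e1 / ip e1 e1"
  define h2 where "h2 x = h1 x + t * e1 x" for x
  have ip_h2: "ip h2 v = ip h1 v + t * ip e1 v" if "v \<in> V" for v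
    unfolding h2_def using that h1V e1V by (simp add: ip_add ip_scale V_scale)
  have h2V: "h2 \<in> V" unfolding h2_def by (intro V_add V_scale h1V e1V)
  have low: "ip h2 (e l) = 0" if "l < n" for l
    using ip_h2[OF eV[of l]] a[OF that] b[OF that] that by (simp add: h1_def[symmetric] e1_def[symmetric])
  have top: "ip h2 e1 = 0" using ip_h2[OF e1V] nz unfolding t_def by simp
  \<comment> \<open>\<open>e1\<close> is \<open>e n\<close> plus earlier vectors, to which
    \<open>h2\<close> is already orthogonal, so orthogonality to \<open>e1\<close> passes to
    \<open>e n\<close>.\<close>
  have "ip h2 e1 = ip h2 (e n) + (\<Sum>j<n. cnj (b j) * ip h2 (e j))"
  proof -
    have 1: "(\<lambda>x. \<Sum>j<n. b j * e j x) \<in> V" using eV by (intro V_sum) auto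
    have 2: "ip h2 (\<lambda>x. \<Sum>j<n. b j * e j x) = (\<Sum>j<n. cnj (b j) * ip h2 (e j))"
      using eV h2V by (intro ip_sum_right) auto
    show ?thesis unfolding e1_def using ip_add_right[OF eV[of n] 1 h2V] 2 by simp
  qed
  then have "ip h2 (e n) = 0" using top low by simp
  moreover have "h2 = (\<lambda>x. h x + (\<Sum>j<Suc n. (if j < n then a j + t * b j else t) * e j x))"
    unfolding h2_def h1_def e1_def by (auto simp: algebra_simps sum.distrib sum_distrib_left)
  ultimately show ?case using low by (intro exI[of _ "\<lambda>j. if j < n then a j + t * b j else t"]) (auto simp: less_Suc_eq)
qed simp

text \<open>
  \<open>f i\<close> is the component of \<open>e i\<close> orthogonal to \<open>e 0, \<dots>, e (i - 1)\<close>; the product of the \<open>sq (f i)\<close> is the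
  Gram determinant, whose growth in the radius is compared with the trace below.
\<close>

lemma Gram_Schmidt:
  fixes e :: "nat \<Rightarrow> 'a \<Rightarrow> complex"
  assumes e: "\<And>i. i < n \<Longrightarrow> e i \<in> V"
    and pos: "\<And>i b. i < n \<Longrightarrow> sq (\<lambda>x. e i x + (\<Sum>j<i. b j * e j x)) > 0"
  obtains a where "\<And>i. i < n \<Longrightarrow> sq (\<lambda>x. e i x + (\<Sum>j<i. a i j * e j x)) > 0"
    "\<And>i b. i < n \<Longrightarrow> sq (\<lambda>x. e i x + (\<Sum>j<i. a i j * e j x)) \<le> sq (\<lambda>x. e i x + (\<Sum>j<i. b j * e j x))"
    "\<And>i j. i < n \<Longrightarrow> j < n \<Longrightarrow> i \<noteq> j \<Longrightarrow>
       ip (\<lambda>x. e i x + (\<Sum>l<i. a i l * e l x)) (\<lambda>x. e j x + (\<Sum>l<j. a j l * e l x)) = 0"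
proof -
  have "\<exists>a. \<forall>l<i. ip (\<lambda>x. e i x + (\<Sum>j<i. a j * e j x)) (e l) = 0" if "i < n" for i
    using that by (intro orthogonal_correction) (auto intro: e pos)
  then obtain a where a: "\<And>i l. i < n \<Longrightarrow> l < i \<Longrightarrow> ip (\<lambda>x. e i x + (\<Sum>j<i. a i j * e j x)) (e l) = 0" by metis
  define f where "f i = (\<lambda>x. e i x + (\<Sum>j<i. a i j * e j x))" for i
  have fV: "f i \<in> V" if "i < n" for i unfolding f_def using e that by (intro V_add V_sum) auto
  have lower: "ip (f i) (\<lambda>x. \<Sum>j<i. c j * e j x) = 0" if "i < n" for i c
    using a[OF that] fV[OF that] e that by (subst ip_sum_right) (auto simp: f_def)
  show ?thesis
  proof (rule that[of a])
    fix i assume i: "i < n"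
    show "sq (\<lambda>x. e i x + (\<Sum>j<i. a i j * e j x)) > 0" by (rule pos[OF i])
    fix b
    \<comment> \<open>A competitor differs from \<open>f i\<close> by an element of the span of the
      earlier vectors, so minimality is Pythagoras.\<close>
    define v where "v x = (\<Sum>j<i. (b j - a i j) * e j x)" for x
    have vV: "v \<in> V" unfolding v_def using e i by (intro V_sum) auto
    have eq: "(\<lambda>x. e i x + (\<Sum>j<i. b j * e j x)) = (\<lambda>x. f i x + v x)"
      unfolding f_def v_def by (auto simp: left_diff_distrib sum_subtractf)
    have "sq (\<lambda>x. e i x + (\<Sum>j<i. b j * e j x)) = sq (f i) + sq v"
      unfolding eq using fV[OF i] vV lower[OF i] unfolding v_def by (rule sq_add_orthogonal)
    then show "sq (\<lambda>x. e i x + (\<Sum>j<i. a i j * e j x)) \<le> sq (\<lambda>x. e i x + (\<Sum>j<i. b j * e j x))"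
      using sq_nonneg[OF vV] unfolding f_def by simp
  next
    \<comment> \<open>For \<open>j < i\<close> the vector \<open>f j\<close> lies in the span of
      \<open>e 0, ..., e (i - 1)\<close>; padding its coefficients to that range makes
      \<open>lower\<close> applicable.\<close>
    have *: "ip (f i) (f j) = 0" if "i < n" "j < i" for i j
    proof -
      have "(\<Sum>l<j. a j l * e l x) = (\<Sum>l<i. (if l < j then a j l else 0) * e l x)" for x
        using that by (intro sum.mono_neutral_cong_left) auto
      moreover have "e j x = (\<Sum>l<i. (if l = j then 1 else 0) * e l x)" for x
        using that by (subst sum.cong[of _ _ _ "\<lambda>l. if l = j then e l x else 0"]) auto
      ultimately have "f j = (\<lambda>x. \<Sum>l<i. ((if l = j then 1 else 0) + (if l < j then a j l else 0)) * e l x)"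
        unfolding f_def by (auto simp: distrib_right sum.distrib)
      then show ?thesis using lower[OF that(1)] by simp
    qed
    fix i j assume ij: "i < n" "j < n" "i \<noteq> j"
    then have "ip (f i) (f j) = 0"
      using *[of i j] *[of j i] ip_cnj[OF fV[OF ij(2)] fV[OF ij(1)]] by (cases "i < j") auto
    then show "ip (\<lambda>x. e i x + (\<Sum>l<i. a i l * e l x)) (\<lambda>x. e j x + (\<Sum>l<j. a j l * e l x)) = 0"
      unfolding f_def .
  qed
qed

end

text \<open>Increments above 1 at every index from \<open>L\<close> on would force a slope of at
  least 1. The free choice of \<open>L\<close> lets the scale be large in terms of the
  family.\<close>

lemma good_scale_exists:
  fixes \<Phi> :: "nat \<Rightarrow> real"
  assumes "\<And>l. \<Phi> l \<le> \<kappa> * real l + \<gamma>" "\<kappa> < 1"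
  obtains l where "l \<ge> L" "\<Phi> (Suc l) - \<Phi> l \<le> 1"
proof -
  have "\<exists>l\<ge>L. \<Phi> (Suc l) - \<Phi> l \<le> 1"
  proof (rule ccontr)
    assume "\<not> (\<exists>l\<ge>L. \<Phi> (Suc l) - \<Phi> l \<le> 1)"
    then have step: "\<Phi> (Suc l) - \<Phi> l > 1" if "l \<ge> L" for l using that by force
    have grow: "\<Phi> (L + n) \<ge> \<Phi> L + real n" for n
    proof (induction n)
      case (Suc n) then show ?case using step[of "L + n"] by simp
    qed simp
    define n where "n = nat \<lceil>(\<kappa> * real L + \<gamma> - \<Phi> L) / (1 - \<kappa>)\<rceil> + 1"
    have "real n > (\<kappa> * real L + \<gamma> - \<Phi> L) / (1 - \<kappa>)" unfolding n_def by linarith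
    then have "real n * (1 - \<kappa>) > \<kappa> * real L + \<gamma> - \<Phi> L" using assms(2) by (simp add: field_simps)
    then show False using grow[of n] assms(1)[of "L + n"] by (simp add: algebra_simps)
  qed
  then show ?thesis using that by blast
qed

text \<open>Jensen's inequality, by the tangent of the exponential at \<open>- b\<close>. It
  converts a bound on the logarithm of a determinant ratio into a lower bound for a trace.\<close>

lemma sum_exp_ge:
  fixes x :: "nat \<Rightarrow> real"
  assumes "(\<Sum>i<n. x i) \<le> real n * b"
  shows "(\<Sum>i<n. exp (- x i)) \<ge> real n * exp (- b)"
proof -
  have "exp (- b) * (1 + b - x i) \<le> exp (- x i)" for i
  proof -
    have "exp (- b) * (1 + (b - x i)) \<le> exp (- b) * exp (b - x i)"
      by (intro mult_left_mono exp_ge_add_one_self) simp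
    also have "\<dots> = exp (- x i)" by (simp add: mult_exp_exp)
    finally show ?thesis by (simp only: add_diff_eq)
  qed
  then have "(\<Sum>i<n. exp (- b) * (1 + b - x i)) \<le> (\<Sum>i<n. exp (- x i))" by (intro sum_mono)
  also have "(\<Sum>i<n. exp (- b) * (1 + b - x i)) = exp (- b) * (\<Sum>i<n. 1 + b - x i)"
    by (simp only: sum_distrib_left)
  also have "(\<Sum>i<n. 1 + b - x i) = real n + real n * b - (\<Sum>i<n. x i)"
    by (simp add: sum_subtractf algebra_simps)
  finally have "exp (- b) * (real n + real n * b - (\<Sum>i<n. x i)) \<le> (\<Sum>i<n. exp (- x i))" .
  moreover have "exp (- b) * real n \<le> exp (- b) * (real n + real n * b - (\<Sum>i<n. x i))"
    using assms by (intro mult_left_mono) auto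
  ultimately have "exp (- b) * real n \<le> (\<Sum>i<n. exp (- x i))" by linarith
  then show ?thesis by (simp add: mult.commute)
qed

section \<open>The L2 forms on balls\<close>

context haar_growth
begin

text \<open>Measurable rather than continuous functions, because the vector fed into Bessel's
  inequality in \<open>sum_ball_average_le\<close> contains the indicator of a ball.\<close>

definition L2_ball :: "nat \<Rightarrow> ('a \<Rightarrow> complex) set" where
  "L2_ball R = {f. f \<in> borel_measurable borel \<and> integrable m (\<lambda>x. indicator (B R) x * (cmod (f x))\<^sup>2)}"

definition ball_ip :: "nat \<Rightarrow> ('a \<Rightarrow> complex) \<Rightarrow> ('a \<Rightarrow> complex) \<Rightarrow> complex" where
  "ball_ip R f g = (\<integral>x. indicator (B R) x *\<^sub>R (f x * cnj (g x)) \<partial>m)"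

lemma integrable_ball_ip:
  assumes "f \<in> L2_ball R" "g \<in> L2_ball R"
  shows "integrable m (\<lambda>x. indicator (B R) x *\<^sub>R (f x * cnj (g x)))"
proof (rule Bochner_Integration.integrable_bound)
  show "integrable m (\<lambda>x. indicator (B R) x * (cmod (f x))\<^sup>2 + indicator (B R) x * (cmod (g x))\<^sup>2)"
    using assms unfolding L2_ball_def by auto
  have [measurable]: "f \<in> borel_measurable borel" "g \<in> borel_measurable borel"
    using assms unfolding L2_ball_def by auto
  show "(\<lambda>x. indicator (B R) x *\<^sub>R (f x * cnj (g x))) \<in> borel_measurable m"
    using borel_measurable_continuous_onI[of cnj] by (auto intro!: continuous_intros borel_measurable_scaleR borel_measurable_times measurable_compose[of g borel borel cnj])
  have "norm (indicator (B R) x *\<^sub>R (f x * cnj (g x)))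
      \<le> norm (indicator (B R) x * (cmod (f x))\<^sup>2 + indicator (B R) x * (cmod (g x))\<^sup>2)" for x
    using sum_squares_bound[of "cmod (f x)" "cmod (g x)"] mult_nonneg_nonneg[of "cmod (f x)" "cmod (g x)"]
    by (cases "x \<in> B R") (auto simp: norm_mult simp del: mult_nonneg_nonneg)
  then show "AE x in m. norm (indicator (B R) x *\<^sub>R (f x * cnj (g x)))
      \<le> norm (indicator (B R) x * (cmod (f x))\<^sup>2 + indicator (B R) x * (cmod (g x))\<^sup>2)" by simp
qed

lemma ball_hermitian: "hermitian_form (L2_ball R) (ball_ip R)"
proof
  show "(\<lambda>x. 0) \<in> L2_ball R" unfolding L2_ball_def by simp
  fix f g h :: "'a \<Rightarrow> complex" and c
  assume f: "f \<in> L2_ball R"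
  then have [measurable]: "f \<in> borel_measurable borel" unfolding L2_ball_def by simp
  show "(\<lambda>x. c * f x) \<in> L2_ball R"
  proof -
    have "indicator (B R) x * (cmod (c * f x))\<^sup>2 = (cmod c)\<^sup>2 * (indicator (B R) x * (cmod (f x))\<^sup>2)" for x
      by (simp add: norm_mult power_mult_distrib)
    note eq = this
    show ?thesis using f unfolding L2_ball_def mem_Collect_eq eq by auto
  qed
  have "ball_ip R f f = (\<integral>x. complex_of_real (indicator (B R) x * (cmod (f x))\<^sup>2) \<partial>m)"
    unfolding ball_ip_def by (intro Bochner_Integration.integral_cong refl)
      (simp add: scaleR_conv_of_real complex_norm_square[symmetric])
  then show "0 \<le> Re (ball_ip R f f)" by (simp only: integral_complex_of_real Re_complex_of_real) simp
  { assume g: "g \<in> L2_ball R"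
    then have [measurable]: "g \<in> borel_measurable borel" unfolding L2_ball_def by simp
    have "integrable m (\<lambda>x. 2 * (indicator (B R) x * (cmod (f x))\<^sup>2) + 2 * (indicator (B R) x * (cmod (g x))\<^sup>2))"
      using f g unfolding L2_ball_def by auto
    then have "integrable m (\<lambda>x. indicator (B R) x * (cmod (f x + g x))\<^sup>2)"
    proof (rule Bochner_Integration.integrable_bound)
      have "norm (indicator (B R) x * (cmod (f x + g x))\<^sup>2)
          \<le> norm (2 * (indicator (B R) x * (cmod (f x))\<^sup>2) + 2 * (indicator (B R) x * (cmod (g x))\<^sup>2))" for x
        using norm_add_square_le[of 1 "f x" "g x"] by (cases "x \<in> B R") auto
      then show "AE x in m. norm (indicator (B R) x * (cmod (f x + g x))\<^sup>2)
          \<le> norm (2 * (indicator (B R) x * (cmod (f x))\<^sup>2) + 2 * (indicator (B R) x * (cmod (g x))\<^sup>2))" by simp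
    qed measurable
    then show "(\<lambda>x. f x + g x) \<in> L2_ball R" unfolding L2_ball_def by simp
    assume h: "h \<in> L2_ball R"
    show "ball_ip R (\<lambda>x. f x + g x) h = ball_ip R f h + ball_ip R g h"
      unfolding ball_ip_def using integrable_ball_ip[OF f h] integrable_ball_ip[OF g h]
      by (simp add: distrib_right scaleR_add_right) }
  assume h: "h \<in> L2_ball R"
  show "ball_ip R (\<lambda>x. c * f x) h = c * ball_ip R f h"
    unfolding ball_ip_def by (simp add: mult.assoc flip: integral_mult_right_zero)
  show "ball_ip R h f = cnj (ball_ip R f h)"
    unfolding ball_ip_def by (subst Bochner_Integration.integral_cnj[symmetric]) (simp add: mult.commute)
qed

lemma continuous_L2_ball: "continuous_on UNIV f \<Longrightarrow> f \<in> L2_ball R"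
  unfolding L2_ball_def using integrable_ball_energy borel_measurable_continuous_onI by blast

lemma ball_sq:
  shows "hermitian_form.sq (ball_ip R) f = ball_energy R f"
proof -
  have "ball_ip R f f = (\<integral>x. complex_of_real (indicator (B R) x * (cmod (f x))\<^sup>2) \<partial>m)"
    unfolding ball_ip_def by (intro Bochner_Integration.integral_cong refl)
      (simp add: scaleR_conv_of_real complex_norm_square[symmetric])
  then show ?thesis
    unfolding hermitian_form.sq_def[OF ball_hermitian] ball_energy_def by (simp only: integral_complex_of_real Re_complex_of_real)
qed

end

section \<open>The trace estimate\<close>

context haar_growth
begin

lemma ball_energy_add_le:
  assumes "continuous_on UNIV f" "continuous_on UNIV g"
  shows "ball_energy R (\<lambda>x. f x + g x) \<le> 2 * ball_energy R f + 2 * ball_energy R g"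
proof -
  note i = integrable_ball_energy[of _ R]
  have "ball_energy R (\<lambda>x. f x + g x)
      \<le> (\<integral>x. 2 * (indicator (B R) x * (cmod (f x))\<^sup>2) + 2 * (indicator (B R) x * (cmod (g x))\<^sup>2) \<partial>m)"
    unfolding ball_energy_def
  proof (rule integral_mono)
    show "integrable m (\<lambda>x. indicator (B R) x * (cmod (f x + g x))\<^sup>2)"
      by (intro i continuous_intros assms)
    show "integrable m (\<lambda>x. 2 * (indicator (B R) x * (cmod (f x))\<^sup>2) + 2 * (indicator (B R) x * (cmod (g x))\<^sup>2))"
      using i[OF assms(1)] i[OF assms(2)] by simp
    show "indicator (B R) x * (cmod (f x + g x))\<^sup>2
        \<le> 2 * (indicator (B R) x * (cmod (f x))\<^sup>2) + 2 * (indicator (B R) x * (cmod (g x))\<^sup>2)" for x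
      using norm_add_square_le[of 1 "f x" "g x"] by (cases "x \<in> B R") auto
  qed
  also have "\<dots> = 2 * ball_energy R f + 2 * ball_energy R g"
    unfolding ball_energy_def using i[OF assms(1)] i[OF assms(2)] by simp
  finally show ?thesis .
qed

lemma ball_energy_le_nn_integral:
  assumes "continuous_on UNIV h" "(\<integral>\<^sup>+x. ennreal ((cmod (h x))\<^sup>2) \<partial>m) \<le> ennreal K" "K \<ge> 0"
  shows "ball_energy R h \<le> K"
proof -
  have "ennreal (ball_energy R h) = (\<integral>\<^sup>+x. ennreal (indicator (B R) x * (cmod (h x))\<^sup>2) \<partial>m)"
    unfolding ball_energy_def by (rule nn_integral_eq_integral[symmetric]) (auto intro: integrable_ball_energy assms)
  also have "\<dots> \<le> (\<integral>\<^sup>+x. ennreal ((cmod (h x))\<^sup>2) \<partial>m)"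
    by (intro nn_integral_mono ennreal_leI) (auto simp: indicator_def)
  also have "\<dots> \<le> ennreal K" by (rule assms(2))
  finally show ?thesis using assms(3) by (simp add: ennreal_le_iff)
qed

text \<open>
  At a point \<open>x\<close>, the averages of \<open>\<eta> \<cdot> \<phi> i\<close> are the Fourier coefficients of one fixed function of small norm,
  hence Bessel's inequality bounds them independently of the number of functions.
\<close>

lemma sum_ball_average_le:
  fixes D :: nat
  assumes \<phi>: "\<And>i. i < D \<Longrightarrow> continuous_on UNIV (\<phi> i)"
    and on: "\<And>i j. i < D \<Longrightarrow> j < D \<Longrightarrow> ball_ip (4 * R) (\<phi> i) (\<phi> j) = (if i = j then 1 else 0)"
    and r: "1 \<le> r" and \<eta>: "cutoff R \<eta>"
  shows "(\<Sum>i<D. (cmod (ball_average r (\<lambda>x. complex_of_real (\<eta> x) * \<phi> i x) x))\<^sup>2) \<le> 1 / vol r"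
proof -
  interpret H: hermitian_form "L2_ball (4 * R)" "ball_ip (4 * R)" by (rule ball_hermitian)
  have V: "vol r > 0" using B_measure_ge_1[OF r] by simp
  have \<eta>c: "continuous_on UNIV \<eta>" and \<eta>01: "\<And>x. 0 \<le> \<eta> x" "\<And>x. \<eta> x \<le> 1"
    and \<eta>0: "\<And>x. x \<notin> B (3 * R) \<Longrightarrow> \<eta> x = 0"
    using \<eta> unfolding cutoff_def by auto
  have \<eta>4: "\<eta> y = 0" if "y \<notin> B (4 * R)" for y using that B_mono[of "3 * R" "4 * R"] by (intro \<eta>0) auto
  have [measurable]: "\<eta> \<in> borel_measurable borel" using \<eta>c by (rule borel_measurable_continuous_onI)
  have Im: "(\<lambda>y. indicator (B r) (- x + y) :: real) \<in> borel_measurable borel"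
    by (rule measurable_translation(1)) measurable
  note [measurable] = Im
  \<comment> \<open>With the cutoff moved into this function, the average is a multiple of the
    pairing of \<open>\<phi> i\<close> itself with \<open>\<psi>\<close>. Restricting that pairing
    to radius \<open>4 * R\<close> loses nothing, as \<open>\<eta>\<close> vanishes outside.\<close>
  define \<psi> where "\<psi> y = complex_of_real (indicator (B r) (- x + y) * \<eta> y)" for y
  have \<psi>m [measurable]: "\<psi> \<in> borel_measurable borel" unfolding \<psi>_def by measurable
  have \<psi>le: "(cmod (\<psi> y))\<^sup>2 \<le> indicator (B r) (- x + y)" for y
    unfolding \<psi>_def using \<eta>01[of y] by (cases "- x + y \<in> B r") (auto simp: power_le_one)
  have Iint: "integrable m (\<lambda>y. indicator (B r) (- x + y) :: real)" "(\<integral>y. indicator (B r) (- x + y) \<partial>m) = vol r"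
    using integral_left[of "indicator (B r) :: 'a \<Rightarrow> real" "- x"] finite_B[of r] by auto
  have \<psi>I: "integrable m (\<lambda>y. indicator (B (4 * R)) y * (cmod (\<psi> y))\<^sup>2)"
  proof (rule Bochner_Integration.integrable_bound[OF Iint(1)])
    have "norm (indicator (B (4 * R)) y * (cmod (\<psi> y))\<^sup>2) \<le> norm (indicator (B r) (- x + y) :: real)" for y
      using \<psi>le[of y] by (cases "y \<in> B (4 * R)") auto
    then show "AE y in m. norm (indicator (B (4 * R)) y * (cmod (\<psi> y))\<^sup>2) \<le> norm (indicator (B r) (- x + y) :: real)"
      by simp
  qed measurable
  then have \<psi>L: "\<psi> \<in> L2_ball (4 * R)" unfolding L2_ball_def using \<psi>m by simp
  have "H.sq \<psi> \<le> vol r"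
    unfolding ball_sq ball_energy_def Iint(2)[symmetric]
  proof (rule integral_mono[OF \<psi>I Iint(1)])
    show "indicator (B (4 * R)) y * (cmod (\<psi> y))\<^sup>2 \<le> indicator (B r) (- x + y)" for y
      using \<psi>le[of y] by (cases "y \<in> B (4 * R)") auto
  qed
  moreover have "(\<Sum>i<D. (cmod (ball_ip (4 * R) (\<phi> i) \<psi>))\<^sup>2) \<le> H.sq \<psi>"
    using H.Bessel[of D \<phi> \<psi>, OF continuous_L2_ball[OF \<phi>] \<psi>L on] by blast
  ultimately have sum_le: "(\<Sum>i<D. (cmod (ball_ip (4 * R) (\<phi> i) \<psi>))\<^sup>2) \<le> vol r" by linarith
  have avg: "ball_average r (\<lambda>x. complex_of_real (\<eta> x) * \<phi> i x) x = (1 / vol r) *\<^sub>R ball_ip (4 * R) (\<phi> i) \<psi>" if "i < D" for i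
  proof -
    have [measurable]: "\<phi> i \<in> borel_measurable borel" using \<phi>[OF that] by (rule borel_measurable_continuous_onI)
    let ?h = "\<lambda>y. indicator (B r) (- x + y) *\<^sub>R (complex_of_real (\<eta> y) * \<phi> i y)"
    have "(\<integral>s. indicator (B r) s *\<^sub>R (complex_of_real (\<eta> (x + s)) * \<phi> i (x + s)) \<partial>m) = (\<integral>s. ?h (x + s) \<partial>m)"
      by (simp add: add.assoc[symmetric])
    also have "\<dots> = (\<integral>y. ?h y \<partial>m)" by (rule integral_left(1)) measurable
    also have "\<dots> = ball_ip (4 * R) (\<phi> i) \<psi>"
      unfolding ball_ip_def
    proof (intro Bochner_Integration.integral_cong refl)
      show "?h y = indicator (B (4 * R)) y *\<^sub>R (\<phi> i y * cnj (\<psi> y))" for y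
        using \<eta>4[of y] unfolding \<psi>_def by (cases "y \<in> B (4 * R)") (auto simp: scaleR_conv_of_real)
    qed
    finally show ?thesis unfolding ball_average_def by simp
  qed
  have "(\<Sum>i<D. (cmod (ball_average r (\<lambda>x. complex_of_real (\<eta> x) * \<phi> i x) x))\<^sup>2)
      = (\<Sum>i<D. (1 / vol r)\<^sup>2 * (cmod (ball_ip (4 * R) (\<phi> i) \<psi>))\<^sup>2)"
    using V by (intro sum.cong refl) (simp add: avg power_mult_distrib power_divide)
  also have "\<dots> = (1 / vol r)\<^sup>2 * (\<Sum>i<D. (cmod (ball_ip (4 * R) (\<phi> i) \<psi>))\<^sup>2)"
    by (rule sum_distrib_left[symmetric])
  also have "\<dots> \<le> (1 / vol r)\<^sup>2 * vol r" using sum_le by (intro mult_left_mono) auto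
  also have "\<dots> = 1 / vol r" using V by (simp add: power2_eq_square)
  finally show ?thesis .
qed

end

context courteous_walk
begin

text \<open>The sum is a trace: the form of radius \<open>R\<close> evaluated on a basis orthonormal
  for radius \<open>4 * R\<close>. The constants precede the family, so they depend neither on
  \<open>D\<close> and \<open>C\<close> nor on the radii, and the volume term carries no factor
  \<open>D\<close>, which is what finally bounds \<open>D\<close>.\<close>

lemma trace_bound:
  obtains Q Q' where "Q \<ge> 0" "Q' \<ge> 0"
    "\<And>\<phi> C R r D. (\<And>i. i < D \<Longrightarrow> \<phi> i \<in> HF S \<mu> k) \<Longrightarrow> (\<And>i. i < D \<Longrightarrow> growth_bound k C (\<phi> i)) \<Longrightarrow>
      (\<And>i j. i < D \<Longrightarrow> j < D \<Longrightarrow> ball_ip (4 * R) (\<phi> i) (\<phi> j) = (if i = j then 1 else 0)) \<Longrightarrow>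
      1 \<le> r \<Longrightarrow> r \<le> R \<Longrightarrow>
      (\<Sum>i<D. ball_energy R (\<phi> i))
        \<le> 2 * (vol R / vol r) + real D * ((real r)\<^sup>2 * (Q / (real R)\<^sup>2 + Q' * C\<^sup>2 / (real R) ^ 3))"
proof -
  obtain K where K: "K \<ge> 0"
    "\<And>g s. continuous_on UNIV g \<Longrightarrow> shift_energy g s \<le> ennreal (K * (real (len s))\<^sup>2) * energy g"
    using shift_energy_bound by blast
  obtain M c where Mc: "M \<ge> 0" "c \<ge> 0"
    "\<And>f C R \<eta>. f \<in> HF S \<mu> k \<Longrightarrow> growth_bound k C f \<Longrightarrow> R \<ge> 1 \<Longrightarrow> cutoff R \<eta> \<Longrightarrow>
      energy (\<lambda>x. complex_of_real (\<eta> x) * f x) \<le> ennreal (M / (real R)\<^sup>2 * ball_energy (4 * R) f + c * C\<^sup>2 / (real R) ^ 3)"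
    using Caccioppoli[of k] by blast
  have main: "(\<Sum>i<D. ball_energy R (\<phi> i))
        \<le> 2 * (vol R / vol r) + real D * ((real r)\<^sup>2 * ((2 * K * M) / (real R)\<^sup>2 + (2 * K * c) * C\<^sup>2 / (real R) ^ 3))"
    if \<phi>: "\<And>i. i < D \<Longrightarrow> \<phi> i \<in> HF S \<mu> k" and C: "\<And>i. i < D \<Longrightarrow> growth_bound k C (\<phi> i)"
      and on: "\<And>i j. i < D \<Longrightarrow> j < D \<Longrightarrow> ball_ip (4 * R) (\<phi> i) (\<phi> j) = (if i = j then 1 else 0)"
      and r: "1 \<le> r" "r \<le> R" for \<phi> C R r D
  proof -
    have R: "R \<ge> 1" using r by simp
    obtain \<eta> where \<eta>: "cutoff R \<eta>" using cutoff_exists[OF R] by blast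
    have \<eta>c: "continuous_on UNIV \<eta>" and \<eta>1: "\<And>x. x \<in> B R \<Longrightarrow> \<eta> x = 1"
      using \<eta> unfolding cutoff_def by auto
    have \<phi>c: "continuous_on UNIV (\<phi> i)" if "i < D" for i using HF_continuous[OF \<phi>[OF that]] .
    define g where "g i = (\<lambda>x. complex_of_real (\<eta> x) * \<phi> i x)" for i
    have gc: "continuous_on UNIV (g i)" if "i < D" for i
      unfolding g_def using \<phi>c[OF that] \<eta>c by (intro continuous_intros)
    define A where "A i = ball_average r (g i)" for i
    have Ac: "continuous_on UNIV (A i)" if "i < D" for i
      unfolding A_def by (rule ball_average_continuous[OF gc[OF that]])
    define E where "E = K * (real r)\<^sup>2 * (M / (real R)\<^sup>2 + c * C\<^sup>2 / (real R) ^ 3)"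
    have E0: "E \<ge> 0" unfolding E_def using K(1) Mc by simp
    \<comment> \<open>On \<open>B R\<close> the cutoff is 1, so \<open>\<phi> i\<close> equals
      \<open>g i\<close> there, which is split into its average and the deviation from it.\<close>
    have each: "ball_energy R (\<phi> i) \<le> 2 * ball_energy R (A i) + 2 * E" if i: "i < D" for i
    proof -
      have eq: "indicator (B R) x * (cmod (\<phi> i x))\<^sup>2 = indicator (B R) x * (cmod (g i x))\<^sup>2" for x
        unfolding g_def using \<eta>1[of x] by (cases "x \<in> B R") auto
      have "ball_energy R (\<phi> i) = ball_energy R (\<lambda>x. A i x + (g i x - A i x))"
        unfolding ball_energy_def eq by simp
      also have "\<dots> \<le> 2 * ball_energy R (A i) + 2 * ball_energy R (\<lambda>x. g i x - A i x)"
        using gc[OF i] Ac[OF i] by (intro ball_energy_add_le continuous_intros)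
      also have "ball_energy R (\<lambda>x. g i x - A i x) \<le> E"
      proof (rule ball_energy_le_nn_integral[OF _ _ E0])
        show "continuous_on UNIV (\<lambda>x. g i x - A i x)" using gc[OF i] Ac[OF i] by (intro continuous_intros)
        \<comment> \<open>Normalisation at radius \<open>4 * R\<close> removes
          \<open>\<phi> i\<close> from the main term of the Caccioppoli inequality.\<close>
        have "ball_energy (4 * R) (\<phi> i) = 1"
          using on[OF i i] hermitian_form.sq_def[OF ball_hermitian, of "4 * R" "\<phi> i"] ball_sq[of "4 * R" "\<phi> i"] by simp
        then have en: "energy (g i) \<le> ennreal (M / (real R)\<^sup>2 + c * C\<^sup>2 / (real R) ^ 3)"
          using Mc(3)[OF \<phi>[OF i] C[OF i] R \<eta>] unfolding g_def by simp
        have "(\<integral>\<^sup>+x. ennreal ((cmod (g i x - A i x))\<^sup>2) \<partial>m) \<le> ennreal (K * (real r)\<^sup>2) * energy (g i)"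
          unfolding A_def
        proof (rule ball_average_deviation_integral[OF gc[OF i] r(1)])
          fix s assume "s \<in> B r"
          then have "K * (real (len s))\<^sup>2 \<le> K * (real r)\<^sup>2"
            using K(1) by (intro mult_left_mono power_mono) (auto simp: in_B_iff)
          then have "ennreal (K * (real (len s))\<^sup>2) * energy (g i) \<le> ennreal (K * (real r)\<^sup>2) * energy (g i)"
            by (intro mult_right_mono ennreal_leI) auto
          then show "shift_energy (g i) s \<le> ennreal (K * (real r)\<^sup>2) * energy (g i)"
            using K(2)[OF gc[OF i], of s] by (rule order_trans[rotated])
        qed
        also have "\<dots> \<le> ennreal (K * (real r)\<^sup>2) * ennreal (M / (real R)\<^sup>2 + c * C\<^sup>2 / (real R) ^ 3)"
          using en by (intro mult_left_mono) auto
        also have "\<dots> = ennreal E"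
          unfolding E_def using K(1) Mc by (intro ennreal_mult[symmetric]) auto
        finally show "(\<integral>\<^sup>+x. ennreal ((cmod (g i x - A i x))\<^sup>2) \<partial>m) \<le> ennreal E" .
      qed
      finally show ?thesis by simp
    qed
    have "(\<Sum>i<D. ball_energy R (A i)) = (\<integral>x. (\<Sum>i<D. indicator (B R) x * (cmod (A i x))\<^sup>2) \<partial>m)"
      unfolding ball_energy_def using Ac
      by (intro Bochner_Integration.integral_sum[symmetric] integrable_ball_energy) auto
    also have "\<dots> \<le> (\<integral>x. 1 / vol r * indicator (B R) x \<partial>m)"
    proof (rule integral_mono)
      show "integrable m (\<lambda>x. \<Sum>i<D. indicator (B R) x * (cmod (A i x))\<^sup>2)"
        using Ac by (intro Bochner_Integration.integrable_sum integrable_ball_energy) auto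
      show "integrable m (\<lambda>x. 1 / vol r * indicator (B R) x)" using finite_B[of R] by simp
      fix x
      have "(\<Sum>i<D. (cmod (A i x))\<^sup>2) \<le> 1 / vol r"
        unfolding A_def g_def by (rule sum_ball_average_le[OF \<phi>c on r(1) \<eta>])
      then show "(\<Sum>i<D. indicator (B R) x * (cmod (A i x))\<^sup>2) \<le> 1 / vol r * indicator (B R) x"
        by (cases "x \<in> B R") auto
    qed
    also have "\<dots> = vol R / vol r" using finite_B[of R] by simp
    finally have sumA: "(\<Sum>i<D. ball_energy R (A i)) \<le> vol R / vol r" .
    have "(\<Sum>i<D. ball_energy R (\<phi> i)) \<le> (\<Sum>i<D. 2 * ball_energy R (A i) + 2 * E)"
      using each by (intro sum_mono) auto
    also have "\<dots> = 2 * (\<Sum>i<D. ball_energy R (A i)) + real D * (2 * E)"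
      by (simp add: sum.distrib sum_distrib_left)
    also have "\<dots> \<le> 2 * (vol R / vol r) + real D * (2 * E)" using sumA by simp
    also have "2 * E = (real r)\<^sup>2 * ((2 * K * M) / (real R)\<^sup>2 + (2 * K * c) * C\<^sup>2 / (real R) ^ 3)"
      unfolding E_def by (simp add: algebra_simps)
    finally show ?thesis .
  qed
  show ?thesis by (rule that[of "2 * K * M" "2 * K * c", OF _ _ main]) (use K(1) Mc in auto)
qed

end

section \<open>The dimension bound\<close>

context courteous_walk
begin

lemma HF_sum: "(\<And>i. i \<in> I \<Longrightarrow> e i \<in> HF S \<mu> k) \<Longrightarrow> (\<lambda>x. \<Sum>i\<in>I. c i * e i x) \<in> HF S \<mu> k"
proof (induction I rule: infinite_finite_induct)
  case (insert i I)
  then show ?case using HF_add[OF HF_scale[of "e i" k "c i"] insert.IH] by simp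
qed (simp_all add: HF_zero)

lemma growth_bound_weaken: "growth_bound k C f \<Longrightarrow> C \<le> C' \<Longrightarrow> growth_bound k C' f"
  unfolding growth_bound_def by (meson mult_right_mono order_trans zero_le_power add_nonneg_nonneg of_nat_0_le_iff zero_le_one)

text \<open>Controls the growth constant of vectors constructed at later scales by data of the
  initial family: orthonormality at one fixed radius bounds the coefficients by the mass
  there.\<close>

lemma orthonormal_coefficients_growth:
  fixes e :: "nat \<Rightarrow> 'a \<Rightarrow> complex"
  assumes e: "\<And>i. i < n \<Longrightarrow> e i \<in> HF S \<mu> k" "\<And>i. i < n \<Longrightarrow> growth_bound k C (e i)" "C \<ge> 0"
    and on: "\<And>i j. i < n \<Longrightarrow> j < n \<Longrightarrow> ball_ip R (e i) (e j) = (if i = j then 1 else 0)"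
    and T: "ball_energy R (\<lambda>x. \<Sum>i<n. c i * e i x) \<le> T"
  shows "growth_bound k (real n * C * sqrt T) (\<lambda>x. \<Sum>i<n. c i * e i x)"
  unfolding growth_bound_def
proof
  fix x
  interpret H: hermitian_form "L2_ball R" "ball_ip R" by (rule ball_hermitian)
  have eV: "e i \<in> L2_ball R" if "i < n" for i
    using HF_continuous[OF e(1)[OF that]] by (rule continuous_L2_ball)
  have "(\<Sum>i<n. (cmod (c i))\<^sup>2) = H.sq (\<lambda>x. \<Sum>i<n. c i * e i x)"
    by (rule H.sq_orthonormal_sum[symmetric, OF eV on])
  also have "\<dots> \<le> T" using T unfolding ball_sq .
  finally have sum_le: "(\<Sum>i<n. (cmod (c i))\<^sup>2) \<le> T" .
  have c: "cmod (c i) \<le> sqrt T" if "i < n" for i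
  proof -
    have "(cmod (c i))\<^sup>2 \<le> (\<Sum>i<n. (cmod (c i))\<^sup>2)" using that by (intro member_le_sum) auto
    then show ?thesis using sum_le by (intro real_le_rsqrt) simp
  qed
  have "cmod (\<Sum>i<n. c i * e i x) \<le> (\<Sum>i<n. cmod (c i) * cmod (e i x))"
    by (rule order_trans[OF norm_sum]) (simp add: norm_mult)
  also have "\<dots> \<le> (\<Sum>i<n. sqrt T * (C * (1 + real (len x)) ^ k))"
  proof (rule sum_mono)
    fix i assume "i \<in> {..<n}"
    then have i: "i < n" by simp
    have "0 \<le> sqrt T" using c[OF i] norm_ge_zero order_trans by blast
    then show "cmod (c i) * cmod (e i x) \<le> sqrt T * (C * (1 + real (len x)) ^ k)"
      using c[OF i] growth_boundD[OF e(2)[OF i], of x] by (intro mult_mono) auto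
  qed
  also have "\<dots> = real n * C * sqrt T * (1 + real (len x)) ^ k" by simp
  finally show "cmod (\<Sum>i<n. c i * e i x) \<le> real n * C * sqrt T * (1 + real (len x)) ^ k" .
qed

text \<open>The bound must not depend on the family or on its starting radius, so \<open>b\<close>,
  \<open>p\<close> and \<open>a\<close> are fixed, in this order, before any family is
  considered.\<close>

lemma orthonormal_family_bound:
  obtains N :: real where "\<And>(e :: nat \<Rightarrow> 'a \<Rightarrow> complex) D j0. (\<And>i. i < D \<Longrightarrow> e i \<in> HF S \<mu> k) \<Longrightarrow>
    (\<And>i j. i < D \<Longrightarrow> j < D \<Longrightarrow> ball_ip (4 ^ j0) (e i) (e j) = (if i = j then 1 else 0)) \<Longrightarrow> real D \<le> N"
proof -
  obtain Q Q' where Q: "Q \<ge> 0" "Q' \<ge> 0"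
    "\<And>\<phi> C R r D. (\<And>i. i < D \<Longrightarrow> \<phi> i \<in> HF S \<mu> k) \<Longrightarrow> (\<And>i. i < D \<Longrightarrow> growth_bound k C (\<phi> i)) \<Longrightarrow>
      (\<And>i j. i < D \<Longrightarrow> j < D \<Longrightarrow> ball_ip (4 * R) (\<phi> i) (\<phi> j) = (if i = j then 1 else 0)) \<Longrightarrow>
      1 \<le> r \<Longrightarrow> r \<le> R \<Longrightarrow>
      (\<Sum>i<D. ball_energy R (\<phi> i))
        \<le> 2 * (vol R / vol r) + real D * ((real r)\<^sup>2 * (Q / (real R)\<^sup>2 + Q' * C\<^sup>2 / (real R) ^ 3))"
    using trace_bound[of k] by blast
  obtain c0 d where c0: "c0 > 0" "\<And>n. vol n \<le> c0 * (real n + 1) ^ d" using growthE by blast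
  define q where "q = 2 * k + d"
  define LN :: real where "LN = ln 4"
  have LN: "LN > 0" unfolding LN_def by simp
  \<comment> \<open>Allowed increase per scale of the averaged logarithm of the Gram determinant.
    That quantity has slope at most \<open>real q * LN\<close>, so the factor 4 limits its share of
    the slope of \<open>\<Phi>\<close> to 1/4; the \<open>+ 1\<close> keeps \<open>b\<close>
    positive.\<close>
  define b where "b = 4 * real q * LN + 1"
  have b: "b > 0" unfolding b_def using LN by (simp add: add_nonneg_pos)
  \<comment> \<open>The averaging radius will be \<open>R\<close> divided by \<open>4 ^ p\<close>,
    so the squared ratio is \<open>(1 / 16) ^ p\<close>; this choice makes the main energy term at
    most a quarter of \<open>exp (- b)\<close>.\<close>
  obtain p where p: "(1 / 16) ^ p < exp (- b) / (4 * (Q + 1))"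
    using real_arch_pow_inv[of "exp (- b) / (4 * (Q + 1))" "1 / 16"] Q(1) by auto
  \<comment> \<open>Allowed logarithm of the volume ratio across \<open>p\<close> scales, again with
    a share of 1/4 of the slope.\<close>
  define a where "a = 4 * real p * real d * LN + 1"
  have a: "a > 0" unfolding a_def using LN by (simp add: add_nonneg_pos)
  have main: "real D \<le> 4 * exp a * exp b"
    if e: "\<And>i. i < D \<Longrightarrow> e i \<in> HF S \<mu> k"
      and on: "\<And>i j. i < D \<Longrightarrow> j < D \<Longrightarrow> ball_ip (4 ^ j0) (e i) (e j) = (if i = j then 1 else 0)"
    for e :: "nat \<Rightarrow> 'a \<Rightarrow> complex" and D j0
  proof (cases "D = 0")
    case False
    then have D: "real D > 0" by simp
    have "\<exists>C. growth_bound k C (e i)" if "i < D" for i using HF_growth_bound[OF e[OF that]] .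
    then obtain Ci where Ci: "\<And>i. i < D \<Longrightarrow> growth_bound k (Ci i) (e i)" by metis
    define C where "C = (\<Sum>i<D. Ci i) + 1"
    have "0 \<le> (\<Sum>i<D. Ci i)" using growth_bound_nonneg[OF Ci] by (intro sum_nonneg) auto
    then have C1: "C \<ge> 1" unfolding C_def by simp
    have C: "growth_bound k C (e i)" if "i < D" for i
    proof (rule growth_bound_weaken[OF Ci[OF that]])
      have "Ci i \<le> (\<Sum>i<D. Ci i)" using that growth_bound_nonneg[OF Ci] by (intro member_le_sum) auto
      then show "Ci i \<le> C" unfolding C_def by simp
    qed
    have ec: "continuous_on UNIV (e i)" if "i < D" for i using HF_continuous[OF e[OF that]] .
    \<comment> \<open>The leading coefficient is 1, so orthonormality at radius
      \<open>4 ^ j0\<close> gives mass at least 1 there and at all larger radii, whatever the other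
      coefficients are.\<close>
    define comb where "comb i b = (\<lambda>x. e i x + (\<Sum>j<i. b j * e j x))" for i and b :: "nat \<Rightarrow> complex"
    have comb_alt: "comb i b = (\<lambda>x. \<Sum>j<Suc i. (b(i := 1)) j * e j x)" for i b
      unfolding comb_def by (auto intro!: ext sum.cong)
    have combHF: "comb i b \<in> HF S \<mu> k" if "i < D" for i b
      unfolding comb_alt using e that by (intro HF_sum) auto
    have combc: "continuous_on UNIV (comb i b)" if "i < D" for i b using HF_continuous[OF combHF[OF that]] .
    have comb_ge1: "ball_energy (4 ^ j) (comb i b) \<ge> 1" if "i < D" "j \<ge> j0" for i j b
    proof -
      interpret H: hermitian_form "L2_ball (4 ^ j0)" "ball_ip (4 ^ j0)" by (rule ball_hermitian)
      have "H.sq (comb i b) = (\<Sum>j<Suc i. (cmod ((b(i := 1)) j))\<^sup>2)"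
        unfolding comb_alt using that(1) ec on by (intro H.sq_orthonormal_sum continuous_L2_ball) auto
      also have "\<dots> \<ge> 1" by (simp add: sum_nonneg)
      finally have "1 \<le> ball_energy (4 ^ j0) (comb i b)" unfolding ball_sq .
      also have "\<dots> \<le> ball_energy (4 ^ j) (comb i b)"
        using that by (intro ball_energy_mono combc power_increasing) auto
      finally show ?thesis .
    qed
    have "\<exists>A. (\<forall>i<D. \<forall>b. ball_energy (4 ^ j) (comb i (A i)) \<le> ball_energy (4 ^ j) (comb i b)) \<and>
        (\<forall>i<D. \<forall>l<D. i \<noteq> l \<longrightarrow> ball_ip (4 ^ j) (comb i (A i)) (comb l (A l)) = 0)" if "j \<ge> j0" for j
    proof -
      interpret H: hermitian_form "L2_ball (4 ^ j)" "ball_ip (4 ^ j)" by (rule ball_hermitian)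
      have 1: "e i \<in> L2_ball (4 ^ j)" if "i < D" for i using ec[OF that] by (rule continuous_L2_ball)
      have 2: "H.sq (\<lambda>x. e i x + (\<Sum>j<i. b j * e j x)) > 0" if "i < D" for i b
        using comb_ge1[OF that \<open>j \<ge> j0\<close>, of b] unfolding comb_def ball_sq by simp
      show ?thesis
      proof (rule H.Gram_Schmidt[of D e, OF 1 2], assumption)
        fix A
        assume "\<And>i b. i < D \<Longrightarrow> H.sq (\<lambda>x. e i x + (\<Sum>j<i. A i j * e j x)) \<le> H.sq (\<lambda>x. e i x + (\<Sum>j<i. b j * e j x))"
          and "\<And>i i'. i < D \<Longrightarrow> i' < D \<Longrightarrow> i \<noteq> i' \<Longrightarrow>
            ball_ip (4 ^ j) (\<lambda>x. e i x + (\<Sum>l<i. A i l * e l x)) (\<lambda>x. e i' x + (\<Sum>l<i'. A i' l * e l x)) = 0"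
        then show ?thesis unfolding comb_def ball_sq by (intro exI[of _ A]) blast
      qed
    qed
    then obtain A where A: "\<And>j i b. j \<ge> j0 \<Longrightarrow> i < D \<Longrightarrow> ball_energy (4 ^ j) (comb i (A j i)) \<le> ball_energy (4 ^ j) (comb i b)"
      "\<And>j i l. j \<ge> j0 \<Longrightarrow> i < D \<Longrightarrow> l < D \<Longrightarrow> i \<noteq> l \<Longrightarrow> ball_ip (4 ^ j) (comb i (A j i)) (comb l (A j l)) = 0"
      by metis
    define f where "f j i = comb i (A j i)" for j i
    \<comment> \<open>The squared distance of \<open>e i\<close> from the span of its predecessors
      at radius \<open>4 ^ j\<close>. Being a minimum of increasing quantities, it increases with
      the radius.\<close>
    define \<delta> where "\<delta> j i = ball_energy (4 ^ j) (f j i)" for j i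
    have \<delta>1: "\<delta> j i \<ge> 1" if "j \<ge> j0" "i < D" for j i
      unfolding \<delta>_def f_def using comb_ge1 that by blast
    have \<delta>_min: "\<delta> j i \<le> ball_energy (4 ^ j) (f j' i)" if "j \<ge> j0" "i < D" for j j' i
      unfolding \<delta>_def f_def using A(1) that by blast
    have \<delta>_mono: "\<delta> j i \<le> \<delta> (Suc j) i" if "j \<ge> j0" "i < D" for j i
    proof -
      have "\<delta> j i \<le> ball_energy (4 ^ j) (f (Suc j) i)" by (rule \<delta>_min[OF that])
      also have "\<dots> \<le> \<delta> (Suc j) i"
        unfolding \<delta>_def f_def using that(2) by (intro ball_energy_mono combc power_increasing) auto
      finally show ?thesis .
    qed
    have four: "real (4 ^ j) + 1 \<le> 4 ^ Suc j" for j
    proof -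
      have "(1::real) \<le> 4 ^ j" by (rule one_le_power) simp
      then have "(4::real) ^ j + 1 \<le> 4 * 4 ^ j" by linarith
      then show ?thesis by simp
    qed
    have vol_le: "vol (4 ^ j) \<le> c0 * (4 ^ Suc j) ^ d" for j
    proof (rule order_trans[OF c0(2)])
      show "c0 * (real (4 ^ j) + 1) ^ d \<le> c0 * (4 ^ Suc j) ^ d"
        using c0(1) by (intro mult_left_mono power_mono four) auto
    qed
    \<comment> \<open>Zero coefficients are a competitor, so the minimum is at most the mass of
      \<open>e i\<close> itself.\<close>
    have \<delta>_le: "\<delta> j i \<le> C\<^sup>2 * c0 * (4 ^ Suc j) ^ q" if "j \<ge> j0" "i < D" for j i
    proof -
      have "\<delta> j i \<le> ball_energy (4 ^ j) (comb i (\<lambda>_. 0))" unfolding \<delta>_def f_def using A(1) that by blast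
      also have "comb i (\<lambda>_. 0) = e i" unfolding comb_def by simp
      also have "ball_energy (4 ^ j) (e i) \<le> (C * (1 + real (4 ^ j)) ^ k)\<^sup>2 * vol (4 ^ j)"
        using ec[OF that(2)] C[OF that(2)] by (rule ball_energy_le)
      also have "\<dots> \<le> (C * (4 ^ Suc j) ^ k)\<^sup>2 * (c0 * (4 ^ Suc j) ^ d)"
      proof (rule mult_mono[OF _ vol_le])
        have "(1 + real (4 ^ j)) ^ k \<le> (4 ^ Suc j) ^ k"
          using four[of j] by (intro power_mono) linarith+
        then have "C * (1 + real (4 ^ j)) ^ k \<le> C * (4 ^ Suc j) ^ k"
          using C1 by (intro mult_left_mono) auto
        then show "(C * (1 + real (4 ^ j)) ^ k)\<^sup>2 \<le> (C * (4 ^ Suc j) ^ k)\<^sup>2"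
          using C1 by (intro power_mono) auto
      qed auto
      also have "\<dots> = C\<^sup>2 * c0 * (4 ^ Suc j) ^ q"
      proof -
        have "X ^ q = (X ^ k)\<^sup>2 * X ^ d" for X :: real
          unfolding q_def by (simp only: power_add power_mult[symmetric] mult.commute[of 2])
        from this[of "4 ^ Suc j"] show ?thesis by (simp only: power_mult_distrib mult.assoc mult.left_commute[of c0])
      qed
      finally show ?thesis .
    qed
    have ln4: "ln ((4 ^ Suc j) ^ n) = real n * (real (Suc j) * LN)" for j n
      unfolding LN_def by (simp only: ln_realpow zero_less_power zero_less_numeral)
    define u where "u j = ln (vol (4 ^ j))" for j
    \<comment> \<open>An average over \<open>i\<close> and not a sum, which makes its growth rate
      independent of \<open>D\<close>; the constant \<open>C\<close> enters only the additive
      term.\<close>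
    define w where "w j = (\<Sum>i<D. ln (\<delta> j i)) / real D" for j
    have vol1: "vol (4 ^ j) \<ge> 1" for j by (rule B_measure_ge_1) simp
    have u_mono: "u j \<le> u j'" if "j \<le> j'" for j j'
      unfolding u_def using vol1[of j] that by (intro ln_mono vol_mono power_increasing) auto
    have u_le: "u j \<le> ln c0 + real d * (real (Suc j) * LN)" for j
    proof -
      have "u j \<le> ln (c0 * (4 ^ Suc j) ^ d)" unfolding u_def using vol_le[of j] vol1[of j] by (intro ln_mono) auto
      also have "\<dots> = ln c0 + ln ((4 ^ Suc j) ^ d)" using c0(1) by (intro ln_mult_pos) auto
      finally show ?thesis unfolding ln4 .
    qed
    have w_le: "w j \<le> ln (C\<^sup>2 * c0) + real q * (real (Suc j) * LN)" if "j \<ge> j0" for j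
    proof -
      have "ln (\<delta> j i) \<le> ln (C\<^sup>2 * c0) + real q * (real (Suc j) * LN)" if "i < D" for i
      proof -
        have "ln (\<delta> j i) \<le> ln (C\<^sup>2 * c0 * (4 ^ Suc j) ^ q)"
          using \<delta>_le[OF \<open>j \<ge> j0\<close> that] \<delta>1[OF \<open>j \<ge> j0\<close> that] by (intro ln_mono) auto
        also have "\<dots> = ln (C\<^sup>2 * c0) + ln ((4 ^ Suc j) ^ q)" using c0(1) C1 by (intro ln_mult_pos) auto
        finally show ?thesis unfolding ln4 .
      qed
      then have "(\<Sum>i<D. ln (\<delta> j i)) \<le> real D * (ln (C\<^sup>2 * c0) + real q * (real (Suc j) * LN))"
        using sum_bounded_above[of "{..<D}" "\<lambda>i. ln (\<delta> j i)"] by simp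
      then show ?thesis unfolding w_def using D by (simp add: field_simps)
    qed
    have w_mono: "w j \<le> w (Suc j)" if "j \<ge> j0" for j
    proof -
      have "ln (\<delta> j i) \<le> ln (\<delta> (Suc j) i)" if "i < D" for i
        using \<delta>_mono[OF \<open>j \<ge> j0\<close> that] \<delta>1[OF \<open>j \<ge> j0\<close> that] by (intro ln_mono) auto
      then show ?thesis unfolding w_def using D by (intro divide_right_mono sum_mono) auto
    qed
    \<comment> \<open>The window over \<open>p\<close> consecutive scales makes an increment
      telescope to \<open>u J - u (j0 + l)\<close>, the logarithm of the volume ratio needed later.
      Both parts are nondecreasing, so an increment of at most 1 bounds the first by
      \<open>a\<close> and the second by \<open>b\<close>.\<close>
    define \<Phi> where "\<Phi> l = (\<Sum>i<p. u (j0 + l + i)) / a + w (j0 + l + p) / b" for l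
    define T where "T = real (j0 + p + 1)"
    have \<Phi>_le: "\<Phi> l \<le> (real p * real d * LN / a + real q * LN / b) * real l
        + (real p * (ln c0 + real d * (T * LN)) / a + (ln (C\<^sup>2 * c0) + real q * (T * LN)) / b)" for l
    proof -
      have "u (j0 + l + i) \<le> ln c0 + real d * ((T + real l) * LN)" if "i < p" for i
      proof -
        have "u (j0 + l + i) \<le> u (j0 + l + p)" using that by (intro u_mono) simp
        also have "\<dots> \<le> ln c0 + real d * (real (Suc (j0 + l + p)) * LN)" by (rule u_le)
        also have "real (Suc (j0 + l + p)) = T + real l" unfolding T_def by simp
        finally show ?thesis .
      qed
      then have "(\<Sum>i<p. u (j0 + l + i)) \<le> real p * (ln c0 + real d * ((T + real l) * LN))"
        using sum_bounded_above[of "{..<p}" "\<lambda>i. u (j0 + l + i)"] by simp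
      then have 1: "(\<Sum>i<p. u (j0 + l + i)) / a \<le> real p * (ln c0 + real d * ((T + real l) * LN)) / a"
        using a by (simp add: divide_right_mono)
      have "w (j0 + l + p) \<le> ln (C\<^sup>2 * c0) + real q * (real (Suc (j0 + l + p)) * LN)" by (intro w_le) simp
      also have "real (Suc (j0 + l + p)) = T + real l" unfolding T_def by simp
      finally have 2: "w (j0 + l + p) / b \<le> (ln (C\<^sup>2 * c0) + real q * ((T + real l) * LN)) / b"
        using b by (simp add: divide_right_mono)
      have "real p * (ln c0 + real d * ((T + real l) * LN)) / a + (ln (C\<^sup>2 * c0) + real q * ((T + real l) * LN)) / b
        = (real p * real d * LN / a + real q * LN / b) * real l
        + (real p * (ln c0 + real d * (T * LN)) / a + (ln (C\<^sup>2 * c0) + real q * (T * LN)) / b)"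
        by (simp add: algebra_simps add_divide_distrib)
      then show ?thesis unfolding \<Phi>_def using 1 2 by linarith
    qed
    have \<kappa>: "real p * real d * LN / a + real q * LN / b < 1"
    proof -
      have "real p * real d * LN / a \<le> 1 / 4" using a unfolding a_def by (simp add: field_simps)
      moreover have "real q * LN / b \<le> 1 / 4" using b unfolding b_def by (simp add: field_simps)
      ultimately show ?thesis by linarith
    qed
    \<comment> \<open>Growth constant valid for the normalised vectors of every later scale. It
      depends on the family, but it only affects how far out the scale \<open>L\<close> must
      lie.\<close>
    define C' where "C' = real D * C"
    define L where "L = nat \<lceil>4 * Q' * C'\<^sup>2 * exp b\<rceil>"
    obtain l where l: "l \<ge> L" "\<Phi> (Suc l) - \<Phi> l \<le> 1" by (rule good_scale_exists[OF \<Phi>_le \<kappa>])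
    define J where "J = j0 + l + p"
    have J: "J \<ge> j0" unfolding J_def by simp
    define r where "r = (4::nat) ^ (j0 + l)"
    define R where "R = (4::nat) ^ J"
    have "(\<Sum>i<p. u (j0 + Suc l + i)) - (\<Sum>i<p. u (j0 + l + i)) = u (j0 + l + p) - u (j0 + l)"
      using sum_lessThan_telescope[of "\<lambda>i. u (j0 + l + i)" p] by (simp add: sum_subtractf)
    then have "\<Phi> (Suc l) - \<Phi> l = (u J - u (j0 + l)) / a + (w (Suc J) - w J) / b"
      unfolding \<Phi>_def J_def by (simp add: diff_divide_distrib[symmetric] add_diff_add)
    moreover have ud: "u J - u (j0 + l) \<ge> 0" using u_mono[of "j0 + l" J] unfolding J_def by simp
    moreover have wd: "w (Suc J) - w J \<ge> 0" using w_mono[OF J] by simp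
    ultimately have "(u J - u (j0 + l)) / a \<le> 1" "(w (Suc J) - w J) / b \<le> 1"
      using l(2) a b divide_nonneg_pos[OF ud a] divide_nonneg_pos[OF wd b] by linarith+
    then have ua: "u J - u (j0 + l) \<le> a" and wb: "w (Suc J) - w J \<le> b" using a b by simp_all
    have volr: "vol R / vol r \<le> exp a"
    proof -
      have "vol R / vol r = exp (u J - u (j0 + l))"
        unfolding u_def R_def r_def using vol1[of J] vol1[of "j0 + l"] by (simp add: exp_diff)
      then show ?thesis using ua by simp
    qed
    \<comment> \<open>The family that is orthogonal at the larger radius
      \<open>4 * R = 4 ^ Suc J\<close>, normalised there.\<close>
    define \<phi> where "\<phi> i = (\<lambda>x. complex_of_real (1 / sqrt (\<delta> (Suc J) i)) * f (Suc J) i x)" for i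
    have \<delta>p: "\<delta> (Suc J) i > 0" if "i < D" for i using \<delta>1[of "Suc J" i] that J by simp
    have fHF: "f j i \<in> HF S \<mu> k" if "i < D" for j i unfolding f_def by (rule combHF[OF that])
    have \<phi>HF: "\<phi> i \<in> HF S \<mu> k" if "i < D" for i unfolding \<phi>_def by (rule HF_scale[OF fHF[OF that]])
    have \<phi>growth: "growth_bound k C' (\<phi> i)" if i: "i < D" for i
    proof -
      \<comment> \<open>The initial ball lies inside the larger one, so the mass on it is at most
        \<open>\<delta> (Suc J) i\<close>; normalisation then cancels the square root, and no
        dependence on the scale remains.\<close>
      have "ball_energy (4 ^ j0) (f (Suc J) i) \<le> \<delta> (Suc J) i"
        unfolding \<delta>_def f_def using i J by (intro ball_energy_mono combc power_increasing) auto
      then have "growth_bound k (real (Suc i) * C * sqrt (\<delta> (Suc J) i)) (f (Suc J) i)"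
        unfolding f_def comb_alt using i e C C1 on
        by (intro orthonormal_coefficients_growth[where R = "4 ^ j0"]) auto
      from growth_bound_scale[OF this, of "complex_of_real (1 / sqrt (\<delta> (Suc J) i))"]
      have "growth_bound k (real (Suc i) * C) (\<phi> i)"
        unfolding \<phi>_def using \<delta>p[OF i] by (simp add: norm_divide)
      then show ?thesis
        unfolding C'_def using i C1 by (elim growth_bound_weaken) (intro mult_right_mono; simp)
    qed
    have fL: "f j i \<in> L2_ball R'" if "i < D" for j i R'
      using HF_continuous[OF fHF[OF that]] by (rule continuous_L2_ball)
    have \<phi>on: "ball_ip (4 * R) (\<phi> i) (\<phi> i') = (if i = i' then 1 else 0)" if i: "i < D" "i' < D" for i i'
    proof -
      interpret H: hermitian_form "L2_ball (4 * R)" "ball_ip (4 * R)" by (rule ball_hermitian)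
      have R4: "4 * R = 4 ^ Suc J" unfolding R_def by simp
      have ip: "ball_ip (4 * R) (\<phi> i) (\<phi> i') =
          complex_of_real (1 / sqrt (\<delta> (Suc J) i)) * (complex_of_real (1 / sqrt (\<delta> (Suc J) i')) * ball_ip (4 * R) (f (Suc J) i) (f (Suc J) i'))"
      proof -
        have "ball_ip (4 * R) (\<lambda>x. c * F x) (\<lambda>x. c' * G x) = c * (cnj c' * ball_ip (4 * R) F G)"
          if "F \<in> L2_ball (4 * R)" "G \<in> L2_ball (4 * R)" for F G c c'
          using H.ip_scale[OF that(1) H.V_scale[OF that(2)]] H.ip_scale_right[OF that(2,1)] by simp
        from this[OF fL[OF i(1)] fL[OF i(2)]] show ?thesis
          unfolding \<phi>_def by (simp only: complex_cnj_complex_of_real)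
      qed
      show ?thesis
      proof (cases "i = i'")
        case True
        have "ball_ip (4 * R) (f (Suc J) i) (f (Suc J) i) = complex_of_real (\<delta> (Suc J) i)"
          using H.ip_self[OF fL[OF i(1)]] unfolding ball_sq \<delta>_def R4 .
        moreover have "1 / sqrt (\<delta> (Suc J) i) * (1 / sqrt (\<delta> (Suc J) i) * \<delta> (Suc J) i) = 1"
          using \<delta>p[OF i(1)] by (simp add: field_simps)
        ultimately show ?thesis
          unfolding ip using True by (simp only: of_real_mult[symmetric]) simp
      next
        case False
        then have "ball_ip (4 * R) (f (Suc J) i) (f (Suc J) i') = 0"
          using A(2)[of "Suc J" i i'] i J unfolding f_def R4 by simp
        then show ?thesis unfolding ip using False by simp
      qed
    qed
    have rR: "1 \<le> r" "r \<le> R" unfolding r_def R_def J_def by (auto intro: power_increasing)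
    have upper: "(\<Sum>i<D. ball_energy R (\<phi> i))
        \<le> 2 * (vol R / vol r) + real D * ((real r)\<^sup>2 * (Q / (real R)\<^sup>2 + Q' * C'\<^sup>2 / (real R) ^ 3))"
      by (rule Q(3)[OF \<phi>HF \<phi>growth \<phi>on rR])
    \<comment> \<open>The vectors built for the larger radius are still competitors for the minimum
      at radius \<open>R\<close>.\<close>
    have each: "exp (- (ln (\<delta> (Suc J) i) - ln (\<delta> J i))) \<le> ball_energy R (\<phi> i)" if i: "i < D" for i
    proof -
      interpret H: hermitian_form "L2_ball R" "ball_ip R" by (rule ball_hermitian)
      have "exp (- (ln (\<delta> (Suc J) i) - ln (\<delta> J i))) = \<delta> J i / \<delta> (Suc J) i"
        using \<delta>1[OF J i] \<delta>p[OF i] by (simp add: exp_diff)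
      also have "\<dots> \<le> ball_energy R (f (Suc J) i) / \<delta> (Suc J) i"
        using \<delta>_min[OF J i, of "Suc J"] \<delta>p[OF i] unfolding R_def by (intro divide_right_mono) auto
      also have "\<dots> = ball_energy R (\<phi> i)"
        using H.sq_scale[OF fL[OF i], of "complex_of_real (1 / sqrt (\<delta> (Suc J) i))" "Suc J"] \<delta>p[OF i]
        unfolding \<phi>_def ball_sq by (simp add: norm_divide power_divide)
      finally show ?thesis .
    qed
    have "(\<Sum>i<D. ln (\<delta> (Suc J) i) - ln (\<delta> J i)) = real D * (w (Suc J) - w J)"
      unfolding w_def using D by (simp add: sum_subtractf diff_divide_distrib[symmetric])
    also have "\<dots> \<le> real D * b" using wb D by simp
    finally have "real D * exp (- b) \<le> (\<Sum>i<D. exp (- (ln (\<delta> (Suc J) i) - ln (\<delta> J i))))" by (rule sum_exp_ge)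
    also have "\<dots> \<le> (\<Sum>i<D. ball_energy R (\<phi> i))" using each by (intro sum_mono) auto
    finally have lower: "real D * exp (- b) \<le> (\<Sum>i<D. ball_energy R (\<phi> i))" .
    have Rr: "real R = real r * 4 ^ p" unfolding R_def r_def J_def by (simp add: power_add)
    have Rpos: "real R > 0" "real r > 0" unfolding R_def r_def by simp_all
    have t1: "(real r)\<^sup>2 * (Q / (real R)\<^sup>2) \<le> exp (- b) / 4"
    proof -
      have "(real r)\<^sup>2 * (Q / (real R)\<^sup>2) = Q * (1 / 16) ^ p"
        unfolding Rr using Rpos(2) by (simp add: power_mult_distrib power_divide power_mult[symmetric] mult.commute[of p] power_mult)
      also have "\<dots> \<le> Q * (exp (- b) / (4 * (Q + 1)))" using p Q(1) by (intro mult_left_mono) auto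
      also have "\<dots> \<le> exp (- b) / 4" using Q(1) by (simp add: field_simps)
      finally show ?thesis .
    qed
    \<comment> \<open>Replacing \<open>r\<close> by \<open>R\<close> leaves a term of order
      \<open>1 / R\<close>; since \<open>R \<ge> l \<ge> L\<close>, the choice of \<open>L\<close>
      makes it small.\<close>
    have t2: "(real r)\<^sup>2 * (Q' * C'\<^sup>2 / (real R) ^ 3) \<le> exp (- b) / 4"
    proof -
      have "real l \<le> real R"
      proof -
        have "l < 4 ^ l" by (rule power_gt_expt) simp
        also have "(4::nat) ^ l \<le> R" unfolding R_def J_def by (intro power_increasing) auto
        finally show ?thesis by simp
      qed
      moreover have "4 * Q' * C'\<^sup>2 * exp b \<le> real L" unfolding L_def by linarith
      ultimately have RL: "4 * Q' * C'\<^sup>2 * exp b \<le> real R" using l(1) by linarith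
      have "(real r)\<^sup>2 * (Q' * C'\<^sup>2 / (real R) ^ 3) \<le> (real R)\<^sup>2 * (Q' * C'\<^sup>2 / (real R) ^ 3)"
        using rR Q(2) by (intro mult_right_mono power_mono) auto
      also have "\<dots> = Q' * C'\<^sup>2 / real R" using Rpos by (simp add: power2_eq_square power3_eq_cube)
      also have "\<dots> \<le> exp (- b) / 4"
        using RL Rpos by (simp add: field_simps exp_minus)
      finally show ?thesis .
    qed
    have "real D * ((real r)\<^sup>2 * (Q / (real R)\<^sup>2 + Q' * C'\<^sup>2 / (real R) ^ 3)) \<le> real D * (exp (- b) / 2)"
    proof (rule mult_left_mono)
      show "(real r)\<^sup>2 * (Q / (real R)\<^sup>2 + Q' * C'\<^sup>2 / (real R) ^ 3) \<le> exp (- b) / 2"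
        unfolding distrib_left using t1 t2 by linarith
    qed simp
    \<comment> \<open>The two error terms consume half of the lower bound; the other half faces a
      quantity free of \<open>D\<close>.\<close>
    then have "real D * exp (- b) \<le> 2 * exp a + real D * (exp (- b) / 2)"
      using lower upper volr by linarith
    then have "real D * exp (- b) \<le> 4 * exp a" by simp
    then show ?thesis by (simp add: exp_minus field_simps)
  qed simp
  show ?thesis by (rule that) (use main in blast)
qed

end

section \<open>From linear independence to orthonormality on a ball\<close>

context haar_growth
begin

text \<open>The integral gives vanishing only almost everywhere on the ball; continuity upgrades
  this at points that have a neighbourhood inside the ball.\<close>

lemma ball_energy_eq_0_imp:
  assumes v: "continuous_on UNIV v" and 0: "ball_energy R v = 0" and x: "x \<in> interior (B R)"
  shows "v x = 0"
proof (rule ccontr)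
  assume vx: "v x \<noteq> 0"
  let ?h = "\<lambda>x. indicator (B R) x * (cmod (v x))\<^sup>2"
  have [measurable]: "v \<in> borel_measurable borel" using v by (rule borel_measurable_continuous_onI)
  have ae: "AE x in m. ?h x = 0"
    using 0 integral_nonneg_eq_0_iff_AE[OF integrable_ball_energy[OF v, of R]] unfolding ball_energy_def by simp
  have N: "{x \<in> space m. \<not> ?h x = 0} \<in> sets m" by measurable
  have null: "emeasure m {x \<in> space m. \<not> ?h x = 0} = 0"
    by (rule iffD1[OF AE_iff_measurable[OF N refl] ae])
  have "interior (B R) \<inter> {x. v x \<noteq> 0} \<subseteq> {x \<in> space m. \<not> ?h x = 0}"
    using subsetD[OF interior_subset[of "B R"]] by auto
  from emeasure_mono[OF this N] have "emeasure m (interior (B R) \<inter> {x. v x \<noteq> 0}) = 0"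
    unfolding null by simp
  moreover have "open (interior (B R) \<inter> {x. v x \<noteq> 0})"
    using v by (intro open_Int open_interior open_Collect_neq) auto
  ultimately show False using open_pos[of "interior (B R) \<inter> {x. v x \<noteq> 0}" x] x vx by simp
qed

end

context compactly_generated
begin

text \<open>The linear relations valid on \<open>B n\<close> decrease with \<open>n\<close>, and
  only the trivial one is global. In the inductive step a nontrivial relation on a large ball must
  involve \<open>e D\<close>; normalised there it is already unique on \<open>B N\<close>, so the
  relations on all larger balls coincide and give a global one.\<close>

lemma independent_on_ball:
  fixes e :: "nat \<Rightarrow> 'a \<Rightarrow> complex"
  assumes "\<And>c. (\<And>x. (\<Sum>j<D. c j * e j x) = 0) \<Longrightarrow> \<forall>j<D. c j = 0"
  shows "\<exists>N. \<forall>c. (\<forall>x\<in>B N. (\<Sum>j<D. c j * e j x) = 0) \<longrightarrow> (\<forall>j<D. c j = 0)"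
  using assms
proof (induction D)
  case (Suc D)
  have "\<forall>j<D. c j = 0" if "\<And>x. (\<Sum>j<D. c j * e j x) = 0" for c
  proof (intro allI impI)
    fix j assume "j < D"
    then show "c j = 0" using Suc.prems[of "c(D := 0)"] that by (auto dest!: spec[of _ j])
  qed
  then obtain N where N: "\<And>c. (\<And>x. x \<in> B N \<Longrightarrow> (\<Sum>j<D. c j * e j x) = 0) \<Longrightarrow> \<forall>j<D. c j = 0"
    using Suc.IH by blast
  show ?case
  proof (rule ccontr)
    assume "\<nexists>N. \<forall>c. (\<forall>x\<in>B N. (\<Sum>j<Suc D. c j * e j x) = 0) \<longrightarrow> (\<forall>j<Suc D. c j = 0)"
    then have "\<forall>n. \<exists>c. (\<forall>x\<in>B n. (\<Sum>j<Suc D. c j * e j x) = 0) \<and> (\<exists>j<Suc D. c j \<noteq> 0)" by blast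
    then obtain c where c: "\<And>n x. x \<in> B n \<Longrightarrow> (\<Sum>j<Suc D. c n j * e j x) = 0" "\<And>n. \<exists>j<Suc D. c n j \<noteq> 0"
      by metis
    have top: "c n D \<noteq> 0" if "n \<ge> N" for n
    proof
      assume z: "c n D = 0"
      have "\<forall>j<D. c n j = 0"
        by (rule N) (use c(1)[of _ n] z B_mono[OF that] in auto)
      then show False using c(2)[of n] z by (auto simp: less_Suc_eq)
    qed
    define b where "b n j = c n j / c n D" for n j
    have b: "(\<Sum>j<D. b n j * e j x) = - e D x" if "n \<ge> N" "x \<in> B n" for n x
    proof -
      have "(\<Sum>j<D. c n j * e j x) = - (c n D * e D x)"
        using c(1)[OF that(2)] by (simp add: eq_neg_iff_add_eq_0)
      then have "(\<Sum>j<D. c n j * e j x) / c n D = - e D x" using top[OF that(1)] by simp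
      then show ?thesis unfolding b_def by (simp add: sum_divide_distrib)
    qed
    have eq: "b n j = b N j" if "n \<ge> N" "j < D" for n j
    proof -
      have "\<forall>j<D. b n j - b N j = 0"
      proof (rule N)
        fix x assume "x \<in> B N"
        then show "(\<Sum>j<D. (b n j - b N j) * e j x) = 0"
          using b[of n x] b[of N x] B_mono[OF that(1)] that(1) by (auto simp: left_diff_distrib sum_subtractf)
      qed
      then show ?thesis using that by simp
    qed
    have "(\<Sum>j<Suc D. ((b N)(D := 1)) j * e j x) = 0" for x
    proof -
      define n where "n = max N (len x)"
      have "x \<in> B n" unfolding n_def by (simp add: in_B_iff)
      then have "(\<Sum>j<D. b n j * e j x) = - e D x" by (intro b) (simp_all add: n_def)
      moreover have "(\<Sum>j<D. b n j * e j x) = (\<Sum>j<D. b N j * e j x)"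
        using eq[of n] by (intro sum.cong refl) (simp add: n_def)
      ultimately show ?thesis by simp
    qed
    then have "\<forall>j<Suc D. ((b N)(D := 1)) j = 0" by (rule Suc.prems)
    then show False by (auto dest: spec[of _ D])
  qed
qed simp

end

context courteous_walk
begin

text \<open>Independence becomes definiteness of the form on one large ball, where Gram-Schmidt and
  normalisation produce a family of the same size to which \<open>orthonormal_family_bound\<close>
  applies.\<close>

lemma independent_family_bound:
  obtains N :: real where "\<And>(e :: nat \<Rightarrow> 'a \<Rightarrow> complex) D. (\<And>i. i < D \<Longrightarrow> e i \<in> HF S \<mu> k) \<Longrightarrow>
    (\<And>c. (\<And>x. (\<Sum>j<D. c j * e j x) = 0) \<Longrightarrow> \<forall>j<D. c j = 0) \<Longrightarrow> real D \<le> N"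
proof -
  obtain N :: real where N: "\<And>(e :: nat \<Rightarrow> 'a \<Rightarrow> complex) D j0. (\<And>i. i < D \<Longrightarrow> e i \<in> HF S \<mu> k) \<Longrightarrow>
    (\<And>i j. i < D \<Longrightarrow> j < D \<Longrightarrow> ball_ip (4 ^ j0) (e i) (e j) = (if i = j then 1 else 0)) \<Longrightarrow> real D \<le> N"
    using orthonormal_family_bound[of k] by blast
  have main: "real D \<le> N" if e: "\<And>i. i < D \<Longrightarrow> e i \<in> HF S \<mu> k"
    and ind: "\<And>c. (\<And>x. (\<Sum>j<D. c j * e j x) = 0) \<Longrightarrow> \<forall>j<D. c j = 0" for e :: "nat \<Rightarrow> 'a \<Rightarrow> complex" and D
  proof -
    obtain n where n: "\<And>c. (\<And>x. x \<in> B n \<Longrightarrow> (\<Sum>j<D. c j * e j x) = 0) \<Longrightarrow> \<forall>j<D. c j = 0"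
      using independent_on_ball[where D = D and e = e, OF ind] by blast
    \<comment> \<open>Since \<open>4 ^ j0\<close> exceeds \<open>n + 2\<close>, the ball
      \<open>B n\<close>, which detects all relations, lies in the interior of the ball of radius
      \<open>4 ^ j0\<close>.\<close>
    define j0 where "j0 = n + 2"
    have "j0 < 4 ^ j0" by (rule power_gt_expt) simp
    then have Bn: "B n \<subseteq> interior (B (4 ^ j0))"
      using B_subset_interior[of n] interior_mono[OF B_mono[of "n + 2" "4 ^ j0"]] unfolding j0_def by auto
    interpret H: hermitian_form "L2_ball (4 ^ j0)" "ball_ip (4 ^ j0)" by (rule ball_hermitian)
    have ec: "continuous_on UNIV (e i)" if "i < D" for i using HF_continuous[OF e[OF that]] .
    have combHF: "(\<lambda>x. e i x + (\<Sum>j<i. b j * e j x)) \<in> HF S \<mu> k" if "i < D" for i b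
      using that by (intro HF_add e HF_sum) auto
    have pos: "H.sq (\<lambda>x. e i x + (\<Sum>j<i. b j * e j x)) > 0" if i: "i < D" for i b
    proof (rule ccontr)
      assume "\<not> H.sq (\<lambda>x. e i x + (\<Sum>j<i. b j * e j x)) > 0"
      then have z: "ball_energy (4 ^ j0) (\<lambda>x. e i x + (\<Sum>j<i. b j * e j x)) = 0"
        using ball_energy_nonneg[of "4 ^ j0" "\<lambda>x. e i x + (\<Sum>j<i. b j * e j x)"] unfolding ball_sq by linarith
      \<comment> \<open>A combination of mass 0 vanishes on \<open>B n\<close>, and its coefficient
        1 at \<open>i\<close> then contradicts the choice of \<open>n\<close>.\<close>
      define c where "c j = (if j < i then b j else if j = i then 1 else 0)" for j
      have c: "(\<Sum>j<D. c j * e j x) = e i x + (\<Sum>j<i. b j * e j x)" for x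
      proof -
        have "(\<Sum>j<D. c j * e j x) = (\<Sum>j<Suc i. c j * e j x)"
          using i by (intro sum.mono_neutral_right) (auto simp: c_def)
        then show ?thesis by (simp add: c_def)
      qed
      have "\<forall>j<D. c j = 0"
        by (rule n) (use ball_energy_eq_0_imp[OF HF_continuous[OF combHF[OF i]] z] Bn c in auto)
      then show False using i by (auto simp: c_def dest: spec[of _ i])
    qed
    obtain a where a: "\<And>i. i < D \<Longrightarrow> H.sq (\<lambda>x. e i x + (\<Sum>j<i. a i j * e j x)) > 0"
      "\<And>i j. i < D \<Longrightarrow> j < D \<Longrightarrow> i \<noteq> j \<Longrightarrow>
       ball_ip (4 ^ j0) (\<lambda>x. e i x + (\<Sum>l<i. a i l * e l x)) (\<lambda>x. e j x + (\<Sum>l<j. a j l * e l x)) = 0"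
    proof (rule H.Gram_Schmidt[of D e, OF _ pos])
      show "\<And>i. i < D \<Longrightarrow> e i \<in> L2_ball (4 ^ j0)" using ec continuous_L2_ball by blast
    qed (use that in blast)+
    define f where "f i = (\<lambda>x. e i x + (\<Sum>j<i. a i j * e j x))" for i
    define s where "s i = complex_of_real (1 / sqrt (H.sq (f i)))" for i
    have fHF: "f i \<in> HF S \<mu> k" if "i < D" for i unfolding f_def by (rule combHF[OF that])
    have fL: "f i \<in> L2_ball (4 ^ j0)" if "i < D" for i
      using HF_continuous[OF fHF[OF that]] by (rule continuous_L2_ball)
    show ?thesis
    proof (rule N[of D "\<lambda>i x. s i * f i x" j0])
      show "(\<lambda>x. s i * f i x) \<in> HF S \<mu> k" if "i < D" for i by (rule HF_scale[OF fHF[OF that]])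
      fix i j assume ij: "i < D" "j < D"
      have ip: "ball_ip (4 ^ j0) (\<lambda>x. s i * f i x) (\<lambda>x. s j * f j x) = s i * (cnj (s j) * ball_ip (4 ^ j0) (f i) (f j))"
        using H.ip_scale[OF fL[OF ij(1)] H.V_scale[OF fL[OF ij(2)]]] H.ip_scale_right[OF fL[OF ij(2)] fL[OF ij(1)]] by simp
      show "ball_ip (4 ^ j0) (\<lambda>x. s i * f i x) (\<lambda>x. s j * f j x) = (if i = j then 1 else 0)"
      proof (cases "i = j")
        case True
        have "H.sq (f i) > 0" unfolding f_def by (rule a(1)[OF ij(1)])
        then have "1 / sqrt (H.sq (f i)) * (1 / sqrt (H.sq (f i)) * H.sq (f i)) = 1"
          by (simp add: field_simps)
        then have "complex_of_real (1 / sqrt (H.sq (f i)) * (1 / sqrt (H.sq (f i)) * H.sq (f i))) = 1" by (simp only: of_real_1)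
        then show ?thesis
          unfolding ip using True H.ip_self[OF fL[OF ij(1)]] unfolding s_def by (simp only: of_real_mult complex_cnj_complex_of_real) simp
      next
        case False
        then show ?thesis unfolding ip using a(2)[OF ij False] unfolding f_def by simp
      qed
    qed
  qed
  show ?thesis by (rule that) (use main in blast)
qed

end

lemma sum_fun_apply: "(\<Sum>i\<in>I. f i) x = (\<Sum>i\<in>I. f i x :: 'b::comm_monoid_add)"
  by (induction I rule: infinite_finite_induct) (auto simp: zero_fun_def plus_fun_def)

theorem theorem1p5:
  fixes S :: "'a::{topological_group_add,t2_space} set"
    and m \<mu> :: "'a measure"
    and k :: nat
  assumes "locally_compact_space (euclidean :: 'a topology)"
    and "compact_generating_set S"
    and "left_haar_measure m"
    and "emeasure m S = 1"
    and "polynomial_growth S m"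
    and "courteous S m \<mu>"
    and "k \<ge> 1"
  shows "finite_dimensional_space (HF S \<mu> k)"
proof -
  interpret courteous_walk S m \<mu> using assms by unfold_locales
  interpret vs: vector_space fun_scale by (rule vector_space_fun_scale)
  obtain N :: real where N: "\<And>(e :: nat \<Rightarrow> 'a \<Rightarrow> complex) D. (\<And>i. i < D \<Longrightarrow> e i \<in> HF S \<mu> k) \<Longrightarrow>
    (\<And>c. (\<And>x. (\<Sum>j<D. c j * e j x) = 0) \<Longrightarrow> \<forall>j<D. c j = 0) \<Longrightarrow> real D \<le> N"
    using independent_family_bound[of k] by blast
  have sub: "vs.subspace (HF S \<mu> k)"
    using HF_zero[of k] HF_add[of _ k] HF_scale[of _ k]
    by (intro vs.subspaceI) (simp_all add: zero_fun_def plus_fun_def fun_scale_def)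
  \<comment> \<open>A maximal independent set exists before any finiteness is known; the bound on
    its finite subsets then makes it finite.\<close>
  obtain E where E: "E \<subseteq> HF S \<mu> k" "vs.independent E" "HF S \<mu> k \<subseteq> vs.span E"
    using vs.maximal_independent_subset by blast
  have card_le: "real (card F) \<le> N" if F: "F \<subseteq> E" "finite F" for F
  proof -
    obtain e where e: "bij_betw e {..<card F} F"
      using ex_bij_betw_nat_finite[OF F(2)] by (auto simp: atLeast0LessThan)
    show ?thesis
    proof (rule N)
      show "e i \<in> HF S \<mu> k" if "i < card F" for i
        using bij_betwE[OF e] that F(1) E(1) by blast
      fix c :: "nat \<Rightarrow> complex"
      assume c: "\<And>x. (\<Sum>j<card F. c j * e j x) = 0"
      \<comment> \<open>Transports the coefficients from indices to functions, as
        \<open>vs.independentD\<close> requires.\<close>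
      define u where "u v = c (the_inv_into {..<card F} e v)" for v
      have ue: "u (e j) = c j" if "j < card F" for j
        unfolding u_def using that bij_betw_imp_inj_on[OF e] by (simp add: the_inv_into_f_f)
      have "(\<Sum>v\<in>F. fun_scale (u v) v) = (\<Sum>j<card F. fun_scale (u (e j)) (e j))"
        by (rule sum.reindex_bij_betw[OF e, symmetric])
      also have "\<dots> = 0"
        using c by (auto simp: fun_eq_iff sum_fun_apply fun_scale_def ue zero_fun_def)
      finally have "(\<Sum>v\<in>F. fun_scale (u v) v) = 0" .
      then have "u v = 0" if "v \<in> F" for v
        using vs.independentD[OF E(2) F(2,1)] that by blast
      then show "\<forall>j<card F. c j = 0" using ue bij_betwE[OF e] by (metis lessThan_iff)
    qed
  qed
  have "finite E"
  proof (rule ccontr)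
    assume "infinite E"
    then obtain F where F: "finite F" "card F = nat \<lceil>N\<rceil> + 1" "F \<subseteq> E"
      using infinite_arbitrarily_large by blast
    then show False using card_le[OF F(3,1)] by linarith
  qed
  moreover have "vs.span E = HF S \<mu> k" by (rule vs.span_subspace[OF E(1,3) sub])
  ultimately show ?thesis unfolding finite_dimensional_space_def by blast
qed

end
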